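(* Let $T$ be an invertible real $2d\times 2d$ matrix, written in $d\times d$ blocks together with its inverse as $$T=\begin{pmatrix} A_0 & B_0\\ C_0 & D_0\end{pmatrix},\qquad T^{-1}=\begin{pmatrix} A & B\\ C & D\end{pmatrix}.$$ Let $\mu\in\mathcal S'(\mathbb R^d)$ satisfy $$W_T(\mu)=\sum_{(r,s)\in R\times S} c_{r,s}\,\delta_{(r,s)}$$ with $R,S\subset\mathbb R^d$ uniformly discrete sets and $c_{r,s}\in\mathbb C$, and suppose that: (i) $\sup_{s\in S}|c_{r,s}|<\infty$ for every $r\in R$, and $\sup_{r\in R}|c_{r,s}|<\infty$ for every $s\in S$; (ii) $\det(B_0-D_0)\neq 0$; (iii) $\det(A+B)\neq 0$. Then $\mu$ and $\widehat\mu$ are measures whose supports, $\Lambda=\operatorname{supp}\mu$ and $\Sigma=\operatorname{supp}\widehat\mu$, are uniformly discrete. If furthermore $W_T$ is in the Cohen class, then $\Lambda\subseteq R$ and $\Sigma\subseteq S$.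
   Context: Tempered distributions are conjugate-linear functionals on the Schwartz space, a function $f$ acting by $\langle f,\phi\rangle=\int f\overline{\phi}$. The Fourier transform is $\widehat f(\omega)=\int_{\mathbb R^d} f(t)e^{-2\pi i\omega t}\,dt$, extended to $\mathcal S'(\mathbb R^d)$ in the usual way; $\delta_p$ is the Dirac mass at $p$. Matrix-Wigner transform: for $f\in\mathcal S(\mathbb R^d)$, $$W_T(f)(x,\omega)=\int_{\mathbb R^d}e^{-2\pi i t\omega}f(A_0x+B_0t)\,\overline{f(C_0x+D_0t)}\,dt,\qquad x,\omega\in\mathbb R^d.$$ It extends to $\mu\in\mathcal S'(\mathbb R^d)$ by $W_T(\mu)=\mathcal F_2\big(P_T(\mu\otimes\overline\mu)\big)\in\mathcal S'(\mathbb R^{2d})$, where $P_T$ is the extension to $\mathcal S'(\mathbb R^{2d})$ of the change of variables $P_T\Phi(z)=\Phi(Tz)$, and $\mathcal F_2$ is the extension to $\mathcal S'(\mathbb R^{2d})$ of the partial Fourier transform $\mathcal F_2F(x,\omega)=\int_{\mathbb R^d}F(x,t)e^{-2\pi i\omega t}\,dt$. The classical Wigner transform $W$ is $W_{T_0}$ with $T_0=\begin{pmatrix}\mathrm{Id}&\frac12\mathrm{Id}\\ \mathrm{Id}&-\frac12\mathrm{Id}\end{pmatrix}$. The Cohen class consists of all sesquilinear forms $Q(f)=\sigma*W(f)$ with $\sigma\in\mathcal S'(\mathbb R^{2d})$; $W_T$ is in the Cohen class if it is of this form for some $\sigma$. A set $E\subset\mathbb R^n$ is uniformly discrete if there is $\delta>0$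 with $|r-s|\ge\delta$ for all $r,s\in E$, $r\ne s$. A tempered distribution "is a measure" if it is given by a complex Radon measure (for a distribution with uniformly discrete support $\Lambda$, this means it has the form $\sum_{\lambda\in\Lambda}a_\lambda\delta_\lambda$, with no derivatives of Dirac masses). *)

theory Defs
  imports "HOL-Analysis.Analysis"
begin

section \<open>Schwartz functions\<close>

text \<open>\<open>partials [b\<^sub>1, \<dots>, b\<^sub>n] f\<close> is the iterated partial derivative
  \<open>\<partial>\<^bsub>b\<^sub>1\<^esub> \<dots> \<partial>\<^bsub>b\<^sub>n\<^esub> f\<close>; lists of basis vectors play the role of multi-indices.\<close>

primrec partials :: "'a::euclidean_space list \<Rightarrow> ('a \<Rightarrow> complex) \<Rightarrow> 'a \<Rightarrow> complex" where
  "partials [] f = f"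
| "partials (b # bs) f = (\<lambda>x. frechet_derivative (partials bs f) (at x) b)"

definition smooth :: "('a::euclidean_space \<Rightarrow> complex) \<Rightarrow> bool" where
  "smooth f \<longleftrightarrow> (\<forall>bs x. set bs \<subseteq> Basis \<longrightarrow> partials bs f differentiable (at x))"

definition schwartz :: "('a::euclidean_space \<Rightarrow> complex) \<Rightarrow> bool" where
  "schwartz f \<longleftrightarrow> smooth f \<and>
     (\<forall>k bs. set bs \<subseteq> Basis \<longrightarrow>
        (\<exists>C. \<forall>x. (1 + norm x) ^ k * cmod (partials bs f x) \<le> C))"

text \<open>For Schwartz functions the suprema are finite, and these norms, increasing in \<open>N\<close>,
  generate the usual Frechet topology.\<close>

definition schwartz_norm :: "nat \<Rightarrow> ('a::euclidean_space \<Rightarrow> complex) \<Rightarrow> real" where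
  "schwartz_norm N f =
     (\<Sum>bs \<in> {bs. set bs \<subseteq> Basis \<and> length bs \<le> N}.
        SUP x. (1 + norm x) ^ N * cmod (partials bs f x))"

definition test_function :: "('a::euclidean_space \<Rightarrow> complex) \<Rightarrow> bool" where
  "test_function f \<longleftrightarrow> smooth f \<and> compact (closure {x. f x \<noteq> 0})"

definition fourier :: "('a::euclidean_space \<Rightarrow> complex) \<Rightarrow> 'a \<Rightarrow> complex" where
  "fourier f \<omega> = (\<integral>t. f t * cis (- 2 * pi * (\<omega> \<bullet> t)) \<partial>lborel)"

definition partial_fourier ::
  "('a \<times> 'b::euclidean_space \<Rightarrow> complex) \<Rightarrow> 'a \<times> 'b \<Rightarrow> complex" where
  "partial_fourier F = (\<lambda>(x, \<omega>). fourier (\<lambda>t. F (x, t)) \<omega>)"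


section \<open>Tempered distributions\<close>

text \<open>A distribution is a functional on all functions of which only the values on
  Schwartz functions are meaningful. Functionals are conjugate-linear: a function \<open>f\<close> acts by
  \<open>\<phi> \<mapsto> \<integral> f \<cdot> cnj \<phi>\<close>.\<close>

type_synonym 'a functional = "('a \<Rightarrow> complex) \<Rightarrow> complex"

definition tempered_distribution :: "'a::euclidean_space functional \<Rightarrow> bool" where
  "tempered_distribution \<mu> \<longleftrightarrow>
     (\<forall>\<phi> \<psi>. schwartz \<phi> \<longrightarrow> schwartz \<psi> \<longrightarrow> \<mu> (\<lambda>x. \<phi> x + \<psi> x) = \<mu> \<phi> + \<mu> \<psi>) \<and>
     (\<forall>a \<phi>. schwartz \<phi> \<longrightarrow> \<mu> (\<lambda>x. a * \<phi> x) = cnj a * \<mu> \<phi>) \<and>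
     (\<exists>C N. \<forall>\<phi>. schwartz \<phi> \<longrightarrow> cmod (\<mu> \<phi>) \<le> C * schwartz_norm N \<phi>)"

definition dirac :: "'a \<Rightarrow> 'a functional" where
  "dirac p \<phi> = cnj (\<phi> p)"

definition dist_support :: "'a::euclidean_space functional \<Rightarrow> 'a set" where
  "dist_support \<mu> =
     - \<Union>{U. open U \<and>
           (\<forall>\<phi>. test_function \<phi> \<longrightarrow> closure {x. \<phi> x \<noteq> 0} \<subseteq> U \<longrightarrow> \<mu> \<phi> = 0)}"

text \<open>A positive Radon measure on a Euclidean space is a Borel measure that is finite on compact
  sets. A complex Radon measure, whose total variation may be infinite, is a combination
  \<open>\<nu>\<^sub>0 + \<i> \<nu>\<^sub>1 - \<nu>\<^sub>2 - \<i> \<nu>\<^sub>3\<close> of positive ones. As its total variation need not grow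
  polynomially, it is tested against compactly supported functions, which are dense among the
  Schwartz functions.\<close>

definition radon_measure :: "'a::euclidean_space measure \<Rightarrow> bool" where
  "radon_measure \<nu> \<longleftrightarrow> sets \<nu> = sets borel \<and> (\<forall>K. compact K \<longrightarrow> emeasure \<nu> K < \<infinity>)"

definition given_by_measure :: "'a::euclidean_space functional \<Rightarrow> bool" where
  "given_by_measure \<mu> \<longleftrightarrow>
     (\<exists>\<nu> :: nat \<Rightarrow> 'a measure. (\<forall>k<4. radon_measure (\<nu> k)) \<and>
        (\<forall>\<phi>. test_function \<phi> \<longrightarrow> \<mu> \<phi> = (\<Sum>k<4. \<i> ^ k * (\<integral>x. cnj (\<phi> x) \<partial>\<nu> k))))"

text \<open>Extensions of the operations on functions to distributions. By Plancherel, for functions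
  \<open>\<langle>fourier f, \<phi>\<rangle> = \<langle>f, fourier\<^sup>-\<^sup>1 \<phi>\<rangle>\<close>, where the inverse transform is the forward one
  followed by a reflection.\<close>

definition dist_fourier :: "'a::euclidean_space functional \<Rightarrow> 'a functional" where
  "dist_fourier \<mu> \<phi> = \<mu> (\<lambda>t. fourier \<phi> (- t))"

definition dist_partial_fourier ::
  "('a \<times> 'b::euclidean_space) functional \<Rightarrow> ('a \<times> 'b) functional" where
  "dist_partial_fourier U \<Phi> = U (\<lambda>(x, t). partial_fourier \<Phi> (x, - t))"

definition dist_cnj :: "'a functional \<Rightarrow> 'a functional" where
  "dist_cnj \<mu> \<phi> = cnj (\<mu> (\<lambda>x. cnj (\<phi> x)))"

text \<open>The inner conjugation is due to conjugate-linearity: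
  \<open>\<integral>\<integral> \<mu>(x) \<nu>(y) cnj \<Phi>(x,y) dy dx = \<integral> \<mu>(x) cnj (cnj \<langle>\<nu>, \<Phi>(x,\<cdot>)\<rangle>) dx\<close>.\<close>

definition dist_tensor :: "'a functional \<Rightarrow> 'b functional \<Rightarrow> ('a \<times> 'b) functional" where
  "dist_tensor \<mu> \<nu> \<Phi> = \<mu> (\<lambda>x. cnj (\<nu> (\<lambda>y. \<Phi> (x, y))))"

text \<open>The convolution \<open>\<sigma> * F\<close> with a Schwartz function is the function
  \<open>z \<mapsto> \<integral> \<sigma>(w) F(z - w) dw\<close>.\<close>

definition dist_convolution ::
  "'a::euclidean_space functional \<Rightarrow> ('a \<Rightarrow> complex) \<Rightarrow> 'a \<Rightarrow> complex" where
  "dist_convolution \<sigma> F z = \<sigma> (\<lambda>w. cnj (F (z - w)))"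


section \<open>Block matrices\<close>

definition block_matrix ::
  "real^'d^'d \<Rightarrow> real^'d^'d \<Rightarrow> real^'d^'d \<Rightarrow> real^'d^'d
     \<Rightarrow> real^('d::finite + 'd)^('d + 'd)" where
  "block_matrix A B C D =
     (\<chi> i j. case (i, j) of
         (Inl i, Inl j) \<Rightarrow> A $ i $ j | (Inl i, Inr j) \<Rightarrow> B $ i $ j
       | (Inr i, Inl j) \<Rightarrow> C $ i $ j | (Inr i, Inr j) \<Rightarrow> D $ i $ j)"

definition block11 :: "real^('d::finite + 'd)^('d + 'd) \<Rightarrow> real^'d^'d" where
  "block11 T = (\<chi> i j. T $ Inl i $ Inl j)"

definition block12 :: "real^('d::finite + 'd)^('d + 'd) \<Rightarrow> real^'d^'d" where
  "block12 T = (\<chi> i j. T $ Inl i $ Inr j)"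

definition block21 :: "real^('d::finite + 'd)^('d + 'd) \<Rightarrow> real^'d^'d" where
  "block21 T = (\<chi> i j. T $ Inr i $ Inl j)"

definition block22 :: "real^('d::finite + 'd)^('d + 'd) \<Rightarrow> real^'d^'d" where
  "block22 T = (\<chi> i j. T $ Inr i $ Inr j)"

lemma block_matrix_blocks [simp]:
  "block11 (block_matrix A B C D) = A" "block12 (block_matrix A B C D) = B"
  "block21 (block_matrix A B C D) = C" "block22 (block_matrix A B C D) = D"
  by (simp_all add: block_matrix_def block11_def block12_def block21_def block22_def vec_eq_iff)

text \<open>\<open>\<real>\<^sup>2\<^sup>d\<close> is represented by the product space, on which a matrix acts blockwise.\<close>

definition block_apply ::
  "real^('d::finite + 'd)^('d + 'd) \<Rightarrow> (real^'d) \<times> (real^'d) \<Rightarrow> (real^'d) \<times> (real^'d)" where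
  "block_apply T = (\<lambda>(x, t). (block11 T *v x + block12 T *v t, block21 T *v x + block22 T *v t))"


section \<open>Matrix-Wigner transforms and the Cohen class\<close>

definition matrix_wigner ::
  "real^('d::finite + 'd)^('d + 'd) \<Rightarrow> (real^'d \<Rightarrow> complex)
     \<Rightarrow> (real^'d) \<times> (real^'d) \<Rightarrow> complex" where
  "matrix_wigner T f = (\<lambda>(x, \<omega>).
     \<integral>t. cis (- 2 * pi * (t \<bullet> \<omega>)) * f (block11 T *v x + block12 T *v t)
           * cnj (f (block21 T *v x + block22 T *v t)) \<partial>lborel)"

text \<open>The extension of \<open>\<Phi> \<mapsto> \<Phi> \<circ> T\<close>, by the change of variables formula.\<close>

definition dist_pullback ::
  "real^('d::finite + 'd)^('d + 'd) \<Rightarrow> ((real^'d) \<times> (real^'d)) functional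
     \<Rightarrow> ((real^'d) \<times> (real^'d)) functional" where
  "dist_pullback T U \<Phi> =
     complex_of_real (1 / \<bar>det T\<bar>) * U (\<lambda>z. \<Phi> (block_apply (matrix_inv T) z))"

definition dist_matrix_wigner ::
  "real^('d::finite + 'd)^('d + 'd) \<Rightarrow> (real^'d) functional
     \<Rightarrow> ((real^'d) \<times> (real^'d)) functional" where
  "dist_matrix_wigner T \<mu> =
     dist_partial_fourier (dist_pullback T (dist_tensor \<mu> (dist_cnj \<mu>)))"

definition wigner :: "(real^'d::finite \<Rightarrow> complex) \<Rightarrow> (real^'d) \<times> (real^'d) \<Rightarrow> complex" where
  "wigner = matrix_wigner
     (block_matrix (mat 1) ((1/2) *\<^sub>R mat 1) (mat 1) (- (1/2) *\<^sub>R mat 1))"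

definition in_cohen_class ::
  "((real^'d::finite \<Rightarrow> complex) \<Rightarrow> (real^'d) \<times> (real^'d) \<Rightarrow> complex) \<Rightarrow> bool" where
  "in_cohen_class Q \<longleftrightarrow>
     (\<exists>\<sigma>. tempered_distribution \<sigma> \<and>
        (\<forall>f. schwartz f \<longrightarrow> Q f = dist_convolution \<sigma> (wigner f)))"

end

theory Submission
  imports Defs "HOL-Probability.Sinc_Integral" "HOL-Probability.Distributions"
begin

text \<open>Since \<open>W\<^sub>T(\<mu>) = \<Sum> c\<^sub>r\<^sub>s \<delta>\<^bsub>(r,s)\<^esub>\<close>, it annihilates every Schwartz function that vanishes on
  \<open>R \<times> S\<close>. For \<open>\<Phi> = F\<^sub>2 (G \<circ> T)\<close>, where \<open>F\<^sub>2\<close> is the partial Fourier transform, Fourier inversion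
  gives \<open>\<langle>W\<^sub>T(\<mu>), \<Phi>\<rangle> = \<langle>\<mu> \<otimes> cnj \<mu>, G\<rangle> / \<bar>det T\<bar>\<close>. If \<open>G (u, v) = 0\<close> whenever \<open>A u + B v \<in> R\<close>, then
  \<open>G \<circ> T\<close> vanishes on \<open>R \<times> \<real>\<^sup>d\<close>, hence so does \<open>\<Phi>\<close>, and \<open>\<mu> \<otimes> cnj \<mu>\<close> annihilates \<open>G\<close>. Written in terms of
  the Fourier transforms of \<open>\<mu>\<close> and \<open>G\<close>, the same idea shows that the tensor square of \<open>dist_fourier \<mu>\<close>
  annihilates every \<open>G\<close> that vanishes where \<open>B\<^sub>0\<^sup>T u - D\<^sub>0\<^sup>T v \<in> S\<close>. Hence \<open>\<mu>\<close> and its Fourier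
  transform are two instances of one situation, the locale \<open>tensor_square_vanishing\<close>: a functional
  \<open>\<nu>\<close> whose tensor square annihilates all \<open>G\<close> that vanish where \<open>P u + Q v \<in> R\<close>, with \<open>R\<close> uniformly
  discrete and \<open>P + Q\<close> injective. Conditions (ii) and (iii) say that \<open>P + Q\<close> is injective in both cases.

  In that situation put \<open>\<Lambda> = {q. P q + Q q \<in> R}\<close>, a uniformly discrete set. Away from \<open>\<Lambda>\<close> the
  functional vanishes, as one sees from \<open>G = \<phi> \<otimes> cnj \<phi>\<close> with \<open>\<phi>\<close> supported near a point. Near a point
  \<open>p \<in> \<Lambda>\<close> let \<open>l\<close> be \<open>\<nu>\<close> multiplied by a cutoff. By discreteness of \<open>R\<close>, every component of
  \<open>P (u - p) + Q (v - p)\<close> vanishes at those \<open>(u, v)\<close> near \<open>(p, p)\<close> for which \<open>P u + Q v \<in> R\<close>. Taking for \<open>G\<close>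
  such a component times \<open>\<phi> \<otimes> cnj \<psi>\<close> yields
  \<open>l (P\<^sub>b \<phi>) cnj (l \<psi>) + l \<phi> cnj (l (Q\<^sub>b \<psi>)) = 0\<close>, and separating the variables shows that multiplication
  by \<open>P\<^sub>b\<close>, by \<open>Q\<^sub>b\<close>, and thus by each coordinate function, acts on \<open>l\<close> as a scalar. By Hadamard's lemma
  a functional on which the coordinates act as real scalars is a multiple of a Dirac mass, so no derivatives
  of Dirac masses occur (\<open>scalar_coordinates_imp_dirac\<close>, \<open>locally_dirac\<close>). A partition of unity
  assembles the local statements to a measure carried by \<open>\<Lambda>\<close>.

  Hadamard's lemma on the Schwartz space (\<open>schwartz_hadamard\<close>) also replaces Fubini's theorem and changes of
  variables in the Fourier analysis. For instance, for fixed \<open>y\<close> the functional \<open>f \<mapsto> fourier (fourier f) y\<close>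
  annihilates \<open>(x + y)\<^sub>e f\<close> for all \<open>e\<close> because the Fourier transform exchanges derivatives and coordinates;
  so it only depends on \<open>f (- y)\<close>. Inserting an invertible linear map between the two transforms
  (\<open>fourier_like_inversion\<close>) gives the frequency side above.

  Finally, forms in the Cohen class are covariant under time-frequency shifts. Testing this with shifted
  and modulated Gaussians forces \<open>B\<^sub>0 - D\<^sub>0 = Id\<close> and \<open>A\<^sub>0 = C\<^sub>0 = Id\<close>, whence \<open>A + B = Id\<close>. Then \<open>\<Lambda>\<close> is \<open>R\<close>
  for \<open>\<mu>\<close>, and \<open>S\<close> for its Fourier transform.\<close>


section \<open>Derivatives and classes of smooth functions\<close>

definition dir_deriv :: "'a::euclidean_space \<Rightarrow> ('a \<Rightarrow> complex) \<Rightarrow> 'a \<Rightarrow> complex" where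
  "dir_deriv v f = (\<lambda>x. frechet_derivative f (at x) v)"

lemma partials_append: "partials (bs @ cs) f = partials bs (partials cs f)"
  by (induction bs) simp_all

lemma dir_deriv_eqI: "(f has_derivative f') (at x) \<Longrightarrow> dir_deriv v f x = f' v"
  unfolding dir_deriv_def using frechet_derivative_at by metis

lemma has_derivative_dir_deriv:
  "f differentiable (at x) \<Longrightarrow> (f has_derivative (\<lambda>v. dir_deriv v f x)) (at x)"
  unfolding dir_deriv_def using frechet_derivative_works by blast

lemma dir_deriv_Basis_expansion:
  fixes f :: "'a::euclidean_space \<Rightarrow> complex"
  assumes "f differentiable (at x)"
  shows "dir_deriv v f x = (\<Sum>e\<in>Basis. of_real (v \<bullet> e) * dir_deriv e f x)"
proof -
  have lin: "linear (\<lambda>v. dir_deriv v f x)"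
    using has_derivative_dir_deriv[OF assms] by (rule has_derivative_linear)
  have "dir_deriv v f x = dir_deriv (\<Sum>e\<in>Basis. (v \<bullet> e) *\<^sub>R e) f x"
    by (simp add: euclidean_representation)
  also have "\<dots> = (\<Sum>e\<in>Basis. of_real (v \<bullet> e) * dir_deriv e f x)"
    by (simp add: linear_sum[OF lin] linear_scale[OF lin] scaleR_conv_of_real)
  finally show ?thesis .
qed

text \<open>The product rule produces sums; closing a family of functions under addition lets the
  coinduction below be applied to families such as the products \<open>f g\<close>.\<close>

inductive_set sum_closure :: "('a \<Rightarrow> complex) set \<Rightarrow> ('a \<Rightarrow> complex) set" for X where
  base: "f \<in> X \<Longrightarrow> f \<in> sum_closure X"
| add: "f \<in> sum_closure X \<Longrightarrow> g \<in> sum_closure X \<Longrightarrow> (\<lambda>x. f x + g x) \<in> sum_closure X"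

text \<open>All partial derivatives of \<open>f\<close> of all orders, including \<open>f\<close> itself, exist and satisfy \<open>P\<close>. Smooth
  functions, Schwartz functions and the multipliers of the Schwartz space are the instances where \<open>P\<close> is
  no condition, rapid decay and polynomial growth.\<close>

definition derivs_in :: "(('a::euclidean_space \<Rightarrow> complex) \<Rightarrow> bool) \<Rightarrow> ('a \<Rightarrow> complex) \<Rightarrow> bool" where
  "derivs_in P f \<longleftrightarrow>
     (\<forall>bs. set bs \<subseteq> Basis \<longrightarrow> P (partials bs f) \<and> (\<forall>x. partials bs f differentiable (at x)))"

text \<open>It suffices to exhibit a family \<open>X\<close> that contains \<open>f\<close> and is closed under the first partial
  derivatives, up to sums. This avoids any formula for higher derivatives.\<close>

lemma derivs_in_sum_closure:
  fixes f :: "'a::euclidean_space \<Rightarrow> complex"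
  assumes "f \<in> sum_closure X"
    and diff: "\<And>f x. f \<in> X \<Longrightarrow> f differentiable (at x)"
    and step: "\<And>f b. f \<in> X \<Longrightarrow> b \<in> Basis \<Longrightarrow> dir_deriv b f \<in> sum_closure X"
    and P: "\<And>f. f \<in> X \<Longrightarrow> P f"
    and P_add: "\<And>f g. P f \<Longrightarrow> P g \<Longrightarrow> P (\<lambda>x. f x + g x)"
  shows "derivs_in P f"
proof -
  have diff': "g differentiable (at x)" if "g \<in> sum_closure X" for g x
    using that by induction (auto intro: diff differentiable_add)
  have P': "P g" if "g \<in> sum_closure X" for g
    using that by induction (auto intro: P P_add)
  have step': "dir_deriv b g \<in> sum_closure X" if "g \<in> sum_closure X" "b \<in> Basis" for g b
    using that
  proof induction
    case (base f)
    then show ?case by (simp add: step)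
  next
    case (add f g)
    have "dir_deriv b (\<lambda>x. f x + g x) = (\<lambda>x. dir_deriv b f x + dir_deriv b g x)"
      by (intro ext dir_deriv_eqI[OF has_derivative_add] has_derivative_dir_deriv diff' add.hyps)
    then show ?case
      using add by (auto intro: sum_closure.add)
  qed
  have "partials bs f \<in> sum_closure X" if "set bs \<subseteq> Basis" for bs
    using that by (induction bs)
      (use assms(1) step' in \<open>auto simp: dir_deriv_def[symmetric]\<close>)
  then show ?thesis
    unfolding derivs_in_def using P' diff' by blast
qed

lemmas derivs_in_coinduct = derivs_in_sum_closure[OF sum_closure.base]

lemma derivs_inD:
  assumes "derivs_in P f"
  shows "P f" "f differentiable (at x)" "b \<in> Basis \<Longrightarrow> derivs_in P (dir_deriv b f)"
proof -
  show "P f" "f differentiable (at x)"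
    using assms[unfolded derivs_in_def, rule_format, of "[]"] by auto
  assume b: "b \<in> Basis"
  have "partials bs (dir_deriv b f) = partials (bs @ [b]) f" for bs
    by (simp add: partials_append dir_deriv_def)
  then show "derivs_in P (dir_deriv b f)"
    using assms b unfolding derivs_in_def by simp
qed

lemma derivs_in_mono: "derivs_in P f \<Longrightarrow> (\<And>f. P f \<Longrightarrow> Q f) \<Longrightarrow> derivs_in Q f"
  unfolding derivs_in_def by blast

lemma derivs_in_mult:
  fixes f g :: "'a::euclidean_space \<Rightarrow> complex"
  assumes f: "derivs_in P f" and g: "derivs_in Q g"
    and PQ: "\<And>f g. P f \<Longrightarrow> Q g \<Longrightarrow> S (\<lambda>x. f x * g x)"
    and S_add: "\<And>f g. S f \<Longrightarrow> S g \<Longrightarrow> S (\<lambda>x. f x + g x)"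
  shows "derivs_in S (\<lambda>x. f x * g x)"
proof (rule derivs_in_coinduct[where X = "{\<lambda>x. f x * g x | f g. derivs_in P f \<and> derivs_in Q g}"])
  let ?X = "{\<lambda>x. f x * g x | f g. derivs_in P f \<and> derivs_in Q g}"
  show "(\<lambda>x. f x * g x) \<in> ?X"
    using f g by blast
  fix h :: "'a \<Rightarrow> complex" assume "h \<in> ?X"
  then obtain f g where h: "h = (\<lambda>x. f x * g x)" and fg: "derivs_in P f" "derivs_in Q g"
    by blast
  have D: "(h has_derivative (\<lambda>b. f x * dir_deriv b g x + dir_deriv b f x * g x)) (at x)" for x
    unfolding h by (intro has_derivative_mult has_derivative_dir_deriv derivs_inD(2)[OF fg(1)]
      derivs_inD(2)[OF fg(2)])
  then show "h differentiable (at x)" for x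
    unfolding differentiable_def by blast
  show "S h"
    unfolding h by (intro PQ derivs_inD(1)[OF fg(1)] derivs_inD(1)[OF fg(2)])
  fix b :: 'a assume b: "b \<in> Basis"
  have "dir_deriv b h = (\<lambda>x. f x * dir_deriv b g x + dir_deriv b f x * g x)"
    by (intro ext dir_deriv_eqI[OF D])
  moreover have "(\<lambda>x. f x * dir_deriv b g x) \<in> ?X" "(\<lambda>x. dir_deriv b f x * g x) \<in> ?X"
    using fg derivs_inD(3)[OF fg(1) b] derivs_inD(3)[OF fg(2) b] by blast+
  ultimately show "dir_deriv b h \<in> sum_closure ?X"
    by (simp only:) (rule sum_closure.add; rule sum_closure.base; assumption)
qed (rule S_add)

lemma derivs_in_add:
  fixes f g :: "'a::euclidean_space \<Rightarrow> complex"
  assumes "derivs_in P f" "derivs_in P g" "\<And>f g. P f \<Longrightarrow> P g \<Longrightarrow> P (\<lambda>x. f x + g x)"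
  shows "derivs_in P (\<lambda>x. f x + g x)"
proof (rule derivs_in_sum_closure[where X = "Collect (derivs_in P)"])
  show "(\<lambda>x. f x + g x) \<in> sum_closure (Collect (derivs_in P))"
    using assms(1,2) by (intro sum_closure.intros) simp_all
qed (use assms(3) in \<open>auto intro: derivs_inD(1) sum_closure.base derivs_inD(3) dest: derivs_inD(2)\<close>)

definition rapidly_decaying :: "('a::real_normed_vector \<Rightarrow> complex) \<Rightarrow> bool" where
  "rapidly_decaying f \<longleftrightarrow> (\<forall>k. \<exists>C. \<forall>x. (1 + norm x) ^ k * cmod (f x) \<le> C)"

definition polynomially_bounded :: "('a::real_normed_vector \<Rightarrow> complex) \<Rightarrow> bool" where
  "polynomially_bounded f \<longleftrightarrow> (\<exists>k C. \<forall>x. cmod (f x) \<le> C * (1 + norm x) ^ k)"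

text \<open>The multipliers of the Schwartz space: smooth functions of polynomial growth, together with all
  their derivatives.\<close>

definition moderate :: "('a::euclidean_space \<Rightarrow> complex) \<Rightarrow> bool" where
  "moderate f \<longleftrightarrow> derivs_in polynomially_bounded f"

lemma smooth_derivs_in: "smooth f \<longleftrightarrow> derivs_in (\<lambda>_. True) f"
  unfolding smooth_def derivs_in_def by auto

lemma schwartz_derivs_in: "schwartz f \<longleftrightarrow> derivs_in rapidly_decaying f"
  unfolding schwartz_def smooth_def derivs_in_def rapidly_decaying_def by blast

lemma rapidly_decaying_add:
  assumes "rapidly_decaying f" "rapidly_decaying g"
  shows "rapidly_decaying (\<lambda>x. f x + g x)"
  unfolding rapidly_decaying_def
proof
  fix k
  from assms obtain C D where "\<And>x. (1 + norm x) ^ k * cmod (f x) \<le> C"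
    "\<And>x. (1 + norm x) ^ k * cmod (g x) \<le> D"
    unfolding rapidly_decaying_def by meson
  then have "(1 + norm x) ^ k * cmod (f x + g x) \<le> C + D" for x
    by (smt (verit) norm_triangle_ineq mult_left_mono zero_le_power norm_ge_zero distrib_left)
  then show "\<exists>C. \<forall>x. (1 + norm x) ^ k * cmod (f x + g x) \<le> C"
    by blast
qed

lemma polynomially_bounded_add:
  assumes "polynomially_bounded f" "polynomially_bounded g"
  shows "polynomially_bounded (\<lambda>x. f x + g x)"
proof -
  from assms obtain k C l D where f: "\<And>x. cmod (f x) \<le> C * (1 + norm x) ^ k"
    and g: "\<And>x. cmod (g x) \<le> D * (1 + norm x) ^ l"
    unfolding polynomially_bounded_def by meson
  have "cmod (f x + g x) \<le> (\<bar>C\<bar> + \<bar>D\<bar>) * (1 + norm x) ^ (k + l)" for x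
  proof -
    have "C * (1 + norm x) ^ k \<le> \<bar>C\<bar> * (1 + norm x) ^ (k + l)"
      "D * (1 + norm x) ^ l \<le> \<bar>D\<bar> * (1 + norm x) ^ (k + l)"
      by (intro mult_mono power_increasing; simp)+
    then show ?thesis
      using f[of x] g[of x] norm_triangle_ineq[of "f x" "g x"] by (simp add: distrib_right)
  qed
  then show ?thesis
    unfolding polynomially_bounded_def by blast
qed

lemma polynomially_bounded_mult:
  assumes "polynomially_bounded f" "polynomially_bounded g"
  shows "polynomially_bounded (\<lambda>x. f x * g x)"
proof -
  from assms obtain k C l D where f: "\<And>x. cmod (f x) \<le> C * (1 + norm x) ^ k"
    and g: "\<And>x. cmod (g x) \<le> D * (1 + norm x) ^ l"
    unfolding polynomially_bounded_def by meson
  have "cmod (f x * g x) \<le> (C * D) * (1 + norm x) ^ (k + l)" for x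
    using mult_mono[OF f[of x] g[of x]] order_trans[OF norm_ge_zero f[of x]]
    by (simp add: norm_mult power_add algebra_simps)
  then show ?thesis
    unfolding polynomially_bounded_def by blast
qed

lemma rapidly_decaying_mult:
  assumes "polynomially_bounded f" "rapidly_decaying g"
  shows "rapidly_decaying (\<lambda>x. f x * g x)"
  unfolding rapidly_decaying_def
proof
  fix k
  from assms obtain l C where f: "\<And>x. cmod (f x) \<le> C * (1 + norm x) ^ l"
    unfolding polynomially_bounded_def by meson
  from assms obtain D where g: "\<And>x. (1 + norm x) ^ (k + l) * cmod (g x) \<le> D"
    unfolding rapidly_decaying_def by meson
  have "(1 + norm x) ^ k * cmod (f x * g x) \<le> \<bar>C\<bar> * D" for x
  proof -
    have "(1 + norm x) ^ k * cmod (f x * g x) = cmod (f x) * ((1 + norm x) ^ k * cmod (g x))"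
      by (simp add: norm_mult)
    also have "\<dots> \<le> (\<bar>C\<bar> * (1 + norm x) ^ l) * ((1 + norm x) ^ k * cmod (g x))"
      by (intro mult_right_mono order_trans[OF f]) auto
    also have "\<dots> = \<bar>C\<bar> * ((1 + norm x) ^ (k + l) * cmod (g x))"
      by (simp add: power_add mult_ac)
    also have "\<dots> \<le> \<bar>C\<bar> * D"
      by (intro mult_left_mono g) auto
    finally show ?thesis .
  qed
  then show "\<exists>C. \<forall>x. (1 + norm x) ^ k * cmod (f x * g x) \<le> C"
    by blast
qed

lemma smooth_add: "smooth f \<Longrightarrow> smooth g \<Longrightarrow> smooth (\<lambda>x. f x + g x)"
  unfolding smooth_derivs_in by (rule derivs_in_add) auto

lemma smooth_mult: "smooth f \<Longrightarrow> smooth g \<Longrightarrow> smooth (\<lambda>x. f x * g x)"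
  unfolding smooth_derivs_in by (erule (1) derivs_in_mult) auto

lemma moderate_add: "moderate f \<Longrightarrow> moderate g \<Longrightarrow> moderate (\<lambda>x. f x + g x)"
  unfolding moderate_def by (rule derivs_in_add) (auto intro: polynomially_bounded_add)

lemma moderate_mult: "moderate f \<Longrightarrow> moderate g \<Longrightarrow> moderate (\<lambda>x. f x * g x)"
  unfolding moderate_def
  by (erule (1) derivs_in_mult) (auto intro: polynomially_bounded_add polynomially_bounded_mult)

lemma schwartz_add: "schwartz f \<Longrightarrow> schwartz g \<Longrightarrow> schwartz (\<lambda>x. f x + g x)"
  unfolding schwartz_derivs_in by (rule derivs_in_add) (auto intro: rapidly_decaying_add)

lemma schwartz_moderate_mult: "moderate f \<Longrightarrow> schwartz g \<Longrightarrow> schwartz (\<lambda>x. f x * g x)"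
  unfolding moderate_def schwartz_derivs_in
  by (erule (1) derivs_in_mult) (auto intro: rapidly_decaying_add rapidly_decaying_mult)

lemma rapidly_decaying_imp_polynomially_bounded:
  "rapidly_decaying f \<Longrightarrow> polynomially_bounded f"
  unfolding rapidly_decaying_def polynomially_bounded_def
  by (erule allE[of _ 0], rule exI[of _ 0]) simp

lemma schwartz_imp_moderate: "schwartz f \<Longrightarrow> moderate f"
  unfolding moderate_def schwartz_derivs_in
  by (erule derivs_in_mono) (rule rapidly_decaying_imp_polynomially_bounded)

lemma moderate_imp_smooth: "moderate f \<Longrightarrow> smooth f"
  unfolding smooth_derivs_in moderate_def by (erule derivs_in_mono) simp

lemma moderate_affine:
  fixes v :: "'a::euclidean_space"
  shows "moderate (\<lambda>x. of_real (v \<bullet> x) + c)"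
  unfolding moderate_def
proof (rule derivs_in_coinduct[where X = "{\<lambda>x. of_real (v \<bullet> x) + c | v c. True}"])
  let ?X = "{\<lambda>x::'a. complex_of_real (v \<bullet> x) + c | v c. True}"
  fix f assume "f \<in> ?X"
  then obtain v c where f: "f = (\<lambda>x. of_real (v \<bullet> x) + c)" by blast
  have D: "(f has_derivative (\<lambda>b. of_real (v \<bullet> b))) (at x)" for x
    unfolding f by (auto intro!: derivative_eq_intros)
  then show "f differentiable (at x)" for x
    unfolding differentiable_def by blast
  have "cmod (f x) \<le> (norm v + cmod c) * (1 + norm x) ^ 1" for x
  proof -
    have "cmod (f x) \<le> \<bar>v \<bullet> x\<bar> + cmod c"
      unfolding f using norm_triangle_ineq[of "of_real (v \<bullet> x)" c] by simp
    also have "\<dots> \<le> norm v * norm x + cmod c"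
      using Cauchy_Schwarz_ineq2[of v x] by simp
    also have "\<dots> \<le> (norm v + cmod c) * (1 + norm x) ^ 1"
      by (simp add: algebra_simps)
    finally show ?thesis .
  qed
  then show "polynomially_bounded f"
    unfolding polynomially_bounded_def by blast
  fix b :: 'a
  have "dir_deriv b f = (\<lambda>x. of_real (0 \<bullet> x) + of_real (v \<bullet> b))"
    by (simp add: fun_eq_iff dir_deriv_eqI[OF D])
  then show "dir_deriv b f \<in> sum_closure ?X"
    by (blast intro: sum_closure.base)
qed (use polynomially_bounded_add in blast)+

lemma moderate_inner: "moderate (\<lambda>x. of_real (v \<bullet> x))"
  using moderate_affine[of v 0] by simp

lemma moderate_const: "moderate (\<lambda>x. c)"
  using moderate_affine[of 0 c] by simp

lemma schwartz_cmult: "schwartz f \<Longrightarrow> schwartz (\<lambda>x. c * f x)"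
  by (rule schwartz_moderate_mult[OF moderate_const])

lemma schwartz_zero: "schwartz (\<lambda>x. 0)"
  unfolding schwartz_derivs_in
proof (rule derivs_in_coinduct[where X = "{\<lambda>x. 0}"])
  show "rapidly_decaying f" if "f \<in> {\<lambda>x. 0}" for f :: "'a \<Rightarrow> complex"
    using that by (auto simp: rapidly_decaying_def)
qed (auto simp: dir_deriv_def intro: sum_closure.base rapidly_decaying_add)

lemma schwartz_sum: "(\<And>i. i \<in> I \<Longrightarrow> schwartz (f i)) \<Longrightarrow> schwartz (\<lambda>x. \<Sum>i\<in>I. f i x)"
  by (induction I rule: infinite_finite_induct) (auto intro: schwartz_zero schwartz_add)

lemma schwartz_inner_mult: "schwartz f \<Longrightarrow> schwartz (\<lambda>x. of_real (v \<bullet> x) * f x)"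
  by (rule schwartz_moderate_mult[OF moderate_inner])

lemma schwartz_mult: "schwartz f \<Longrightarrow> schwartz g \<Longrightarrow> schwartz (\<lambda>x. f x * g x)"
  by (rule schwartz_moderate_mult[OF schwartz_imp_moderate])

lemma schwartz_differentiable: "schwartz f \<Longrightarrow> f differentiable (at x)"
  unfolding schwartz_derivs_in by (rule derivs_inD(2))

lemma schwartz_has_derivative:
  "schwartz f \<Longrightarrow> (f has_derivative (\<lambda>v. dir_deriv v f x)) (at x)"
  by (rule has_derivative_dir_deriv[OF schwartz_differentiable])

lemma linear_dir_deriv: "schwartz f \<Longrightarrow> linear (\<lambda>v. dir_deriv v f x)"
  by (rule has_derivative_linear[OF schwartz_has_derivative])

lemma schwartz_dir_deriv:
  assumes "schwartz f"
  shows "schwartz (dir_deriv v f)"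
proof -
  have "dir_deriv v f = (\<lambda>x. \<Sum>e\<in>Basis. of_real (v \<bullet> e) * dir_deriv e f x)"
    by (intro ext dir_deriv_Basis_expansion schwartz_differentiable assms)
  moreover have "schwartz (dir_deriv e f)" if "e \<in> Basis" for e
    using assms that unfolding schwartz_derivs_in by (rule derivs_inD(3))
  ultimately show ?thesis
    by (auto intro!: schwartz_sum schwartz_cmult)
qed

lemma schwartz_rapidly_decaying: "schwartz f \<Longrightarrow> rapidly_decaying f"
  unfolding schwartz_derivs_in by (rule derivs_inD(1))

lemma schwartz_bounded: "schwartz f \<Longrightarrow> \<exists>C. \<forall>x. cmod (f x) \<le> C"
  using schwartz_rapidly_decaying[of f, unfolded rapidly_decaying_def, rule_format, of 0] by simp

text \<open>Each factor \<open>1 + norm x\<close> is dominated by \<open>1 + \<Sum>\<^sub>b \<bar>x\<^sub>b\<bar>\<close>, so a family of bounded functions that is closed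
  under multiplication by coordinates decays rapidly.\<close>

lemma rapidly_decaying_by_coordinates:
  fixes f :: "'a::euclidean_space \<Rightarrow> complex"
  assumes "f \<in> X"
    and bounded: "\<And>f. f \<in> X \<Longrightarrow> \<exists>C. \<forall>x. cmod (f x) \<le> C"
    and coord: "\<And>f b. f \<in> X \<Longrightarrow> b \<in> Basis \<Longrightarrow> (\<lambda>x. of_real (b \<bullet> x) * f x) \<in> X"
  shows "rapidly_decaying f"
  unfolding rapidly_decaying_def
proof
  fix k show "\<exists>C. \<forall>x. (1 + norm x) ^ k * cmod (f x) \<le> C"
    using assms(1)
  proof (induction k arbitrary: f)
    case 0
    then show ?case using bounded by simp
  next
    case (Suc k)
    then obtain C where C: "\<And>x. (1 + norm x) ^ k * cmod (f x) \<le> C" by blast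
    have "\<forall>b\<in>Basis. \<exists>C. \<forall>x. (1 + norm x) ^ k * cmod (of_real (b \<bullet> x) * f x) \<le> C"
      using Suc coord by blast
    then obtain D where D: "\<And>b x. b \<in> Basis \<Longrightarrow> (1 + norm x) ^ k * cmod (of_real (b \<bullet> x) * f x) \<le> D b"
      by metis
    have "(1 + norm x) ^ Suc k * cmod (f x) \<le> C + (\<Sum>b\<in>Basis. D b)" for x
    proof -
      have "(1 + norm x) ^ Suc k * cmod (f x)
          \<le> (1 + (\<Sum>b\<in>Basis. \<bar>x \<bullet> b\<bar>)) * ((1 + norm x) ^ k * cmod (f x))"
        unfolding power_Suc mult.assoc using norm_le_l1[of x] by (intro mult_right_mono) auto
      also have "\<dots> = (1 + norm x) ^ k * cmod (f x)
          + (\<Sum>b\<in>Basis. (1 + norm x) ^ k * cmod (of_real (b \<bullet> x) * f x))"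
        by (simp add: norm_mult algebra_simps sum_distrib_left inner_commute)
      also have "\<dots> \<le> C + (\<Sum>b\<in>Basis. D b)"
        by (intro add_mono C sum_mono D)
      finally show ?thesis .
    qed
    then show ?case by blast
  qed
qed

text \<open>The Schwartz space is the largest family of bounded differentiable functions closed under partial
  derivatives and multiplication by coordinates. Operators which exchange or preserve these operations,
  like the Fourier transform, therefore preserve the Schwartz space.\<close>

lemma schwartz_coinduct:
  fixes f :: "'a::euclidean_space \<Rightarrow> complex"
  assumes "f \<in> X"
    and bounded: "\<And>f. f \<in> X \<Longrightarrow> \<exists>C. \<forall>x. cmod (f x) \<le> C"
    and coord: "\<And>f b. f \<in> X \<Longrightarrow> b \<in> Basis \<Longrightarrow> (\<lambda>x. of_real (b \<bullet> x) * f x) \<in> X"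
    and diff: "\<And>f x. f \<in> X \<Longrightarrow> f differentiable (at x)"
    and step: "\<And>f b. f \<in> X \<Longrightarrow> b \<in> Basis \<Longrightarrow> dir_deriv b f \<in> X"
  shows "schwartz f"
  unfolding schwartz_derivs_in
proof (rule derivs_in_coinduct[where X = X])
  show "rapidly_decaying f" if "f \<in> X" for f
    using that bounded coord by (rule rapidly_decaying_by_coordinates)
qed (use assms in \<open>auto intro: sum_closure.base rapidly_decaying_add\<close>)

lemma moderate_dir_deriv: "moderate f \<Longrightarrow> b \<in> Basis \<Longrightarrow> moderate (dir_deriv b f)"
  unfolding moderate_def by (rule derivs_inD(3))

lemma moderate_differentiable: "moderate f \<Longrightarrow> f differentiable (at x)"
  unfolding moderate_def by (rule derivs_inD(2))

lemma smooth_dir_deriv: "smooth f \<Longrightarrow> b \<in> Basis \<Longrightarrow> smooth (dir_deriv b f)"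
  unfolding smooth_derivs_in by (rule derivs_inD(3))

lemma smooth_differentiable: "smooth f \<Longrightarrow> f differentiable (at x)"
  unfolding smooth_derivs_in by (rule derivs_inD(2))


section \<open>Operations on Schwartz functions\<close>

text \<open>Covers translations, reflections, invertible changes of variables, and the restriction to slices, where
  \<open>L\<close> is the inclusion of a factor of a product.\<close>

lemma schwartz_affine_compose:
  fixes f :: "'b::euclidean_space \<Rightarrow> complex" and L :: "'a::euclidean_space \<Rightarrow> 'b"
  assumes f: "schwartz f" and L: "linear L" "inj L"
  shows "schwartz (\<lambda>x. f (p + L x))"
proof -
  let ?X = "{\<lambda>x. f (p + L x) | f. schwartz f}"
  obtain M where M: "linear M" "\<And>x. M (L x) = x"
    using linear_injective_left_inverse[OF L] by (metis comp_apply id_apply)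
  have bl: "bounded_linear L"
    using L(1) linear_conv_bounded_linear by blast
  have D: "((\<lambda>x. f (p + L x)) has_derivative (\<lambda>v. dir_deriv (L v) f (p + L x))) (at x)"
    if "schwartz f" for f :: "'b \<Rightarrow> complex" and x
  proof -
    have "((\<lambda>x. p + L x) has_derivative L) (at x)"
      using has_derivative_add[OF has_derivative_const bounded_linear.has_derivative[OF bl has_derivative_ident]]
      by simp
    from has_derivative_compose[OF this schwartz_has_derivative[OF that]]
    show ?thesis .
  qed
  show ?thesis
  proof (rule schwartz_coinduct[where X = ?X])
    show "(\<lambda>x. f (p + L x)) \<in> ?X"
      using f by blast
  next
    fix h assume "h \<in> ?X"
    then obtain f where h: "h = (\<lambda>x. f (p + L x))" and f: "schwartz f" by blast
    show "\<exists>C. \<forall>x. cmod (h x) \<le> C"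
      using schwartz_bounded[OF f] unfolding h by blast
    show "h differentiable (at x)" for x
      unfolding h differentiable_def using D[OF f] by blast
    fix b :: 'a assume "b \<in> Basis"
    have "dir_deriv b h = (\<lambda>x. dir_deriv (L b) f (p + L x))"
      unfolding h by (intro ext dir_deriv_eqI[OF D[OF f]])
    then show "dir_deriv b h \<in> ?X"
      using schwartz_dir_deriv[OF f] by blast
    \<comment> \<open>Since \<open>M\<close> is a left inverse of \<open>L\<close>, a coordinate of \<open>x\<close> is an affine function of \<open>p + L x\<close>.\<close>
    let ?m = "\<lambda>y. (complex_of_real (adjoint M b \<bullet> y) + of_real (- (adjoint M b \<bullet> p))) * f y"
    have "(\<lambda>x. of_real (b \<bullet> x) * h x) = (\<lambda>x. ?m (p + L x))"
      using adjoint_works[OF M(1)] by (auto simp: h inner_add_right M(2) inner_commute)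
    moreover have "schwartz ?m"
      by (intro schwartz_moderate_mult moderate_affine f)
    ultimately show "(\<lambda>x. of_real (b \<bullet> x) * h x) \<in> ?X"
      by (intro CollectI exI[of _ ?m] conjI)
  qed
qed

lemma schwartz_translate: "schwartz f \<Longrightarrow> schwartz (\<lambda>x. f (x - p))"
  using schwartz_affine_compose[of f "\<lambda>x. x" "- p"] by (simp add: linear_id[unfolded id_def])

lemma schwartz_reflect: "schwartz f \<Longrightarrow> schwartz (\<lambda>x. f (- x))"
  using schwartz_affine_compose[of f "\<lambda>x. - x" 0] by (simp add: linear_uminus)

lemma schwartz_slice: "schwartz F \<Longrightarrow> schwartz (\<lambda>t. F (x, t))"
  using schwartz_affine_compose[of F "\<lambda>t. (0, t)" "(x, 0)"]
  by (simp add: inj_def linear_iff)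

lemma schwartz_cnj:
  fixes f :: "'a::euclidean_space \<Rightarrow> complex"
  assumes "schwartz f"
  shows "schwartz (\<lambda>x. cnj (f x))"
proof -
  let ?X = "{\<lambda>x. cnj (f x) | f :: 'a \<Rightarrow> complex. schwartz f}"
  have D: "((\<lambda>x. cnj (f x)) has_derivative (\<lambda>v. cnj (dir_deriv v f x))) (at x)"
    if "schwartz f" for f :: "'a \<Rightarrow> complex" and x
    by (intro has_derivative_cnj has_derivative_dir_deriv schwartz_differentiable that)
  show ?thesis
  proof (rule schwartz_coinduct[where X = ?X])
    fix h assume "h \<in> ?X"
    then obtain f where h: "h = (\<lambda>x. cnj (f x))" and f: "schwartz f" by blast
    show "\<exists>C. \<forall>x. cmod (h x) \<le> C"
      using schwartz_bounded[OF f] unfolding h by simp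
    show "h differentiable (at x)" for x
      unfolding h differentiable_def using D[OF f] by blast
    fix b :: 'a assume "b \<in> Basis"
    have "dir_deriv b h = (\<lambda>x. cnj (dir_deriv b f x))"
      unfolding h by (intro ext dir_deriv_eqI[OF D[OF f]])
    then show "dir_deriv b h \<in> ?X"
      using schwartz_dir_deriv[OF f] by blast
    have "(\<lambda>x. of_real (b \<bullet> x) * h x) = (\<lambda>x. cnj (of_real (b \<bullet> x) * f x))"
      by (simp add: h)
    moreover have "schwartz (\<lambda>x. of_real (b \<bullet> x) * f x)"
      by (rule schwartz_inner_mult[OF f])
    ultimately show "(\<lambda>x. of_real (b \<bullet> x) * h x) \<in> ?X"
      by (intro CollectI exI[of _ "\<lambda>x. of_real (b \<bullet> x) * f x"] conjI)
  qed (use assms in blast)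
qed

lemma schwartz_tensor:
  fixes f :: "'a::euclidean_space \<Rightarrow> complex" and g :: "'b::euclidean_space \<Rightarrow> complex"
  assumes "schwartz f" "schwartz g"
  shows "schwartz (\<lambda>z. f (fst z) * g (snd z))"
proof -
  let ?X = "{\<lambda>z::'a \<times> 'b. f (fst z) * g (snd z) | f g. schwartz f \<and> schwartz g}"
  have D: "((\<lambda>z. f (fst z) * g (snd z)) has_derivative
      (\<lambda>v. f (fst z) * dir_deriv (snd v) g (snd z) + dir_deriv (fst v) f (fst z) * g (snd z))) (at z)"
    if "schwartz f" "schwartz g" for f :: "'a \<Rightarrow> complex" and g :: "'b \<Rightarrow> complex" and z
    by (intro has_derivative_mult has_derivative_compose[OF has_derivative_fst[OF has_derivative_ident]]
        has_derivative_compose[OF has_derivative_snd[OF has_derivative_ident]]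
        has_derivative_dir_deriv schwartz_differentiable that)
  show ?thesis
  proof (rule schwartz_coinduct[where X = ?X])
    fix h assume "h \<in> ?X"
    then obtain f g where h: "h = (\<lambda>z. f (fst z) * g (snd z))" and fg: "schwartz f" "schwartz g" by blast
    obtain C E where "\<And>x. cmod (f x) \<le> C" "\<And>y. cmod (g y) \<le> E"
      using schwartz_bounded fg by metis
    then have "cmod (h z) \<le> C * E" for z
      unfolding h norm_mult by (intro mult_mono) (auto intro: order_trans[OF norm_ge_zero])
    then show "\<exists>C. \<forall>x. cmod (h x) \<le> C"
      by blast
    show "h differentiable (at x)" for x
      unfolding h differentiable_def using D[OF fg] by blast
    fix b :: "'a \<times> 'b" assume "b \<in> Basis"
    then consider a where "b = (a, 0)" | a where "b = (0, a)"
      unfolding Basis_prod_def by blast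
    then have "dir_deriv b h \<in> ?X \<and> (\<lambda>x. of_real (b \<bullet> x) * h x) \<in> ?X"
    proof cases
      case (1 a)
      have "dir_deriv b h = (\<lambda>z. dir_deriv a f (fst z) * g (snd z))"
        unfolding h 1 by (rule ext) (simp add: dir_deriv_eqI[OF D[OF fg]] linear_0[OF linear_dir_deriv] fg)
      moreover have "(\<lambda>x. of_real (b \<bullet> x) * h x) = (\<lambda>z. (of_real (a \<bullet> fst z) * f (fst z)) * g (snd z))"
        by (simp add: h 1 inner_prod_def mult_ac)
      moreover have X: "(\<lambda>z. k (fst z) * g (snd z)) \<in> ?X" if "schwartz k" for k
        using that fg(2) by blast
      ultimately show ?thesis
        using X[OF schwartz_dir_deriv[OF fg(1), of a]] X[OF schwartz_inner_mult[OF fg(1), of a]] by (simp only:)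
    next
      case (2 a)
      have "dir_deriv b h = (\<lambda>z. f (fst z) * dir_deriv a g (snd z))"
        unfolding h 2 by (rule ext) (simp add: dir_deriv_eqI[OF D[OF fg]] linear_0[OF linear_dir_deriv] fg)
      moreover have "(\<lambda>x. of_real (b \<bullet> x) * h x) = (\<lambda>z. f (fst z) * (of_real (a \<bullet> snd z) * g (snd z)))"
        by (simp add: h 2 inner_prod_def mult_ac)
      moreover have X: "(\<lambda>z. f (fst z) * k (snd z)) \<in> ?X" if "schwartz k" for k
        using that fg(1) by blast
      ultimately show ?thesis
        using X[OF schwartz_dir_deriv[OF fg(2), of a]] X[OF schwartz_inner_mult[OF fg(2), of a]] by (simp only:)
    qed
    then show "dir_deriv b h \<in> ?X" "(\<lambda>x. of_real (b \<bullet> x) * h x) \<in> ?X"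
      by blast+
  qed (use assms in blast)
qed

lemma power_le_fact_exp:
  assumes "0 \<le> (x::real)"
  shows "x ^ k \<le> fact k * exp x"
proof -
  have "x ^ k / fact k \<le> (\<Sum>n. x ^ n / fact n)"
    using sum_le_suminf[OF summable_exp_generic, of "{k}" x] assms
    by (auto simp: scaleR_conv_of_real divide_inverse mult_ac)
  also have "\<dots> = exp x"
    by (simp add: exp_def scaleR_conv_of_real divide_inverse mult_ac)
  finally show ?thesis
    by (simp add: divide_simps mult_ac)
qed

definition gaussian :: "'a::euclidean_space \<Rightarrow> complex" where
  "gaussian x = of_real (exp (- pi * (norm x)\<^sup>2))"

lemma rapidly_decaying_gaussian: "rapidly_decaying (gaussian :: 'a::euclidean_space \<Rightarrow> complex)"
  unfolding rapidly_decaying_def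
proof
  fix k
  have "(1 + norm x) ^ k * cmod (gaussian x) \<le> fact k * exp 2" for x :: 'a
  proof -
    have "(norm x)\<^sup>2 \<le> pi * (norm x)\<^sup>2"
      using pi_gt3 by (intro mult_le_cancel_right1[THEN iffD2]) auto
    moreover have "norm x \<le> 1 + (norm x)\<^sup>2"
      using zero_le_power2[of "norm x - 1/2"] by (simp add: power2_eq_square algebra_simps)
    ultimately have "1 + norm x + (- pi * (norm x)\<^sup>2) \<le> 2"
      by simp
    then have "exp (1 + norm x) * exp (- pi * (norm x)\<^sup>2) \<le> exp 2"
      by (simp add: exp_add[symmetric])
    then have "fact k * exp (1 + norm x) * exp (- pi * (norm x)\<^sup>2) \<le> fact k * exp 2"
      by (simp add: mult.assoc)
    moreover have "(1 + norm x) ^ k * exp (- pi * (norm x)\<^sup>2)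
        \<le> fact k * exp (1 + norm x) * exp (- pi * (norm x)\<^sup>2)"
      by (intro mult_right_mono power_le_fact_exp) auto
    moreover have "cmod (gaussian x) = exp (- pi * (norm x)\<^sup>2)"
      by (simp add: gaussian_def)
    ultimately show ?thesis
      by (metis order_trans)
  qed
  then show "\<exists>C. \<forall>x::'a. (1 + norm x) ^ k * cmod (gaussian x) \<le> C"
    by blast
qed

lemma has_derivative_gaussian:
  fixes x :: "'a::euclidean_space"
  shows "(gaussian has_derivative (\<lambda>v. of_real (- 2 * pi * (x \<bullet> v)) * gaussian x)) (at x)"
proof -
  have "((\<lambda>x::'a. exp (- pi * (x \<bullet> x))) has_derivative
      (\<lambda>v. (- 2 * pi * (x \<bullet> v)) * exp (- pi * (x \<bullet> x)))) (at x)"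
    by (auto intro!: derivative_eq_intros simp: inner_commute algebra_simps)
  from has_derivative_of_real[OF this, where ?'a = complex]
  show ?thesis
    unfolding gaussian_def[abs_def] power2_norm_eq_inner by simp
qed

lemma schwartz_gaussian: "schwartz (gaussian :: 'a::euclidean_space \<Rightarrow> complex)"
  unfolding schwartz_derivs_in
proof (rule derivs_in_coinduct[where X = "{\<lambda>x. m x * gaussian x | m. moderate m}"])
  let ?X = "{\<lambda>x::'a. m x * gaussian x | m. moderate m}"
  show "gaussian \<in> ?X"
    using moderate_const[of 1] by (intro CollectI exI[of _ "\<lambda>x. 1"]) simp
  fix h assume "h \<in> ?X"
  then obtain m where h: "h = (\<lambda>x. m x * gaussian x)" and m: "moderate m" by blast
  have D: "(h has_derivative (\<lambda>v. m x * (of_real (- 2 * pi * (x \<bullet> v)) * gaussian x)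
      + dir_deriv v m x * gaussian x)) (at x)" for x
    unfolding h
    by (intro has_derivative_mult has_derivative_gaussian has_derivative_dir_deriv
        moderate_differentiable m)
  then show "h differentiable (at x)" for x
    unfolding differentiable_def by blast
  show "rapidly_decaying h"
    using m unfolding h moderate_def
    by (intro rapidly_decaying_mult rapidly_decaying_gaussian derivs_inD(1)[of polynomially_bounded])
  fix b :: 'a assume b: "b \<in> Basis"
  let ?m = "\<lambda>x. of_real (((- 2 * pi) *\<^sub>R b) \<bullet> x) * m x + dir_deriv b m x"
  have "dir_deriv b h = (\<lambda>x. ?m x * gaussian x)"
    by (rule ext) (simp add: dir_deriv_eqI[OF D] inner_commute algebra_simps)
  moreover have "moderate ?m"
    by (intro moderate_add moderate_mult moderate_inner moderate_dir_deriv m b)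
  ultimately show "dir_deriv b h \<in> sum_closure ?X"
    by (intro sum_closure.base CollectI exI[of _ ?m] conjI)
qed (rule rapidly_decaying_add)

lemma moderate_cis:
  fixes v :: "'a::euclidean_space"
  shows "moderate (\<lambda>x. cis (v \<bullet> x))"
  unfolding moderate_def
proof (rule derivs_in_coinduct[where X = "{\<lambda>x. c * cis (v \<bullet> x) | c. True}"])
  let ?X = "{\<lambda>x. c * cis (v \<bullet> x) | c. True}"
  have "(\<lambda>x. cis (v \<bullet> x)) = (\<lambda>x. 1 * cis (v \<bullet> x))"
    by simp
  then show "(\<lambda>x. cis (v \<bullet> x)) \<in> ?X"
    by blast
  fix h assume "h \<in> ?X"
  then obtain c where h: "h = (\<lambda>x. c * cis (v \<bullet> x))" by blast
  have D: "(h has_derivative (\<lambda>w. c * ((v \<bullet> w) *\<^sub>R (\<i> * cis (v \<bullet> x))))) (at x)" for x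
    unfolding h by (intro has_derivative_mult_right has_derivative_cis derivative_intros)
  then show "h differentiable (at x)" for x
    unfolding differentiable_def by blast
  have "cmod (h x) \<le> cmod c * (1 + norm x) ^ 0" for x
    by (simp add: h norm_mult)
  then show "polynomially_bounded h"
    unfolding polynomially_bounded_def by blast
  fix b :: 'a
  have "dir_deriv b h = (\<lambda>x. (c * of_real (v \<bullet> b) * \<i>) * cis (v \<bullet> x))"
    by (rule ext) (simp add: dir_deriv_eqI[OF D] scaleR_conv_of_real)
  then show "dir_deriv b h \<in> sum_closure ?X"
    by (blast intro: sum_closure.base)
qed (rule polynomially_bounded_add)


section \<open>Test functions and partitions of unity\<close>

lemma has_derivative_zero_on_open:
  assumes "open U" "x \<in> U" "\<And>y. y \<in> U \<Longrightarrow> f y = 0"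
  shows "(f has_derivative (\<lambda>_. 0)) (at x)"
  using has_derivative_transform_within_open[OF has_derivative_const assms(1,2), of 0 f] assms(3)
  by auto

lemma dir_deriv_zero_off_closed:
  assumes "closed K" "\<And>y. y \<notin> K \<Longrightarrow> f y = 0" "x \<notin> K"
  shows "dir_deriv b f x = 0"
  by (rule dir_deriv_eqI[OF has_derivative_zero_on_open[of "- K"]]) (use assms in \<open>auto simp: open_closed\<close>)

lemma eq_0_off_support: "x \<notin> closure {x. f x \<noteq> 0} \<Longrightarrow> f x = 0"
  using closure_subset[of "{x. f x \<noteq> 0}"] by auto

lemma smooth_compact_support_schwartz:
  fixes f :: "'a::euclidean_space \<Rightarrow> complex"
  assumes "smooth f" and K: "compact K" and "\<And>x. x \<notin> K \<Longrightarrow> f x = 0"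
  shows "schwartz f"
  unfolding schwartz_derivs_in
proof (rule derivs_in_coinduct[where X = "{f. smooth f \<and> (\<forall>x. x \<notin> K \<longrightarrow> f x = 0)}"])
  fix h :: "'a \<Rightarrow> complex" assume h: "h \<in> {f. smooth f \<and> (\<forall>x. x \<notin> K \<longrightarrow> f x = 0)}"
  then show "h differentiable (at x)" for x
    using smooth_differentiable by blast
  then have "continuous_on UNIV h"
    by (simp add: continuous_on_eq_continuous_at differentiable_imp_continuous_within)
  then have cont: "continuous_on K h"
    by (rule continuous_on_subset) simp
  show "rapidly_decaying h"
    unfolding rapidly_decaying_def
  proof
    fix k
    have "compact ((\<lambda>x. (1 + norm x) ^ k * cmod (h x)) ` K)"
      by (intro compact_continuous_image continuous_intros cont K)
    then have "bdd_above ((\<lambda>x. (1 + norm x) ^ k * cmod (h x)) ` K)"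
      by (intro bounded_imp_bdd_above compact_imp_bounded)
    then obtain C where "\<And>x. x \<in> K \<Longrightarrow> (1 + norm x) ^ k * cmod (h x) \<le> C"
      by (auto simp: bdd_above_def)
    then have "(1 + norm x) ^ k * cmod (h x) \<le> max C 0" for x
      using h by (cases "x \<in> K") (auto simp: le_max_iff_disj)
    then show "\<exists>C. \<forall>x. (1 + norm x) ^ k * cmod (h x) \<le> C" by blast
  qed
  fix b :: 'a assume "b \<in> Basis"
  then show "dir_deriv b h \<in> sum_closure {f. smooth f \<and> (\<forall>x. x \<notin> K \<longrightarrow> f x = 0)}"
    using h smooth_dir_deriv dir_deriv_zero_off_closed[OF compact_imp_closed[OF K]]
    by (intro sum_closure.base) auto
qed (use assms rapidly_decaying_add in auto)

lemma test_function_schwartz: "test_function f \<Longrightarrow> schwartz f"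
  unfolding test_function_def
  by (rule smooth_compact_support_schwartz[of f "closure {x. f x \<noteq> 0}"]) (auto intro: eq_0_off_support)

lemma test_functionI:
  assumes "smooth f" "compact K" "\<And>x. x \<notin> K \<Longrightarrow> f x = 0"
  shows "test_function f"
  unfolding test_function_def
proof
  have "closure {x. f x \<noteq> 0} \<subseteq> K"
    using assms by (intro closure_minimal) (auto simp: compact_imp_closed)
  then show "compact (closure {x. f x \<noteq> 0})"
    using assms(2) by (meson closed_closure compact_closure bounded_subset compact_imp_bounded bounded_closure compact_eq_bounded_closed)
qed fact

text \<open>The quotient is \<open>0\<close> off \<open>K\<close>, where \<open>g\<close> may vanish, because \<open>x / 0 = 0\<close>. The family in the coinduction
  consists of the quotients by all powers of \<open>g\<close>, with numerators vanishing off \<open>K\<close>.\<close>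

lemma smooth_divide:
  fixes f g :: "'a::euclidean_space \<Rightarrow> complex"
  assumes f: "smooth f" "\<And>x. x \<notin> K \<Longrightarrow> f x = 0"
    and K: "closed K" and g: "smooth g" "\<And>x. x \<in> K \<Longrightarrow> g x \<noteq> 0"
  shows "smooth (\<lambda>x. f x / g x)"
  unfolding smooth_derivs_in
proof (rule derivs_in_coinduct[where
      X = "{\<lambda>x. f x / g x ^ n | f n. smooth f \<and> (\<forall>x. x \<notin> K \<longrightarrow> f x = 0)}"])
  let ?X = "{\<lambda>x. f x / g x ^ n | f n. smooth f \<and> (\<forall>x. x \<notin> K \<longrightarrow> f x = 0)}"
  have "(\<lambda>x. f x / g x) = (\<lambda>x. f x / g x ^ 1)"
    by simp
  then show "(\<lambda>x. f x / g x) \<in> ?X"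
    using f by blast
  fix h assume "h \<in> ?X"
  then obtain f n where h: "h = (\<lambda>x. f x / g x ^ n)" and f: "smooth f" "\<And>x. x \<notin> K \<Longrightarrow> f x = 0"
    by blast
  let ?f = "\<lambda>b x. dir_deriv b f x * g x + - of_nat n * (f x * dir_deriv b g x)"
  have f': "dir_deriv b f x = 0" if "x \<notin> K" for b x
    by (rule dir_deriv_zero_off_closed[OF K f(2) that])
  have D: "(h has_derivative (\<lambda>v. ?f v x / g x ^ Suc n)) (at x)" for x
  proof (cases "x \<in> K")
    case True
    then have "g x \<noteq> 0" using g by blast
    note Df = has_derivative_dir_deriv[OF smooth_differentiable[OF f(1)], of x]
    note Dg = has_derivative_dir_deriv[OF smooth_differentiable[OF g(1)], of x]
    have "n = 0 \<or> g x ^ n = g x * g x ^ (n - Suc 0)"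
      by (cases n) auto
    then show ?thesis
      unfolding h using \<open>g x \<noteq> 0\<close>
      by (intro has_derivative_eq_rhs[OF has_derivative_divide[OF Df has_derivative_power[OF Dg]]])
        (auto simp: fun_eq_iff field_simps)
  next
    case False
    have "(h has_derivative (\<lambda>v. 0)) (at x)"
      by (rule has_derivative_zero_on_open[of "- K"]) (use False K f in \<open>auto simp: h open_closed\<close>)
    then show ?thesis
      using False f f' by simp
  qed
  then show "h differentiable (at x)" for x
    unfolding differentiable_def by blast
  fix b :: 'a assume b: "b \<in> Basis"
  have "dir_deriv b h = (\<lambda>x. ?f b x / g x ^ Suc n)"
    by (intro ext dir_deriv_eqI[OF D])
  moreover have "smooth (?f b)"
    by (intro smooth_add smooth_mult smooth_dir_deriv f g b moderate_imp_smooth[OF moderate_const])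
  moreover have "?f b x = 0" if "x \<notin> K" for x
    using that f f' by simp
  ultimately show "dir_deriv b h \<in> sum_closure ?X"
    by (intro sum_closure.base CollectI exI[of _ "?f b"] exI[of _ "Suc n"]) simp
qed auto

text \<open>The functions \<open>s\<^sup>-\<^sup>k exp (- 1 / s)\<close>, extended by \<open>0\<close>, form a family closed under derivatives up to linear
  combinations, which makes \<open>flat 0\<close> smooth.\<close>

definition flat :: "nat \<Rightarrow> real \<Rightarrow> real" where
  "flat k s = (if s > 0 then exp (- (1 / s)) / s ^ k else 0)"

lemma flat_tendsto_0: "(flat k \<longlongrightarrow> 0) (at 0)"
proof -
  have "((\<lambda>s. (inverse s) ^ k / exp (inverse s)) \<longlongrightarrow> (0::real)) (at_right 0)"
    by (rule filterlim_compose[OF tendsto_power_div_exp_0 filterlim_inverse_at_top_right])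
  then have "(flat k \<longlongrightarrow> 0) (at_right 0)"
    by (rule Lim_transform_eventually)
      (auto simp: eventually_at_right_field flat_def exp_minus field_simps intro!: exI[of _ 1])
  moreover have "(flat k \<longlongrightarrow> 0) (at_left 0)"
    by (rule tendsto_eventually) (auto simp: eventually_at_left_field flat_def intro!: exI[of _ "-1"])
  ultimately show ?thesis
    using filterlim_split_at by blast
qed

lemma flat_has_derivative:
  "(flat k has_real_derivative (flat (k + 2) s - of_nat k * flat (k + 1) s)) (at s)"
proof -
  consider "s > 0" | "s < 0" | "s = 0" by linarith
  then show ?thesis
  proof cases
    case 1
    have "((\<lambda>s. exp (- (1 / s)) / s ^ k) has_real_derivative (flat (k + 2) s - of_nat k * flat (k + 1) s)) (at s)"
      using 1 power_minus_mult[of k s]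
      by (cases "k = 0") (auto intro!: derivative_eq_intros simp: flat_def field_simps power2_eq_square)
    then show ?thesis
      by (rule has_field_derivative_transform_within_open[where S = "{0<..}"])
        (use 1 in \<open>auto simp: flat_def\<close>)
  next
    case 2
    have "((\<lambda>s. 0) has_real_derivative (flat (k + 2) s - of_nat k * flat (k + 1) s)) (at s)"
      using 2 by (simp add: flat_def)
    then show ?thesis
      by (rule has_field_derivative_transform_within_open[where S = "{..<0}"])
        (use 2 in \<open>auto simp: flat_def\<close>)
  next
    case 3
    have "((\<lambda>h. (flat k (0 + h) - flat k 0) / h) \<longlongrightarrow> 0) (at 0)"
      by (rule Lim_transform_eventually[OF flat_tendsto_0[of "Suc k"]])
        (auto simp: flat_def eventually_at_filter)
    then show ?thesis
      using 3 by (simp add: flat_def DERIV_def)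
  qed
qed

text \<open>A smooth function that is nonzero exactly on the ball of radius \<open>\<epsilon>\<close> about \<open>p\<close>. Functions supported inside
  the ball may be divided by it, so that it can play the role of a cutoff.\<close>

definition bump :: "'a::euclidean_space \<Rightarrow> real \<Rightarrow> 'a \<Rightarrow> complex" where
  "bump p \<epsilon> x = of_real (flat 0 (\<epsilon>\<^sup>2 - (x - p) \<bullet> (x - p)))"

lemma smooth_bump: "smooth (bump p \<epsilon>)"
  unfolding smooth_derivs_in
proof (rule derivs_in_coinduct[where
      X = "{\<lambda>x. f x * of_real (flat k (\<epsilon>\<^sup>2 - (x - p) \<bullet> (x - p))) | f k. smooth f}"])
  let ?s = "\<lambda>x. \<epsilon>\<^sup>2 - (x - p) \<bullet> (x - p)"
  let ?X = "{\<lambda>x. f x * of_real (flat k (?s x)) | f k. smooth f}"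
  show "bump p \<epsilon> \<in> ?X"
    using moderate_imp_smooth[OF moderate_const[of 1]]
    by (intro CollectI exI[of _ "\<lambda>x. 1"] exI[of _ 0]) (simp add: bump_def fun_eq_iff)
  fix h assume "h \<in> ?X"
  then obtain f k where h: "h = (\<lambda>x. f x * of_real (flat k (?s x)))" and f: "smooth f" by blast
  have D: "(h has_derivative (\<lambda>v. f x * of_real ((-2 * ((x - p) \<bullet> v)) * (flat (k + 2) (?s x) - of_nat k * flat (k + 1) (?s x)))
      + dir_deriv v f x * of_real (flat k (?s x)))) (at x)" for x
  proof -
    have "(?s has_derivative (\<lambda>v. -2 * ((x - p) \<bullet> v))) (at x)"
      by (auto intro!: derivative_eq_intros simp: inner_commute)
    from has_derivative_compose[OF this flat_has_derivative[unfolded has_field_derivative_def]]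
    have "((\<lambda>x. flat k (?s x)) has_derivative
       (\<lambda>v. (-2 * ((x - p) \<bullet> v)) * (flat (k + 2) (?s x) - of_nat k * flat (k + 1) (?s x)))) (at x)"
      by (simp add: mult.commute)
    then show ?thesis
      unfolding h
      by (intro has_derivative_mult has_derivative_of_real has_derivative_dir_deriv
          smooth_differentiable f)
  qed
  then show "h differentiable (at x)" for x
    unfolding differentiable_def by blast
  fix b :: 'a assume b: "b \<in> Basis"
  let ?l = "\<lambda>x. complex_of_real (((-2) *\<^sub>R b) \<bullet> x) + of_real (2 * (p \<bullet> b))"
  have "dir_deriv b h = (\<lambda>x. ((?l x * f x) * of_real (flat (k + 2) (?s x))
      + ((of_nat k * (- ?l x)) * f x) * of_real (flat (k + 1) (?s x)))
      + dir_deriv b f x * of_real (flat k (?s x)))"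
    by (rule ext) (simp add: dir_deriv_eqI[OF D] inner_diff_left inner_commute algebra_simps)
  moreover have "smooth (\<lambda>x. ?l x * f x)"
    by (intro smooth_mult f moderate_imp_smooth[OF moderate_affine])
  moreover have "smooth (\<lambda>x. (of_nat k * (- ?l x)) * f x)"
    using smooth_mult[OF moderate_imp_smooth[OF moderate_const[of "- of_nat k"]] \<open>smooth (\<lambda>x. ?l x * f x)\<close>]
    by (simp add: algebra_simps)
  moreover have "(\<lambda>x. f x * of_real (flat k (?s x))) \<in> sum_closure ?X" if "smooth f" for f k
    using that by (intro sum_closure.base CollectI exI[of _ f] exI[of _ k]) simp
  ultimately show "dir_deriv b h \<in> sum_closure ?X"
    using smooth_dir_deriv[OF f b] by (simp only:) (intro sum_closure.add; assumption)
qed auto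

lemma bump_nonzero_iff: "\<epsilon> > 0 \<Longrightarrow> bump p \<epsilon> x \<noteq> 0 \<longleftrightarrow> x \<in> ball p \<epsilon>"
proof -
  assume "\<epsilon> > 0"
  have "(x - p) \<bullet> (x - p) = (dist p x)\<^sup>2"
    by (metis dist_norm norm_minus_commute power2_norm_eq_inner)
  then show ?thesis
    using abs_le_square_iff[of \<epsilon> "dist p x"] \<open>\<epsilon> > 0\<close> by (simp add: bump_def flat_def not_less[symmetric])
qed

lemma test_function_bump:
  assumes "\<epsilon> > 0"
  shows "test_function (bump p \<epsilon>)"
proof (rule test_functionI[OF smooth_bump, of "cball p \<epsilon>"])
  show "bump p \<epsilon> x = 0" if "x \<notin> cball p \<epsilon>" for x
    using bump_nonzero_iff[OF assms, of p x] that by auto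
qed simp

lemma closure_bump: "\<epsilon> > 0 \<Longrightarrow> closure {x. bump p \<epsilon> x \<noteq> 0} \<subseteq> cball p \<epsilon>"
  using bump_nonzero_iff[of \<epsilon> p] by (intro closure_minimal) auto

text \<open>A partition of unity: cover the compact support by finitely many bumps with supports in the sets
  \<open>V i\<close>, and divide \<open>\<phi>\<close> by the sum of these bumps, which is positive on the support.\<close>

lemma test_function_decomposition:
  fixes \<phi> :: "'a::euclidean_space \<Rightarrow> complex"
  assumes \<phi>: "test_function \<phi>" and V: "\<And>p. open (V p)" "\<And>p. p \<in> V p"
  obtains I \<psi> where "finite I" "\<And>i. i \<in> I \<Longrightarrow> test_function (\<psi> i)"
    "\<And>i. i \<in> I \<Longrightarrow> closure {x. \<psi> i x \<noteq> 0} \<subseteq> V i" "\<And>i x. \<phi> x = 0 \<Longrightarrow> \<psi> i x = 0"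
    "\<And>x. \<phi> x = (\<Sum>i\<in>I. \<psi> i x)"
proof -
  let ?K = "closure {x. \<phi> x \<noteq> 0}"
  have K: "compact ?K" "smooth \<phi>"
    using \<phi> unfolding test_function_def by auto
  have "\<forall>p. \<exists>e>0. cball p e \<subseteq> V p"
    using V open_contains_cball by blast
  then obtain e where e: "\<And>p. e p > 0" "\<And>p. cball p (e p) \<subseteq> V p"
    by metis
  have "?K \<subseteq> (\<Union>i\<in>UNIV. ball i (e i))"
    using centre_in_ball e(1) by blast
  then obtain I where I: "finite I" "?K \<subseteq> (\<Union>i\<in>I. ball i (e i))"
    using compactE_image[OF K(1), of UNIV "\<lambda>i. ball i (e i)"] by (metis open_ball)
  define s where "s = (\<lambda>x. \<Sum>i\<in>I. bump i (e i) x)"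
  have "smooth s"
    unfolding s_def using I(1)
    by (induction I) (auto intro: smooth_add smooth_bump moderate_imp_smooth moderate_const)
  have s_re: "s x = of_real (\<Sum>i\<in>I. flat 0 ((e i)\<^sup>2 - (x - i) \<bullet> (x - i)))" for x
    by (simp add: s_def bump_def)
  have s_nz: "s x \<noteq> 0" if "x \<in> ?K" for x
  proof -
    from that I(2) obtain i where i: "i \<in> I" "x \<in> ball i (e i)" by blast
    then have "flat 0 ((e i)\<^sup>2 - (x - i) \<bullet> (x - i)) \<noteq> 0"
      using bump_nonzero_iff[OF e(1)] by (metis bump_def of_real_0)
    moreover have "flat 0 t \<ge> 0" for t
      by (simp add: flat_def)
    ultimately have "0 < (\<Sum>i\<in>I. flat 0 ((e i)\<^sup>2 - (x - i) \<bullet> (x - i)))"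
      by (intro sum_pos2[OF I(1) i(1)]) (auto simp: less_le)
    then show ?thesis
      unfolding s_re by (metis of_real_eq_0_iff less_irrefl)
  qed
  note \<phi>0 = eq_0_off_support[of _ \<phi>]
  define \<psi> where "\<psi> = (\<lambda>i x. bump i (e i) x * (\<phi> x / s x))"
  have "smooth (\<lambda>x. \<phi> x / s x)"
    using smooth_divide[OF K(2) \<phi>0 closed_closure \<open>smooth s\<close> s_nz] .
  then have sm: "smooth (\<psi> i)" for i
    unfolding \<psi>_def by (intro smooth_mult smooth_bump)
  show thesis
  proof (rule that)
    show "finite I" by fact
    show "test_function (\<psi> i)" if "i \<in> I" for i
      by (rule test_functionI[OF sm K(1)]) (unfold \<psi>_def, subst \<phi>0, simp_all)
    show "closure {x. \<psi> i x \<noteq> 0} \<subseteq> V i" if "i \<in> I" for i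
    proof -
      have "closure {x. \<psi> i x \<noteq> 0} \<subseteq> closure {x. bump i (e i) x \<noteq> 0}"
        by (rule closure_mono) (auto simp: \<psi>_def)
      also have "\<dots> \<subseteq> cball i (e i)"
        by (rule closure_bump[OF e(1)])
      finally show ?thesis
        using e(2) by blast
    qed
    show "\<psi> i x = 0" if "\<phi> x = 0" for i x
      using that by (simp add: \<psi>_def)
    show "\<phi> x = (\<Sum>i\<in>I. \<psi> i x)" for x
    proof (cases "x \<in> ?K")
      case True
      have "(\<Sum>i\<in>I. \<psi> i x) = s x * (\<phi> x / s x)"
        by (simp only: \<psi>_def s_def sum_distrib_right)
      then show ?thesis
        using s_nz[OF True] by simp
    next
      case False
      then show ?thesis
        using \<phi>0[OF False] by (simp add: \<psi>_def)
    qed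
  qed
qed


section \<open>Hadamard's lemma\<close>

text \<open>By the mean value theorem the remainders, divided by the increments, are dominated by \<open>2 g\<close>, so dominated convergence
  applies along every sequence of increments.\<close>

lemma has_derivative_integral_dominated:
  fixes H :: "'a::euclidean_space \<Rightarrow> 't \<Rightarrow> complex"
  assumes D: "\<And>t y. ((\<lambda>y. H y t) has_derivative (\<lambda>v. H' v y t)) (at y)"
    and bound: "\<And>v y t. cmod (H' v y t) \<le> g t * norm v"
    and g: "integrable M g"
    and H: "\<And>y. integrable M (H y)"
    and H': "\<And>v y. integrable M (H' v y)"
  shows "((\<lambda>y. \<integral>t. H y t \<partial>M) has_derivative (\<lambda>v. \<integral>t. H' v y t \<partial>M)) (at y)"
  unfolding has_derivative_at
proof
  have lin: "linear (\<lambda>v. H' v y t)" for t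
    using D by (rule has_derivative_linear)
  have "linear (\<lambda>v. \<integral>t. H' v y t \<partial>M)"
    by (rule linearI) (simp_all add: linear_add[OF lin] linear_scale[OF lin] H')
  then show "bounded_linear (\<lambda>v. \<integral>t. H' v y t \<partial>M)"
    by (simp add: linear_conv_bounded_linear)
  let ?r = "\<lambda>h t. H (y + h) t - H y t - H' h y t"
  let ?q = "\<lambda>h t. cmod (?r h t) / norm h"
  have r_int: "integrable M (?r h)" for h
    using H H' by simp
  have "((\<lambda>h. \<integral>t. ?q h t \<partial>M) \<longlongrightarrow> 0) (at 0)"
    unfolding tendsto_at_iff_sequentially
  proof (intro allI impI)
    fix X :: "nat \<Rightarrow> 'a" assume X: "\<forall>i. X i \<in> UNIV - {0}" "X \<longlonglongrightarrow> 0"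
    have "(\<lambda>i. \<integral>t. ?q (X i) t \<partial>M) \<longlonglongrightarrow> (\<integral>t. 0 \<partial>M)"
    proof (rule integral_dominated_convergence[where w = "\<lambda>t. 2 * g t"])
      show "AE t in M. (\<lambda>i. ?q (X i) t) \<longlonglongrightarrow> 0"
      proof (rule AE_I2)
        fix t
        have "((\<lambda>h. ?q h t) \<longlongrightarrow> 0) (at 0)"
          using D[of t y] unfolding has_derivative_at by simp
        then show "(\<lambda>i. ?q (X i) t) \<longlonglongrightarrow> 0"
          using X unfolding tendsto_at_iff_sequentially comp_def by blast
      qed
      show "AE t in M. norm (?q (X i) t) \<le> 2 * g t" for i
      proof (rule AE_I2)
        fix t
        have "cmod (H (y + X i) t - H y t) \<le> g t * norm (y + X i - y)"
        proof (rule differentiable_bound[of UNIV "\<lambda>y. H y t" "\<lambda>y v. H' v y t"])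
          show "((\<lambda>y. H y t) has_derivative (\<lambda>v. H' v z t)) (at z within UNIV)" for z
            using D by simp
          show "onorm (\<lambda>v. H' v z t) \<le> g t" for z
            using bound[of _ z t] by (rule onorm_le)
        qed auto
        then have "cmod (?r (X i) t) \<le> 2 * g t * norm (X i)"
          using bound[of "X i" y t] norm_triangle_ineq4[of "H (y + X i) t - H y t" "H' (X i) y t"]
          by simp
        then show "norm (?q (X i) t) \<le> 2 * g t"
          using X(1) by (simp add: divide_simps)
      qed
    qed (use r_int g in \<open>auto intro!: borel_measurable_integrable\<close>)
    then show "((\<lambda>h. \<integral>t. ?q h t \<partial>M) \<circ> X) \<longlonglongrightarrow> 0"
      by (simp add: comp_def)
  qed
  then show "(\<lambda>h. norm ((\<integral>t. H (y + h) t \<partial>M) - (\<integral>t. H y t \<partial>M) - (\<integral>t. H' h y t \<partial>M)) / norm h) \<midarrow>0\<rightarrow> 0"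
  proof (rule Lim_null_comparison[rotated])
    have "norm ((\<integral>t. H (y + h) t \<partial>M) - (\<integral>t. H y t \<partial>M) - (\<integral>t. H' h y t \<partial>M)) / norm h
        \<le> (\<integral>t. ?q h t \<partial>M)" for h
    proof -
      have "norm ((\<integral>t. H (y + h) t \<partial>M) - (\<integral>t. H y t \<partial>M) - (\<integral>t. H' h y t \<partial>M))
          = norm (\<integral>t. ?r h t \<partial>M)"
        using H H' by simp
      also have "\<dots> \<le> (\<integral>t. cmod (?r h t) \<partial>M)"
        by (rule integral_norm_bound)
      finally show ?thesis
        by (simp add: divide_right_mono)
    qed
    then show "\<forall>\<^sub>F h in at 0. norm (norm ((\<integral>t. H (y + h) t \<partial>M) - (\<integral>t. H y t \<partial>M) - (\<integral>t. H' h y t \<partial>M)) / norm h)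
        \<le> (\<integral>t. ?q h t \<partial>M)"
      by simp
  qed
qed

text \<open>Expanding \<open>v\<close> in the basis makes the rapid decay uniform in \<open>v\<close>. Such bounds provide the dominating
  functions for differentiation under the integral sign.\<close>

lemma schwartz_linear_family_bound:
  fixes D :: "'b::euclidean_space \<Rightarrow> 'a::euclidean_space \<Rightarrow> complex"
  assumes D: "\<And>v. schwartz (D v)" "\<And>x. linear (\<lambda>v. D v x)"
  shows "\<exists>C. \<forall>v x. (1 + norm x) ^ k * cmod (D v x) \<le> C * norm v"
proof -
  have "\<forall>e. \<exists>C. \<forall>x. (1 + norm x) ^ k * cmod (D e x) \<le> C"
    using schwartz_rapidly_decaying[OF D(1)] unfolding rapidly_decaying_def by blast
  then obtain C where C: "\<And>e x. (1 + norm x) ^ k * cmod (D e x) \<le> C e"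
    by metis
  have "(1 + norm x) ^ k * cmod (D v x) \<le> (\<Sum>e\<in>Basis. C e) * norm v" for v x
  proof -
    have "D v x = D (\<Sum>e\<in>Basis. (v \<bullet> e) *\<^sub>R e) x"
      by (simp add: euclidean_representation)
    then have "(1 + norm x) ^ k * cmod (D v x) = (1 + norm x) ^ k * cmod (\<Sum>e\<in>Basis. (v \<bullet> e) *\<^sub>R D e x)"
      by (simp add: linear_sum[OF D(2)] linear_scale[OF D(2)])
    also have "\<dots> \<le> (1 + norm x) ^ k * (\<Sum>e\<in>Basis. \<bar>v \<bullet> e\<bar> * cmod (D e x))"
      by (intro mult_left_mono order_trans[OF norm_sum] sum_mono) auto
    also have "\<dots> = (\<Sum>e\<in>Basis. \<bar>v \<bullet> e\<bar> * ((1 + norm x) ^ k * cmod (D e x)))"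
      by (simp add: sum_distrib_left mult_ac)
    also have "\<dots> \<le> (\<Sum>e\<in>Basis. norm v * C e)"
      by (intro sum_mono mult_mono C Basis_le_norm) auto
    finally show ?thesis
      by (simp add: sum_distrib_left mult.commute)
  qed
  then show ?thesis by blast
qed

lemmas schwartz_dir_deriv_bound = schwartz_linear_family_bound[OF schwartz_dir_deriv linear_dir_deriv]

lemma schwartz_continuous_on: "schwartz f \<Longrightarrow> continuous_on A f"
  by (meson continuous_at_imp_continuous_on differentiable_imp_continuous_within schwartz_differentiable)

lemma schwartz_continuous_compose:
  "schwartz f \<Longrightarrow> continuous_on A g \<Longrightarrow> continuous_on A (\<lambda>x. f (g x))"
  using continuous_on_compose2[OF schwartz_continuous_on[of f UNIV]] by blast

text \<open>The averages \<open>\<integral>\<^sub>0\<^sup>1 s\<^sup>k f (s x) ds\<close>. Their derivatives are again of this form, with \<open>k\<close> raised by one.\<close>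

definition radial_mean :: "nat \<Rightarrow> ('a::euclidean_space \<Rightarrow> complex) \<Rightarrow> 'a \<Rightarrow> complex" where
  "radial_mean k f x = (\<integral>s. indicator {0..1} s *\<^sub>R (of_real (s ^ k) * f (s *\<^sub>R x)) \<partial>lborel)"

lemma radial_mean_integrable:
  assumes "schwartz f"
  shows "integrable lborel (\<lambda>s. indicator {0..1} s *\<^sub>R (of_real (s ^ k) * f (s *\<^sub>R x)))"
  by (intro borel_integrable_compact compact_Icc continuous_intros schwartz_continuous_compose[OF assms])

lemma has_derivative_radial_mean:
  assumes f: "schwartz f"
  shows "(radial_mean k f has_derivative (\<lambda>v. radial_mean (Suc k) (dir_deriv v f) x)) (at x)"
proof -
  obtain C where C: "\<And>v x. cmod (dir_deriv v f x) \<le> C * norm v"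
    using schwartz_dir_deriv_bound[OF f f, of 0] by auto
  show ?thesis
    unfolding radial_mean_def
  proof (rule has_derivative_integral_dominated[where g = "\<lambda>s. indicator {0..1} s * C"])
    fix s :: real and y v :: 'a
    have "((\<lambda>y. s *\<^sub>R y) has_derivative (\<lambda>v. s *\<^sub>R v)) (at y)"
      by (intro derivative_intros)
    from has_derivative_compose[OF this schwartz_has_derivative[OF f]]
    have "((\<lambda>y. f (s *\<^sub>R y)) has_derivative (\<lambda>v. dir_deriv (s *\<^sub>R v) f (s *\<^sub>R y))) (at y)" .
    moreover have "dir_deriv (s *\<^sub>R v) f z = of_real s * dir_deriv v f z" for v z
      using linear_scale[OF linear_dir_deriv[OF f]]
      by (simp add: scaleR_conv_of_real)
    ultimately have "((\<lambda>y. f (s *\<^sub>R y)) has_derivative (\<lambda>v. of_real s * dir_deriv v f (s *\<^sub>R y))) (at y)"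
      by simp
    from has_derivative_scaleR_right[OF has_derivative_mult_right[OF this, of "of_real (s ^ k)"]]
    show "((\<lambda>y. indicator {0..1} s *\<^sub>R (of_real (s ^ k) * f (s *\<^sub>R y))) has_derivative
        (\<lambda>v. indicator {0..1} s *\<^sub>R (of_real (s ^ Suc k) * dir_deriv v f (s *\<^sub>R y)))) (at y)"
      by (simp add: mult_ac)
    have "s ^ Suc k * cmod (dir_deriv v f (s *\<^sub>R y)) \<le> 1 * (C * norm v)" if "0 \<le> s" "s \<le> 1"
      using that by (intro mult_mono C power_le_one) auto
    then show "cmod (indicator {0..1} s *\<^sub>R (of_real (s ^ Suc k) * dir_deriv v f (s *\<^sub>R y)))
        \<le> indicator {0..1} s * C * norm v"
      by (auto simp: indicator_def norm_mult norm_power)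
  next
    show "integrable lborel (\<lambda>s. indicator {0..1::real} s * C)"
      by (rule integrable_mult_left) simp
  qed (intro radial_mean_integrable f schwartz_dir_deriv)+
qed

lemma moderate_radial_mean:
  fixes f :: "'a::euclidean_space \<Rightarrow> complex"
  assumes f: "schwartz f"
  shows "moderate (radial_mean k f)"
  unfolding moderate_def
proof (rule derivs_in_coinduct[where X = "{radial_mean k f | k f. schwartz f}"])
  fix h :: "'a \<Rightarrow> complex" assume "h \<in> {radial_mean k f | k f. schwartz f}"
  then obtain k f where h: "h = radial_mean k f" and f: "schwartz f" by blast
  show "h differentiable (at x)" for x
    using has_derivative_radial_mean[OF f] unfolding h differentiable_def by blast
  obtain C where C: "\<And>x. cmod (f x) \<le> C"
    using schwartz_bounded[OF f] by blast
  have "cmod (h x) \<le> C * (1 + norm x) ^ 0" for x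
  proof -
    have "cmod (h x) \<le> (\<integral>s. indicator {0..1::real} s * C \<partial>lborel)"
      unfolding h radial_mean_def
    proof (rule order_trans[OF integral_norm_bound integral_mono])
      fix s :: real
      have "s ^ k * cmod (f (s *\<^sub>R x)) \<le> 1 * C" if "0 \<le> s" "s \<le> 1"
        using that by (intro mult_mono C power_le_one) auto
      then show "cmod (indicator {0..1} s *\<^sub>R (of_real (s ^ k) * f (s *\<^sub>R x))) \<le> indicator {0..1} s * C"
        by (auto simp: indicator_def norm_mult norm_power)
    next
      show "integrable lborel (\<lambda>s. cmod (indicator {0..1} s *\<^sub>R (of_real (s ^ k) * f (s *\<^sub>R x))))"
        by (rule integrable_norm[OF radial_mean_integrable[OF f]])
    qed (rule integrable_mult_left, simp)
    then show ?thesis by simp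
  qed
  then show "polynomially_bounded h"
    unfolding polynomially_bounded_def by blast
  fix b :: 'a
  have "dir_deriv b h = radial_mean (Suc k) (dir_deriv b f)"
    unfolding h by (intro ext dir_deriv_eqI[OF has_derivative_radial_mean[OF f]])
  then show "dir_deriv b h \<in> sum_closure {radial_mean k f | k f. schwartz f}"
    using schwartz_dir_deriv[OF f] by (blast intro: sum_closure.base)
qed (use f polynomially_bounded_add in blast)+

lemma radial_fundamental_theorem:
  fixes f :: "'a::euclidean_space \<Rightarrow> complex"
  assumes f: "schwartz f"
  shows "f x - f 0 = (\<integral>s. indicator {0..1} s *\<^sub>R dir_deriv x f (s *\<^sub>R x) \<partial>lborel)"
proof -
  have "(\<integral>s. indicator {0..1} s *\<^sub>R dir_deriv x f (s *\<^sub>R x) \<partial>lborel) = f (1 *\<^sub>R x) - f (0 *\<^sub>R x)"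
  proof (rule integral_FTC_Icc)
    fix s :: real
    have "((\<lambda>s. s *\<^sub>R x) has_derivative (\<lambda>h. h *\<^sub>R x)) (at s within {0..1})"
      by (intro derivative_intros)
    from has_derivative_compose[OF this schwartz_has_derivative[OF f]]
    show "((\<lambda>s. f (s *\<^sub>R x)) has_vector_derivative dir_deriv x f (s *\<^sub>R x)) (at s within {0..1})"
      unfolding has_vector_derivative_def
      using linear_scale[OF linear_dir_deriv[OF f]]
      by simp
    show "continuous_on {0..1} (\<lambda>s. dir_deriv x f (s *\<^sub>R x))"
      by (intro schwartz_continuous_compose[OF schwartz_dir_deriv[OF f]] continuous_intros)
  qed simp
  then show ?thesis by simp
qed

text \<open>The usual Hadamard factors \<open>h\<^sub>e x = \<integral>\<^sub>0\<^sup>1 \<partial>\<^sub>e f (s x) ds\<close> satisfy \<open>f x = \<Sum>\<^sub>e x\<^sub>e h\<^sub>e x\<close> but do not decay, so they are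
  used for the part \<open>g f\<close> only, where \<open>g\<close> is the Gaussian. For \<open>(1 - g) f\<close> one divides by
  \<open>\<bar>x\<bar>\<^sup>2\<close>: with \<open>E x = 2 \<pi> \<integral>\<^sub>0\<^sup>1 s g (s x) ds\<close>, a multiplier of the Schwartz space, the fundamental theorem
  gives \<open>1 - g x = \<bar>x\<bar>\<^sup>2 E x\<close>, hence \<open>(1 - g x) f x = \<Sum>\<^sub>e x\<^sub>e (x\<^sub>e f x E x)\<close>.\<close>

lemma schwartz_hadamard:
  fixes f :: "'a::euclidean_space \<Rightarrow> complex"
  assumes f: "schwartz f" and "f 0 = 0"
  obtains F where "\<And>e. e \<in> Basis \<Longrightarrow> schwartz (F e)"
    "\<And>x. f x = (\<Sum>e\<in>Basis. of_real (e \<bullet> x) * F e x)"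
proof
  let ?E = "\<lambda>x. of_real (2 * pi) * radial_mean 1 gaussian x"
  let ?F = "\<lambda>e x. gaussian x * radial_mean 0 (dir_deriv e f) x + of_real (e \<bullet> x) * f x * ?E x"
  show "schwartz (?F e)" for e
  proof (rule schwartz_add)
    show "schwartz (\<lambda>x. gaussian x * radial_mean 0 (dir_deriv e f) x)"
      using schwartz_moderate_mult[OF moderate_radial_mean[OF schwartz_dir_deriv[OF f]] schwartz_gaussian]
      by (simp add: mult.commute)
    have "schwartz (\<lambda>x. ?E x * (of_real (e \<bullet> x) * f x))"
      by (intro schwartz_moderate_mult moderate_mult moderate_const moderate_radial_mean
          schwartz_gaussian moderate_inner f)
    then show "schwartz (\<lambda>x. of_real (e \<bullet> x) * f x * ?E x)"
      by (simp add: mult_ac)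
  qed
  fix x
  have "f x = (\<integral>s. indicator {0..1} s *\<^sub>R dir_deriv x f (s *\<^sub>R x) \<partial>lborel)"
    using radial_fundamental_theorem[OF f, of x] \<open>f 0 = 0\<close> by simp
  also have "\<dots> = (\<integral>s. (\<Sum>e\<in>Basis. of_real (e \<bullet> x) *
      (indicator {0..1} s *\<^sub>R (of_real (s ^ 0) * dir_deriv e f (s *\<^sub>R x)))) \<partial>lborel)"
    by (intro Bochner_Integration.integral_cong refl, subst dir_deriv_Basis_expansion[OF schwartz_differentiable[OF f]])
      (simp add: sum_distrib_left inner_commute scaleR_conv_of_real mult_ac)
  also have "\<dots> = (\<Sum>e\<in>Basis. of_real (e \<bullet> x) * radial_mean 0 (dir_deriv e f) x)"
    unfolding radial_mean_def
    by (subst Bochner_Integration.integral_sum)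
      (intro integrable_mult_right radial_mean_integrable schwartz_dir_deriv f, simp only: integral_mult_right_zero)
  finally have f_eq: "f x = (\<Sum>e\<in>Basis. of_real (e \<bullet> x) * radial_mean 0 (dir_deriv e f) x)" .
  have "gaussian x - gaussian (0::'a) = (\<integral>s. indicator {0..1} s *\<^sub>R dir_deriv x gaussian (s *\<^sub>R x) \<partial>lborel)"
    by (rule radial_fundamental_theorem[OF schwartz_gaussian])
  also have "\<dots> = (\<integral>s. of_real (- 2 * pi * (x \<bullet> x)) *
      (indicator {0..1} s *\<^sub>R (of_real (s ^ 1) * gaussian (s *\<^sub>R x))) \<partial>lborel)"
    by (intro Bochner_Integration.integral_cong refl)
      (simp add: dir_deriv_eqI[OF has_derivative_gaussian] scaleR_conv_of_real)
  also have "\<dots> = of_real (- 2 * pi * (x \<bullet> x)) * radial_mean 1 gaussian x"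
    unfolding radial_mean_def by (rule integral_mult_right_zero)
  finally have g_eq: "of_real (x \<bullet> x) * ?E x = 1 - gaussian x"
    by (simp add: gaussian_def algebra_simps)
  have "(\<Sum>e\<in>Basis. of_real (e \<bullet> x) * ?F e x)
      = gaussian x * (\<Sum>e\<in>Basis. of_real (e \<bullet> x) * radial_mean 0 (dir_deriv e f) x)
        + of_real (\<Sum>e\<in>Basis. (x \<bullet> e) * (x \<bullet> e)) * (f x * ?E x)"
    by (simp add: sum.distrib sum_distrib_left sum_distrib_right algebra_simps inner_commute)
  also have "\<dots> = gaussian x * f x + of_real (x \<bullet> x) * (f x * ?E x)"
    by (simp only: f_eq[symmetric] euclidean_inner[symmetric])
  also have "\<dots> = gaussian x * f x + f x * (of_real (x \<bullet> x) * ?E x)"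
    by (simp add: mult_ac)
  also have "\<dots> = f x"
    unfolding g_eq by (simp add: algebra_simps)
  finally show "f x = (\<Sum>e\<in>Basis. of_real (e \<bullet> x) * ?F e x)" ..
qed

text \<open>The algebraic form of the statement that a functional \<open>L\<close> with \<open>(x - p)\<^sub>e L = 0\<close> for all \<open>e\<close> is a multiple
  of \<open>\<delta>\<^sub>p\<close>. It holds for all additive functionals, since Hadamard's lemma writes \<open>f\<close> as a finite sum of
  functions on which \<open>L\<close> vanishes.\<close>

lemma functional_killing_coordinates_vanishes:
  fixes L :: "('a::euclidean_space \<Rightarrow> complex) \<Rightarrow> complex"
  assumes add: "\<And>f g. schwartz f \<Longrightarrow> schwartz g \<Longrightarrow> L (\<lambda>x. f x + g x) = L f + L g"
    and kill: "\<And>e f. e \<in> Basis \<Longrightarrow> schwartz f \<Longrightarrow> L (\<lambda>x. of_real (e \<bullet> (x - p)) * f x) = 0"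
    and f: "schwartz f" "f p = 0"
  shows "L f = 0"
proof -
  have "schwartz (\<lambda>x. f (p + x))"
    using schwartz_translate[OF f(1), of "- p"] by (simp add: add.commute)
  then obtain F where F: "\<And>e. e \<in> Basis \<Longrightarrow> schwartz (F e)"
    and f_eq: "\<And>x. f (p + x) = (\<Sum>e\<in>Basis. of_real (e \<bullet> x) * F e x)"
    using schwartz_hadamard[of "\<lambda>x. f (p + x)"] f(2) by auto
  define G where "G e x = F e (x - p)" for e x
  have G: "schwartz (G e)" if "e \<in> Basis" for e
    unfolding G_def[abs_def] by (rule schwartz_translate[OF F[OF that]])
  have f_eq': "f = (\<lambda>x. \<Sum>e\<in>Basis. of_real (e \<bullet> (x - p)) * G e x)"
    using f_eq[of "_ - p"] by (simp add: G_def fun_eq_iff)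
  have L0: "L (\<lambda>x. 0) = 0"
    using add[OF schwartz_zero schwartz_zero] by simp
  have sG: "schwartz (\<lambda>x. of_real (e \<bullet> (x - p)) * G e x)" if "e \<in> Basis" for e
    using schwartz_moderate_mult[OF moderate_affine[of e "- of_real (e \<bullet> p)"] G[OF that]]
    by (simp add: inner_diff_right)
  have "L (\<lambda>x. \<Sum>e\<in>B. of_real (e \<bullet> (x - p)) * G e x) = 0" if "B \<subseteq> Basis" for B
    using finite_subset[OF that finite_Basis] that
  proof induction
    case empty
    then show ?case by (simp add: L0)
  next
    case (insert e B)
    then show ?case
      using add[OF sG schwartz_sum[of B "\<lambda>e x. of_real (e \<bullet> (x - p)) * G e x"], of e] sG kill G
      by (simp add: subset_iff)
  qed
  then show ?thesis
    using f_eq' by auto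
qed


section \<open>The partial Fourier transform of Schwartz functions\<close>

lemma integrable_inverse_1_plus_square: "integrable lborel (\<lambda>x::real. inverse (1 + x\<^sup>2))"
  using integrable_inverse_1_plus_square by (simp add: set_integrable_def einterval_def)

text \<open>Bounded by the product of the functions \<open>1 / (1 + t\<^sub>b\<^sup>2)\<close> of one variable, as each factor
  \<open>(1 + norm t)\<^sup>2\<close> is at least \<open>1 + t\<^sub>b\<^sup>2\<close>.\<close>

lemma integrable_inverse_power_norm:
  "integrable lborel (\<lambda>t::'a::euclidean_space. 1 / (1 + norm t) ^ (2 * DIM('a)))"
proof -
  let ?f = "\<lambda>t::'a. \<Prod>b\<in>Basis. inverse (1 + (t \<bullet> b)\<^sup>2)"
  have "integrable lborel ?f"
  proof (rule integrableI_nonneg)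
    have "(\<integral>\<^sup>+ t. ennreal (?f t) \<partial>lborel) = (\<integral>\<^sup>+ t. (\<Prod>b\<in>Basis. ennreal (inverse (1 + ((t::'a) \<bullet> b)\<^sup>2))) \<partial>lborel)"
      by (simp add: prod_ennreal)
    also have "\<dots> = (\<Prod>b\<in>(Basis::'a set). \<integral>\<^sup>+ x. ennreal (inverse (1 + x\<^sup>2)) \<partial>lborel)"
      by (rule nn_integral_lborel_prod) auto
    also have "\<dots> < \<infinity>"
      using integrable_inverse_1_plus_square
      by (auto simp: integrable_iff_bounded intro!: power_less_top_ennreal[THEN iffD2])
    finally show "(\<integral>\<^sup>+ t. ennreal (?f t) \<partial>lborel) < \<infinity>" .
  qed (auto intro!: AE_I2 prod_nonneg)
  then show ?thesis
  proof (rule Bochner_Integration.integrable_bound)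
    have "1 / (1 + norm t) ^ (2 * DIM('a)) \<le> ?f t" for t :: 'a
    proof -
      have "1 / (1 + norm t) ^ (2 * DIM('a)) = (\<Prod>b\<in>(Basis::'a set). inverse ((1 + norm t)\<^sup>2))"
        by (simp add: power_mult[symmetric] inverse_eq_divide power_divide)
      also have "\<dots> \<le> ?f t"
      proof (rule prod_mono)
        fix b :: 'a assume "b \<in> Basis"
        then have "(t \<bullet> b)\<^sup>2 \<le> (norm t)\<^sup>2"
          using Basis_le_norm[of b t] by (intro abs_le_square_iff[THEN iffD1]) simp
        then have "1 + (t \<bullet> b)\<^sup>2 \<le> (1 + norm t)\<^sup>2"
          by (simp add: power2_sum add_increasing2)
        moreover have "1 + (t \<bullet> b)\<^sup>2 > 0"
          by (simp add: add_pos_nonneg)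
        ultimately show "0 \<le> inverse ((1 + norm t)\<^sup>2) \<and> inverse ((1 + norm t)\<^sup>2) \<le> inverse (1 + (t \<bullet> b)\<^sup>2)"
          by (auto intro: le_imp_inverse_le)
      qed
      finally show ?thesis .
    qed
    then show "AE t in lborel. norm (1 / (1 + norm t) ^ (2 * DIM('a))) \<le> norm (?f t)"
      by (intro AE_I2) (smt (verit) norm_ge_zero real_norm_def zero_le_divide_1_iff zero_le_power)
  qed measurable
qed

lemma le_inverse_power_norm:
  assumes "(1 + norm t) ^ k * a \<le> (C::real)"
  shows "a \<le> C * (1 / (1 + norm t) ^ k)"
proof -
  have "(1 + norm t) ^ k > 0"
    by (intro zero_less_power) (simp add: add_pos_nonneg)
  then show ?thesis
    using assms by (simp add: pos_le_divide_eq mult.commute)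
qed

lemma schwartz_integrable:
  fixes f :: "'a::euclidean_space \<Rightarrow> complex"
  assumes f: "schwartz f"
  shows "integrable lborel f"
proof -
  obtain C where C: "\<And>x. (1 + norm x) ^ (2 * DIM('a)) * cmod (f x) \<le> C"
    using schwartz_rapidly_decaying[OF f] unfolding rapidly_decaying_def by blast
  have "integrable lborel (\<lambda>x::'a. C * (1 / (1 + norm x) ^ (2 * DIM('a))))"
    by (rule integrable_mult_right[OF integrable_inverse_power_norm])
  then show ?thesis
  proof (rule Bochner_Integration.integrable_bound)
    show "f \<in> borel_measurable lborel"
      using borel_measurable_continuous_onI[OF schwartz_continuous_on[OF f]] by simp
    have "cmod (f x) \<le> C * (1 / (1 + norm x) ^ (2 * DIM('a)))" for x
      by (rule le_inverse_power_norm[OF C])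
    then show "AE x in lborel. norm (f x) \<le> norm (C * (1 / (1 + norm x) ^ (2 * DIM('a))))"
      by (intro AE_I2) (metis abs_ge_self order_trans real_norm_def)
  qed
qed

lemma schwartz_cis_mult:
  assumes "schwartz f"
  shows "schwartz (\<lambda>t. f t * cis (- 2 * pi * (\<omega> \<bullet> t)))"
  using schwartz_moderate_mult[OF moderate_cis[of "(- 2 * pi) *\<^sub>R \<omega>"] assms] by (simp add: mult.commute)

lemma partial_fourier_eq:
  "partial_fourier F z = (\<integral>t. F (fst z, t) * cis (- 2 * pi * (snd z \<bullet> t)) \<partial>lborel)"
  by (simp add: partial_fourier_def fourier_def split_beta)

lemma partial_fourier_integrable:
  "schwartz F \<Longrightarrow> integrable lborel (\<lambda>t. F (x, t) * cis (- 2 * pi * (\<omega> \<bullet> t)))"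
  by (intro schwartz_integrable schwartz_cis_mult schwartz_slice)

lemma partial_fourier_add:
  "schwartz F \<Longrightarrow> schwartz G \<Longrightarrow>
    partial_fourier (\<lambda>z. F z + G z) w = partial_fourier F w + partial_fourier G w"
  unfolding partial_fourier_eq
  by (subst Bochner_Integration.integral_add[symmetric])
    (assumption | rule partial_fourier_integrable | simp only: distrib_right)+

lemma partial_fourier_cmult: "partial_fourier (\<lambda>z. c * F z) w = c * partial_fourier F w"
  by (simp add: partial_fourier_eq mult.assoc)

lemma has_derivative_cis_inner:
  "((\<lambda>z. cis (- 2 * pi * (snd z \<bullet> t))) has_derivative
    (\<lambda>v. of_real (- 2 * pi * (snd v \<bullet> t)) * \<i> * cis (- 2 * pi * (snd z \<bullet> t)))) (at z)"
proof -
  have "((\<lambda>z. - 2 * pi * (snd z \<bullet> t)) has_derivative (\<lambda>v. - 2 * pi * (snd v \<bullet> t))) (at z)"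
    by (auto intro!: derivative_eq_intros)
  from has_derivative_cis[OF this] show ?thesis
    by (simp add: scaleR_conv_of_real mult.assoc)
qed

lemma schwartz_fourier_integrand:
  assumes "schwartz F"
  shows "schwartz (\<lambda>z. dir_deriv (a, 0) F z + of_real (- 2 * pi * (b \<bullet> snd z)) * \<i> * F z)"
proof (intro schwartz_add schwartz_dir_deriv assms)
  have "schwartz (\<lambda>z. (- 2 * pi * \<i>) * (of_real ((0, b) \<bullet> z) * F z))"
    by (intro schwartz_cmult schwartz_inner_mult assms)
  then show "schwartz (\<lambda>z. of_real (- 2 * pi * (b \<bullet> snd z)) * \<i> * F z)"
    by (simp add: inner_prod_def mult_ac)
qed

lemma has_derivative_partial_fourier:
  fixes F :: "'a::euclidean_space \<times> 'b::euclidean_space \<Rightarrow> complex"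
  assumes F: "schwartz F"
  shows "(partial_fourier F has_derivative (\<lambda>v. partial_fourier
     (\<lambda>z. dir_deriv (fst v, 0) F z + of_real (- 2 * pi * (snd v \<bullet> snd z)) * \<i> * F z) w)) (at w)"
proof -
  let ?F = "\<lambda>v z. dir_deriv (fst v, 0) F z + of_real (- 2 * pi * (snd v \<bullet> snd z)) * \<i> * F z"
  have sF: "schwartz (?F v)" for v
    by (rule schwartz_fourier_integrand[OF F])
  have "linear (\<lambda>v. ?F v z)" for z
  proof (rule linearI)
    have "dir_deriv (fst (u + v), 0) F z = dir_deriv (fst u, 0) F z + dir_deriv (fst v, 0) F z" for u v :: "'a \<times> 'b"
      using linear_add[OF linear_dir_deriv[OF F], of "(fst u, 0)" "(fst v, 0)"] by simp
    then show "?F (u + v) z = ?F u z + ?F v z" for u v :: "'a \<times> 'b"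
      by (simp add: inner_add_left algebra_simps)
    have "dir_deriv (fst (r *\<^sub>R v), 0) F z = r *\<^sub>R dir_deriv (fst v, 0) F z" for r and v :: "'a \<times> 'b"
      using linear_scale[OF linear_dir_deriv[OF F], of r "(fst v, 0)"] by simp
    then show "?F (r *\<^sub>R v) z = r *\<^sub>R ?F v z" for r and v :: "'a \<times> 'b"
      by (simp add: scaleR_conv_of_real algebra_simps)
  qed
  from schwartz_linear_family_bound[OF sF this]
  obtain C where C: "\<And>v z. (1 + norm z) ^ (2 * DIM('b)) * cmod (?F v z) \<le> C * norm v"
    by blast
  show ?thesis
    unfolding partial_fourier_eq
  proof (rule has_derivative_integral_dominated[where g = "\<lambda>t. C * (1 / (1 + norm t) ^ (2 * DIM('b)))"])
    fix t :: 'b and y v :: "'a \<times> 'b"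
    have "((\<lambda>y::'a \<times> 'b. (fst y, t)) has_derivative (\<lambda>v. (fst v, 0))) (at y)"
      by (intro derivative_intros)
    from has_derivative_compose[OF this schwartz_has_derivative[OF F]]
    have "((\<lambda>y. F (fst y, t)) has_derivative (\<lambda>v. dir_deriv (fst v, 0) F (fst y, t))) (at y)" .
    from has_derivative_mult[OF this has_derivative_cis_inner]
    show "((\<lambda>y. F (fst y, t) * cis (- 2 * pi * (snd y \<bullet> t))) has_derivative
        (\<lambda>v. ?F v (fst y, t) * cis (- 2 * pi * (snd y \<bullet> t)))) (at y)"
      by (rule has_derivative_eq_rhs) (simp add: fun_eq_iff algebra_simps)
    show "cmod (?F v (fst y, t) * cis (- 2 * pi * (snd y \<bullet> t)))
        \<le> C * (1 / (1 + norm t) ^ (2 * DIM('b))) * norm v"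
    proof -
      have "(1 + norm t) ^ (2 * DIM('b)) * cmod (?F v (fst y, t)) \<le> C * norm v"
        by (rule order_trans[OF mult_right_mono C], rule power_mono) (auto intro: norm_snd_le)
      from le_inverse_power_norm[OF this] show ?thesis
        by (simp only: norm_mult norm_cis mult_1_right) (simp add: mult_ac)
    qed
  next
    show "integrable lborel (\<lambda>t::'b. C * (1 / (1 + norm t) ^ (2 * DIM('b))))"
      by (rule integrable_mult_right[OF integrable_inverse_power_norm])
  qed (intro partial_fourier_integrable F sF)+
qed

lemma partial_fourier_dir_deriv_fst:
  assumes "schwartz F"
  shows "partial_fourier (dir_deriv (a, 0) F) w = dir_deriv (a, 0) (partial_fourier F) w"
  by (simp add: dir_deriv_eqI[OF has_derivative_partial_fourier[OF assms]])

lemma dir_deriv_partial_fourier_snd: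
  assumes "schwartz F"
  shows "dir_deriv (0, b) (partial_fourier F) w
    = - 2 * pi * \<i> * partial_fourier (\<lambda>z. of_real (b \<bullet> snd z) * F z) w"
proof -
  have "dir_deriv 0 F z = 0" for z
    using linear_0[OF linear_dir_deriv[OF assms]] .
  then have "dir_deriv (0, b) (partial_fourier F) w
      = partial_fourier (\<lambda>z. (- 2 * pi * \<i>) * (of_real (b \<bullet> snd z) * F z)) w"
    by (simp add: dir_deriv_eqI[OF has_derivative_partial_fourier[OF assms]] zero_prod_def[symmetric] mult_ac)
  then show ?thesis
    by (simp only: partial_fourier_cmult)
qed

lemma integral_translate:
  fixes f :: "'a::euclidean_space \<Rightarrow> complex"
  assumes "f \<in> borel_measurable borel"
  shows "(\<integral>t. f (t + c) \<partial>lborel) = (\<integral>t. f t \<partial>lborel)"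
proof -
  have "(\<integral>t. f t \<partial>lborel) = (\<integral>t. f t \<partial>distr lborel borel ((+) c))"
    by (simp add: lborel_distr_plus)
  also have "\<dots> = (\<integral>t. f (c + t) \<partial>lborel)"
    using assms by (intro integral_distr) auto
  finally show ?thesis
    by (simp add: add.commute)
qed

text \<open>The integral of \<open>f (t + sin s v)\<close> does not depend on \<open>s\<close>; differentiate at \<open>s = 0\<close>. The bounded
  function \<open>sin\<close> with derivative \<open>1\<close> at \<open>0\<close> makes the domination uniform in \<open>s\<close>.\<close>

lemma integral_dir_deriv_eq_0:
  fixes f :: "'a::euclidean_space \<Rightarrow> complex"
  assumes f: "schwartz f"
  shows "(\<integral>t. dir_deriv v f t \<partial>lborel) = 0"
proof -
  let ?n = "2 * DIM('a)"
  obtain C where C: "\<And>v x. (1 + norm x) ^ ?n * cmod (dir_deriv v f x) \<le> C * norm v"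
    using schwartz_dir_deriv_bound[OF f f, of ?n] by blast
  have lin: "linear (\<lambda>v. dir_deriv v f x)" for x
    by (rule linear_dir_deriv[OF f])
  let ?g = "\<lambda>t::'a. (C * norm v * (1 + norm v) ^ ?n) * (1 / (1 + norm t) ^ ?n)"
  have "((\<lambda>s. \<integral>t. f (t + sin s *\<^sub>R v) \<partial>lborel) has_derivative
      (\<lambda>h. \<integral>t. of_real (h * cos 0) * dir_deriv v f (t + sin 0 *\<^sub>R v) \<partial>lborel)) (at 0)"
  proof (rule has_derivative_integral_dominated[where g = ?g])
    fix s h :: real and t :: 'a
    have "((\<lambda>s. t + sin s *\<^sub>R v) has_derivative (\<lambda>h. (h * cos s) *\<^sub>R v)) (at s)"
      by (auto intro!: derivative_eq_intros simp: mult.commute)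
    from has_derivative_compose[OF this schwartz_has_derivative[OF f]]
    show "((\<lambda>s. f (t + sin s *\<^sub>R v)) has_derivative
        (\<lambda>h. of_real (h * cos s) * dir_deriv v f (t + sin s *\<^sub>R v))) (at s)"
      by (simp add: linear_scale[OF lin] scaleR_conv_of_real)
    let ?y = "t + sin s *\<^sub>R v"
    have sv: "norm (sin s *\<^sub>R v) \<le> norm v"
      by (simp add: mult_left_le_one_le)
    have "norm t \<le> norm ?y + norm v"
      using norm_triangle_ineq4[of ?y "sin s *\<^sub>R v"] sv by simp
    moreover have "(1 + norm ?y) * (1 + norm v) = 1 + norm v + norm ?y + norm v * norm ?y"
      by (simp add: algebra_simps)
    moreover have "0 \<le> norm v * norm ?y"
      by simp
    ultimately have "1 + norm t \<le> (1 + norm ?y) * (1 + norm v)"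
      by linarith
    then have "(1 + norm t) ^ ?n \<le> (1 + norm ?y) ^ ?n * (1 + norm v) ^ ?n"
      unfolding power_mult_distrib[symmetric] by (intro power_mono) auto
    then have "(1 + norm t) ^ ?n * cmod (dir_deriv v f ?y)
        \<le> (1 + norm v) ^ ?n * ((1 + norm ?y) ^ ?n * cmod (dir_deriv v f ?y))"
      using mult_right_mono[of _ _ "cmod (dir_deriv v f ?y)"] by (fastforce simp: mult_ac)
    also have "\<dots> \<le> (1 + norm v) ^ ?n * (C * norm v)"
      by (intro mult_left_mono C) auto
    finally have "cmod (dir_deriv v f ?y) \<le> ?g t"
      by (intro le_inverse_power_norm) (simp only: mult_ac)
    moreover have "\<bar>h * cos s\<bar> \<le> \<bar>h\<bar>"
      by (simp add: abs_mult mult_left_le)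
    ultimately show "cmod (of_real (h * cos s) * dir_deriv v f ?y) \<le> ?g t * norm h"
      by (simp only: norm_mult norm_of_real mult.commute[of "?g t"] real_norm_def)
        (intro mult_mono; simp)
  next
    have "schwartz (\<lambda>t. g (t + y))" if "schwartz g" for g :: "'a \<Rightarrow> complex" and y
      using schwartz_translate[OF that, of "- y"] by simp
    then show "integrable lborel (\<lambda>t. f (t + sin s *\<^sub>R v))"
      "integrable lborel (\<lambda>t. of_real (h * cos s) * dir_deriv v f (t + sin s *\<^sub>R v))" for s h
      by (intro schwartz_integrable schwartz_cmult; use f schwartz_dir_deriv in blast)+
    show "integrable lborel ?g"
      by (rule integrable_mult_right[OF integrable_inverse_power_norm])
  qed
  moreover have "(\<lambda>s. \<integral>t. f (t + sin s *\<^sub>R v) \<partial>lborel) = (\<lambda>s. \<integral>t. f t \<partial>lborel)"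
    using borel_measurable_continuous_onI[OF schwartz_continuous_on[OF f]]
    by (intro ext integral_translate) auto
  ultimately have "((\<lambda>s::real. \<integral>t. f t \<partial>lborel) has_derivative
      (\<lambda>h. of_real h * (\<integral>t. dir_deriv v f t \<partial>lborel))) (at 0)"
    by simp
  then have "(\<lambda>h::real. of_real h * (\<integral>t. dir_deriv v f t \<partial>lborel)) = (\<lambda>h. 0)"
    using has_derivative_unique has_derivative_const by blast
  from fun_cong[OF this, of 1] show ?thesis by simp
qed

lemma dir_deriv_slice:
  assumes "F differentiable (at (x, t))"
  shows "((\<lambda>t. F (x, t)) has_derivative (\<lambda>b. dir_deriv (0, b) F (x, t))) (at t)"
    "dir_deriv b (\<lambda>t. F (x, t)) t = dir_deriv (0, b) F (x, t)"
proof -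
  have "((\<lambda>t. (x, t)) has_derivative (\<lambda>v. (0, v))) (at t)"
    by (intro derivative_intros)
  from has_derivative_compose[OF this has_derivative_dir_deriv[OF assms]]
  show "((\<lambda>t. F (x, t)) has_derivative (\<lambda>b. dir_deriv (0, b) F (x, t))) (at t)" .
  then show "dir_deriv b (\<lambda>t. F (x, t)) t = dir_deriv (0, b) F (x, t)"
    by (rule dir_deriv_eqI)
qed

text \<open>Integration by parts: the integral of the derivative of \<open>F (x, t) exp (- 2 \<pi> \<i> \<omega> t)\<close> in direction \<open>b\<close> is zero.\<close>

lemma partial_fourier_dir_deriv_snd:
  fixes F :: "'a::euclidean_space \<times> 'b::euclidean_space \<Rightarrow> complex"
  assumes F: "schwartz F"
  shows "partial_fourier (dir_deriv (0, b) F) w = 2 * pi * \<i> * of_real (b \<bullet> snd w) * partial_fourier F w"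
proof -
  obtain x \<omega> where w: "w = (x, \<omega>)" by force
  let ?e = "\<lambda>t. cis (- 2 * pi * (\<omega> \<bullet> t))"
  have "((\<lambda>t. F (x, t) * ?e t) has_derivative (\<lambda>b. F (x, t) * ((- 2 * pi * (\<omega> \<bullet> b)) *\<^sub>R (\<i> * ?e t))
      + dir_deriv (0, b) F (x, t) * ?e t)) (at t)" for t
    by (intro has_derivative_mult dir_deriv_slice(1) schwartz_differentiable F has_derivative_cis derivative_intros)
  from dir_deriv_eqI[OF this]
  have "dir_deriv b (\<lambda>t. F (x, t) * ?e t) = (\<lambda>t. (- (2 * pi * \<i> * of_real (\<omega> \<bullet> b))) * (F (x, t) * ?e t)
      + dir_deriv (0, b) F (x, t) * ?e t)"
    by (simp add: fun_eq_iff scaleR_conv_of_real)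
  moreover have "(\<integral>t. dir_deriv b (\<lambda>t. F (x, t) * ?e t) t \<partial>lborel) = 0"
    by (intro integral_dir_deriv_eq_0 schwartz_cis_mult schwartz_slice F)
  ultimately have "0 = (\<integral>t. (- (2 * pi * \<i> * of_real (\<omega> \<bullet> b))) * (F (x, t) * ?e t)
      + dir_deriv (0, b) F (x, t) * ?e t \<partial>lborel)"
    by simp
  also have "\<dots> = (\<integral>t. (- (2 * pi * \<i> * of_real (\<omega> \<bullet> b))) * (F (x, t) * ?e t) \<partial>lborel)
      + (\<integral>t. dir_deriv (0, b) F (x, t) * ?e t \<partial>lborel)"
    by (intro Bochner_Integration.integral_add integrable_mult_right partial_fourier_integrable
        F schwartz_dir_deriv)
  finally show ?thesis
    by (simp add: w partial_fourier_eq inner_commute)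
qed

lemma partial_fourier_inner_mult:
  fixes F :: "'a::euclidean_space \<times> 'b::euclidean_space \<Rightarrow> complex"
  assumes F: "schwartz F"
  shows "partial_fourier (\<lambda>z. of_real ((a, b) \<bullet> z) * F z) w
    = of_real (a \<bullet> fst w) * partial_fourier F w + \<i> / (2 * pi) * dir_deriv (0, b) (partial_fourier F) w"
proof -
  have "partial_fourier (\<lambda>z. of_real ((a, b) \<bullet> z) * F z) w
      = partial_fourier (\<lambda>z. of_real ((a, 0) \<bullet> z) * F z + of_real ((0, b) \<bullet> z) * F z) w"
    by (simp add: inner_prod_def distrib_right)
  also have "\<dots> = partial_fourier (\<lambda>z. of_real ((a, 0) \<bullet> z) * F z) w
      + partial_fourier (\<lambda>z. of_real ((0, b) \<bullet> z) * F z) w"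
    by (intro partial_fourier_add schwartz_inner_mult F)
  also have "partial_fourier (\<lambda>z. of_real ((a, 0) \<bullet> z) * F z) w = of_real (a \<bullet> fst w) * partial_fourier F w"
    by (simp add: partial_fourier_eq inner_prod_def mult.assoc)
  also have "partial_fourier (\<lambda>z. of_real ((0, b) \<bullet> z) * F z) w
      = \<i> / (2 * pi) * dir_deriv (0, b) (partial_fourier F) w"
    by (simp add: dir_deriv_partial_fourier_snd[OF F] inner_prod_def field_simps)
  finally show ?thesis .
qed

lemma dir_deriv_add_direction:
  assumes "f differentiable (at x)"
  shows "dir_deriv (u + v) f x = dir_deriv u f x + dir_deriv v f x"
  using linear_add[OF has_derivative_linear[OF has_derivative_dir_deriv[OF assms]]] .

lemma partial_fourier_dir_deriv:
  fixes F :: "'a::euclidean_space \<times> 'b::euclidean_space \<Rightarrow> complex"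
  assumes F: "schwartz F"
  shows "partial_fourier (dir_deriv (a, b) F) w
    = dir_deriv (a, 0) (partial_fourier F) w + 2 * pi * \<i> * of_real (b \<bullet> snd w) * partial_fourier F w"
proof -
  have "dir_deriv (a, b) F = (\<lambda>z. dir_deriv (a, 0) F z + dir_deriv (0, b) F z)"
    using dir_deriv_add_direction[OF schwartz_differentiable[OF F], of "(a, 0)" "(0, b)"]
    by (simp add: fun_eq_iff)
  then show ?thesis
    by (simp add: partial_fourier_add schwartz_dir_deriv F partial_fourier_dir_deriv_fst
        partial_fourier_dir_deriv_snd)
qed

lemma schwartz_partial_fourier:
  fixes F :: "'a::euclidean_space \<times> 'b::euclidean_space \<Rightarrow> complex"
  assumes F: "schwartz F"
  shows "schwartz (partial_fourier F)"
proof (rule schwartz_coinduct[where X = "{partial_fourier F | F. schwartz F}"])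
  fix h :: "'a \<times> 'b \<Rightarrow> complex" assume "h \<in> {partial_fourier F | F. schwartz F}"
  then obtain F where h: "h = partial_fourier F" and F: "schwartz F" by blast
  show "h differentiable (at w)" for w
    using has_derivative_partial_fourier[OF F] unfolding h differentiable_def by blast
  show "\<exists>C. \<forall>w. cmod (h w) \<le> C"
  proof -
    obtain C where C: "\<And>z. (1 + norm z) ^ (2 * DIM('b)) * cmod (F z) \<le> C"
      using schwartz_rapidly_decaying[OF F] unfolding rapidly_decaying_def by blast
    let ?I = "\<integral>t. C * (1 / (1 + norm (t::'b)) ^ (2 * DIM('b))) \<partial>lborel"
    have "cmod (h w) \<le> ?I" for w
      unfolding h partial_fourier_eq
    proof (rule order_trans[OF integral_norm_bound integral_mono])
      show "integrable lborel (\<lambda>t. cmod (F (fst w, t) * cis (- 2 * pi * (snd w \<bullet> t))))"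
        by (intro integrable_norm partial_fourier_integrable F)
      show "integrable lborel (\<lambda>t::'b. C * (1 / (1 + norm t) ^ (2 * DIM('b))))"
        by (rule integrable_mult_right[OF integrable_inverse_power_norm])
      fix t
      have "(1 + norm t) ^ (2 * DIM('b)) * cmod (F (fst w, t)) \<le> C"
        by (rule order_trans[OF mult_right_mono C], rule power_mono) (auto intro: norm_snd_le)
      from le_inverse_power_norm[OF this]
      show "cmod (F (fst w, t) * cis (- 2 * pi * (snd w \<bullet> t))) \<le> C * (1 / (1 + norm t) ^ (2 * DIM('b)))"
        by (simp only: norm_mult norm_cis mult_1_right)
    qed
    then show ?thesis by blast
  qed
  fix v :: "'a \<times> 'b"
  obtain a b where v: "v = (a, b)" by force
  let ?D = "\<lambda>z. dir_deriv (a, 0) F z + of_real (- 2 * pi * (b \<bullet> snd z)) * \<i> * F z"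
  have "dir_deriv v h = partial_fourier ?D"
    unfolding h v by (intro ext) (simp add: dir_deriv_eqI[OF has_derivative_partial_fourier[OF F]])
  moreover have "schwartz ?D"
    by (rule schwartz_fourier_integrand[OF F])
  ultimately show "dir_deriv v h \<in> {partial_fourier F | F. schwartz F}"
    by blast
  \<comment> \<open>The coordinate \<open>(a, b)\<close> of the transform is the transform of the coordinate in \<open>x\<close>
    plus a derivative in \<open>t\<close>.\<close>
  let ?M = "\<lambda>z. of_real ((a, 0) \<bullet> z) * F z + (1 / (2 * pi * \<i>)) * dir_deriv (0, b) F z"
  have M: "schwartz ?M" "schwartz (\<lambda>z. of_real ((a, 0) \<bullet> z) * F z)"
    "schwartz (\<lambda>z. (1 / (2 * pi * \<i>)) * dir_deriv (0, b) F z)"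
    by (intro schwartz_add schwartz_cmult schwartz_inner_mult schwartz_dir_deriv F)+
  have "partial_fourier ?M w = of_real (v \<bullet> w) * h w" for w
  proof -
    have "dir_deriv (0, 0) (partial_fourier F) w = 0"
      using linear_0[OF has_derivative_linear[OF has_derivative_partial_fourier[OF F]], of w]
      by (simp add: dir_deriv_eqI[OF has_derivative_partial_fourier[OF F]] zero_prod_def)
    then have "partial_fourier ?M w = of_real (a \<bullet> fst w) * h w
        + 1 / (2 * pi * \<i>) * (2 * pi * \<i> * of_real (b \<bullet> snd w) * h w)"
      unfolding partial_fourier_add[OF M(2,3)] partial_fourier_cmult
        partial_fourier_dir_deriv_snd[OF F] partial_fourier_inner_mult[OF F] h by simp
    then show ?thesis
      by (simp add: v inner_prod_def distrib_right)
  qed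
  then have "(\<lambda>w. of_real (v \<bullet> w) * h w) = partial_fourier ?M"
    by auto
  then show "(\<lambda>w. of_real (v \<bullet> w) * h w) \<in> {partial_fourier F | F. schwartz F}"
    using M(1) by blast
qed (use F in blast)


section \<open>Fourier inversion\<close>

text \<open>The algebra of the Fourier transform: it maps the Schwartz space to itself and exchanges derivatives
  with coordinates. Up to constants, Fourier inversion follows from these rules alone.\<close>

definition fourier_like :: "(('a::euclidean_space \<Rightarrow> complex) \<Rightarrow> 'a \<Rightarrow> complex) \<Rightarrow> bool" where
  "fourier_like Q \<longleftrightarrow>
     (\<forall>f. schwartz f \<longrightarrow> schwartz (Q f)) \<and>
     (\<forall>f g x. schwartz f \<longrightarrow> schwartz g \<longrightarrow> Q (\<lambda>x. f x + g x) x = Q f x + Q g x) \<and>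
     (\<forall>c f x. schwartz f \<longrightarrow> Q (\<lambda>x. c * f x) x = c * Q f x) \<and>
     (\<forall>v f x. schwartz f \<longrightarrow> Q (\<lambda>x. of_real (v \<bullet> x) * f x) x = \<i> / (2 * pi) * dir_deriv v (Q f) x) \<and>
     (\<forall>v f x. schwartz f \<longrightarrow> Q (dir_deriv v f) x = 2 * pi * \<i> * of_real (v \<bullet> x) * Q f x)"

lemma fourier_likeD:
  assumes "fourier_like Q" "schwartz f"
  shows "schwartz (Q f)"
    and "schwartz g \<Longrightarrow> Q (\<lambda>x. f x + g x) x = Q f x + Q g x"
    and "Q (\<lambda>x. c * f x) x = c * Q f x"
    and "Q (\<lambda>x. of_real (v \<bullet> x) * f x) x = \<i> / (2 * pi) * dir_deriv v (Q f) x"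
    and "Q (dir_deriv v f) x = 2 * pi * \<i> * of_real (v \<bullet> x) * Q f x"
  using assms unfolding fourier_like_def by blast+

lemma schwartz_linear_compose:
  "schwartz f \<Longrightarrow> linear N \<Longrightarrow> inj N \<Longrightarrow> schwartz (\<lambda>x. f (N x))"
  using schwartz_affine_compose[of f N 0] by simp

lemma dir_deriv_linear_compose:
  fixes N :: "'a::euclidean_space \<Rightarrow> 'b::euclidean_space"
  assumes "f differentiable (at (N x))" "linear N"
  shows "dir_deriv v (\<lambda>x. f (N x)) x = dir_deriv (N v) f (N x)"
proof -
  have "(N has_derivative N) (at x)"
    using assms(2) by (simp add: linear_conv_bounded_linear bounded_linear_imp_has_derivative)
  from has_derivative_compose[OF this has_derivative_dir_deriv[OF assms(1)]]
  show ?thesis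
    by (rule dir_deriv_eqI)
qed

text \<open>For \<open>N = id\<close> this is Fourier inversion up to constants: \<open>Q (Q f) y\<close> depends only on \<open>f (- y)\<close>. In general
  let \<open>e = N b\<close>. Then \<open>Q\<close> turns the coordinate \<open>e\<close> into the derivative of \<open>Q f\<close> in direction \<open>N b\<close>, which is
  the derivative of \<open>Q f \<circ> N\<close> in direction \<open>b\<close>; the second \<open>Q\<close> turns the latter into multiplication by
  \<open>b \<bullet> y\<close>. The constants multiply to \<open>- 1\<close>, and \<open>- b \<bullet> y = e \<bullet> p\<close>. So \<open>f \<mapsto> Q (Q f \<circ> N) y\<close> annihilates \<open>(e \<bullet> (x - p)) f\<close>, and Hadamard's lemma applies.\<close>

lemma fourier_like_inversion:
  fixes N :: "'a::euclidean_space \<Rightarrow> 'a" and f :: "'a \<Rightarrow> complex"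
  assumes Q: "fourier_like Q" and N: "linear N" "inj N"
    and p: "\<And>z. p \<bullet> N z = - (y \<bullet> z)"
    and f: "schwartz f" "f p = 0"
  shows "Q (\<lambda>z. Q f (N z)) y = 0"
proof (rule functional_killing_coordinates_vanishes[where L = "\<lambda>f. Q (\<lambda>z. Q f (N z)) y", OF _ _ f])
  have comp: "schwartz (\<lambda>z. Q f (N z))" if "schwartz f" for f :: "'a \<Rightarrow> complex"
    by (rule schwartz_linear_compose[OF fourier_likeD(1)[OF Q that] N])
  show add: "Q (\<lambda>z. Q (\<lambda>x. f x + g x) (N z)) y = Q (\<lambda>z. Q f (N z)) y + Q (\<lambda>z. Q g (N z)) y"
    if "schwartz f" "schwartz g" for f g :: "'a \<Rightarrow> complex"
    using that by (simp add: fourier_likeD(2)[OF Q] comp)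
  fix e :: 'a and f :: "'a \<Rightarrow> complex" assume "schwartz f"
  obtain b where b: "N b = e"
    using linear_injective_imp_surjective[OF N] by (metis surjD)
  have d: "Q f differentiable (at x)" for x
    by (rule schwartz_differentiable[OF fourier_likeD(1)[OF Q \<open>schwartz f\<close>]])
  have "Q (\<lambda>z. Q (\<lambda>x. of_real (e \<bullet> x) * f x) (N z)) y
      = Q (\<lambda>z. \<i> / (2 * pi) * dir_deriv b (\<lambda>z. Q f (N z)) z) y"
    by (simp only: fourier_likeD(4)[OF Q \<open>schwartz f\<close>] dir_deriv_linear_compose[OF d N(1)] b)
  also have "\<dots> = \<i> / (2 * pi) * (2 * pi * \<i> * of_real (b \<bullet> y) * Q (\<lambda>z. Q f (N z)) y)"
    by (simp only: fourier_likeD(3)[OF Q schwartz_dir_deriv[OF comp[OF \<open>schwartz f\<close>]]]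
        fourier_likeD(5)[OF Q comp[OF \<open>schwartz f\<close>]])
  also have "\<dots> = - of_real (b \<bullet> y) * Q (\<lambda>z. Q f (N z)) y"
    by simp
  finally have 1: "Q (\<lambda>z. Q (\<lambda>x. of_real (e \<bullet> x) * f x) (N z)) y = - of_real (b \<bullet> y) * Q (\<lambda>z. Q f (N z)) y" .
  have "e \<bullet> p = - (b \<bullet> y)"
    using p[of b] b by (simp add: inner_commute)
  then have "(\<lambda>x. of_real (e \<bullet> (x - p)) * f x)
      = (\<lambda>x. of_real (e \<bullet> x) * f x + of_real (b \<bullet> y) * f x)"
    by (simp add: inner_diff_right distrib_right)
  then have "Q (\<lambda>z. Q (\<lambda>x. of_real (e \<bullet> (x - p)) * f x) (N z)) y
      = Q (\<lambda>z. Q (\<lambda>x. of_real (e \<bullet> x) * f x) (N z)) y + Q (\<lambda>z. Q (\<lambda>x. of_real (b \<bullet> y) * f x) (N z)) y"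
    using add[OF schwartz_inner_mult[OF \<open>schwartz f\<close>] schwartz_cmult[OF \<open>schwartz f\<close>]] by simp
  also have "Q (\<lambda>z. Q (\<lambda>x. of_real (b \<bullet> y) * f x) (N z)) y = of_real (b \<bullet> y) * Q (\<lambda>z. Q f (N z)) y"
    by (simp only: fourier_likeD(3)[OF Q \<open>schwartz f\<close>] fourier_likeD(3)[OF Q comp[OF \<open>schwartz f\<close>]])
  finally show "Q (\<lambda>z. Q (\<lambda>x. of_real (e \<bullet> (x - p)) * f x) (N z)) y = 0"
    using 1 by simp
qed

text \<open>The full Fourier transform is the slice at \<open>0\<close> of a partial one, after tensoring with a Gaussian in
  an auxiliary real variable.\<close>

lemma fourier_like_fourier: "fourier_like (fourier :: ('a::euclidean_space \<Rightarrow> complex) \<Rightarrow> 'a \<Rightarrow> complex)"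
proof -
  define lift :: "('a \<Rightarrow> complex) \<Rightarrow> real \<times> 'a \<Rightarrow> complex"
    where "lift f z = gaussian (fst z) * f (snd z)" for f z
  have lift: "schwartz (lift f)" if "schwartz f" for f
    unfolding lift_def[abs_def] by (rule schwartz_tensor[OF schwartz_gaussian that])
  have g0: "gaussian (0::real) = 1"
    by (simp add: gaussian_def)
  have four: "fourier f = (\<lambda>\<omega>. partial_fourier (lift f) (0, \<omega>))" for f :: "'a \<Rightarrow> complex"
    by (simp add: partial_fourier_def lift_def g0)
  have d: "partial_fourier (lift f) differentiable (at w)" if "schwartz f" for f w
    by (rule schwartz_differentiable[OF schwartz_partial_fourier[OF lift[OF that]]])
  have sc: "schwartz (fourier f)" if "schwartz f" for f :: "'a \<Rightarrow> complex"
    unfolding four by (rule schwartz_slice[OF schwartz_partial_fourier[OF lift[OF that]]])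
  have add: "fourier (\<lambda>x. f x + g x) x = fourier f x + fourier g x"
    if "schwartz f" "schwartz g" for f g :: "'a \<Rightarrow> complex" and x
  proof -
    have "lift (\<lambda>x. f x + g x) = (\<lambda>z. lift f z + lift g z)"
      by (simp add: fun_eq_iff lift_def distrib_left)
    then show ?thesis
      by (simp add: four partial_fourier_add lift that)
  qed
  have cmult: "fourier (\<lambda>x. c * f x) x = c * fourier f x" for c and f :: "'a \<Rightarrow> complex" and x
    by (simp add: fourier_def mult.assoc)
  have inner: "fourier (\<lambda>x. of_real (v \<bullet> x) * f x) x = \<i> / (2 * pi) * dir_deriv v (fourier f) x"
    if "schwartz f" for f :: "'a \<Rightarrow> complex" and v x
  proof -
    have "lift (\<lambda>x. of_real (v \<bullet> x) * f x) = (\<lambda>z. of_real ((0, v) \<bullet> z) * lift f z)"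
      by (simp add: fun_eq_iff lift_def inner_prod_def)
    then show ?thesis
      by (simp add: four partial_fourier_inner_mult[OF lift[OF that]] dir_deriv_slice(2)[OF d[OF that]])
  qed
  have deriv: "fourier (dir_deriv v f) x = 2 * pi * \<i> * of_real (v \<bullet> x) * fourier f x"
    if "schwartz f" for f :: "'a \<Rightarrow> complex" and v x
  proof -
    have "fourier (dir_deriv v f) x = partial_fourier (dir_deriv (0, v) (lift f)) (0, x)"
      unfolding partial_fourier_def prod.case dir_deriv_slice(2)[OF schwartz_differentiable[OF lift[OF that]], symmetric]
      by (simp add: lift_def g0)
    then show ?thesis
      by (simp add: four partial_fourier_dir_deriv_snd[OF lift[OF that]])
  qed
  show ?thesis
    unfolding fourier_like_def using sc add cmult inner deriv by blast
qed

lemma schwartz_fourier: "schwartz f \<Longrightarrow> schwartz (fourier f)"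
  by (rule fourier_likeD(1)[OF fourier_like_fourier])

lemma integral_gaussian: "(\<integral>t. gaussian (t::'a::euclidean_space) \<partial>lborel) = 1"
proof -
  let ?g = "\<lambda>x. exp (- pi * x\<^sup>2)"
  have g: "?g x = normal_density 0 (1 / sqrt (2 * pi)) x" for x
    by (simp add: normal_density_def power_divide)
  have "(\<integral>\<^sup>+ x. ennreal (?g x) \<partial>lborel) = 1"
    unfolding g by (subst nn_integral_eq_integral) auto
  then have "(\<Prod>b\<in>(Basis :: 'a set). \<integral>\<^sup>+ x. ennreal (?g x) \<partial>lborel) = 1"
    by simp
  moreover have "(\<integral>\<^sup>+ t. (\<Prod>b\<in>Basis. ennreal (?g (t \<bullet> b))) \<partial>(lborel :: 'a measure))
      = (\<Prod>b\<in>(Basis :: 'a set). \<integral>\<^sup>+ x. ennreal (?g x) \<partial>lborel)"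
    by (rule nn_integral_lborel_prod) auto
  moreover have "(\<Prod>b\<in>Basis. ennreal (?g (t \<bullet> b))) = ennreal (exp (- pi * (norm t)\<^sup>2))" for t :: 'a
  proof -
    have "(norm t)\<^sup>2 = (\<Sum>b\<in>Basis. (t \<bullet> b)\<^sup>2)"
      unfolding power2_norm_eq_inner by (subst euclidean_inner) (simp add: power2_eq_square)
    then have "exp (- pi * (norm t)\<^sup>2) = (\<Prod>b\<in>Basis. ?g (t \<bullet> b))"
      by (simp add: sum_distrib_left exp_sum)
    then show ?thesis
      by (simp add: prod_ennreal)
  qed
  ultimately have "(\<integral>\<^sup>+ t. ennreal (exp (- pi * (norm t)\<^sup>2)) \<partial>(lborel :: 'a measure)) = 1"
    by simp
  then have "(\<integral>t. exp (- pi * (norm t)\<^sup>2) \<partial>(lborel :: 'a measure)) = 1"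
    by (subst integral_eq_nn_integral) auto
  then show ?thesis
    unfolding gaussian_def by (simp only: integral_complex_of_real) simp
qed

text \<open>The Gaussian satisfies \<open>\<partial>\<^sub>v g = - 2 \<pi> (x \<bullet> v) g\<close>. The Fourier transform exchanges both sides of this equation,
  so the transform satisfies it as well, and the quotient of the two functions is constant, equal to the
  integral of \<open>g\<close>, which is \<open>1\<close>.\<close>

lemma fourier_gaussian: "fourier gaussian = (gaussian :: 'a::euclidean_space \<Rightarrow> complex)"
proof
  fix w :: 'a
  let ?G = "fourier (gaussian :: 'a \<Rightarrow> complex)"
  let ?E = "\<lambda>w::'a. complex_of_real (exp (pi * (w \<bullet> w)))"
  have G: "dir_deriv v ?G w = of_real (- 2 * pi * (w \<bullet> v)) * ?G w" for v w :: 'a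
  proof -
    have "dir_deriv v gaussian = (\<lambda>x::'a. (- 2 * pi) * (of_real (v \<bullet> x) * gaussian x))"
      by (simp add: fun_eq_iff dir_deriv_eqI[OF has_derivative_gaussian] inner_commute)
    then have "2 * pi * \<i> * of_real (v \<bullet> w) * ?G w = (- 2 * pi) * (\<i> / (2 * pi) * dir_deriv v ?G w)"
      using fourier_likeD(5)[OF fourier_like_fourier schwartz_gaussian, of v w]
        fourier_likeD(4)[OF fourier_like_fourier schwartz_gaussian, of v w]
        fourier_likeD(3)[OF fourier_like_fourier schwartz_inner_mult[OF schwartz_gaussian], of "- 2 * pi" v w]
      by simp
    then have "\<i> * dir_deriv v ?G w = \<i> * (of_real (- 2 * pi * (w \<bullet> v)) * ?G w)"
      by (simp add: inner_commute) (simp add: algebra_simps)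
    then show ?thesis
      using mult_left_cancel[OF complex_i_not_zero] by blast
  qed
  have dG: "(?G has_derivative (\<lambda>v. of_real (- 2 * pi * (w \<bullet> v)) * ?G w)) (at w)" for w
    using has_derivative_dir_deriv[OF schwartz_differentiable[OF schwartz_fourier[OF schwartz_gaussian]], of w]
    unfolding G .
  have dE: "(?E has_derivative (\<lambda>v. of_real (2 * pi * (w \<bullet> v) * exp (pi * (w \<bullet> w))))) (at w)" for w
    by (intro has_derivative_of_real) (auto intro!: derivative_eq_intros simp: inner_commute algebra_simps)
  have "((\<lambda>w. ?G w * ?E w) has_derivative (\<lambda>v. 0)) (at w within UNIV)" for w
    by (rule has_derivative_eq_rhs[OF has_derivative_mult[OF dG dE]]) (simp add: fun_eq_iff)
  then have "?G w * ?E w = ?G 0 * ?E 0"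
    using has_derivative_zero_unique[of UNIV "\<lambda>w. ?G w * ?E w" 0 w] by auto
  also have "\<dots> = 1"
    using integral_gaussian[where ?'a = 'a] by (simp add: fourier_def)
  finally have "?G w * ?E w = 1" .
  moreover have "gaussian w * ?E w = 1"
    by (simp add: gaussian_def power2_norm_eq_inner of_real_mult[symmetric] exp_add[symmetric] del: of_real_mult)
  ultimately show "?G w = gaussian w"
    by (metis mult_cancel_right mult_zero_right zero_neq_one)
qed

text \<open>Subtract the multiple of the Gaussian that makes \<open>f\<close> vanish at \<open>- y\<close>. The double transform of the
  difference vanishes at \<open>y\<close>, and the Gaussian is its own transform.\<close>

lemma fourier_inversion:
  fixes f :: "'a::euclidean_space \<Rightarrow> complex"
  assumes f: "schwartz f"
  shows "fourier (fourier f) y = f (- y)"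
proof -
  note F = fourier_likeD[OF fourier_like_fourier]
  let ?c = "- f (- y) / gaussian y"
  let ?h = "\<lambda>x. f x + ?c * gaussian x"
  have g: "schwartz (gaussian :: 'a \<Rightarrow> complex)" "schwartz (\<lambda>x::'a. ?c * gaussian x)"
    by (intro schwartz_cmult schwartz_gaussian)+
  have gy: "gaussian y \<noteq> 0" "gaussian (- y) = gaussian y"
    by (simp_all add: gaussian_def)
  have "fourier (\<lambda>z. fourier ?h z) y = 0"
  proof (rule fourier_like_inversion[OF fourier_like_fourier, where N = "\<lambda>z. z" and p = "- y"])
    show "schwartz ?h"
      by (intro schwartz_add f g)
  qed (use gy in \<open>auto simp: linear_id[unfolded id_def]\<close>)
  moreover have "fourier ?h = (\<lambda>z. fourier f z + ?c * gaussian z)"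
    by (simp only: fun_eq_iff F(2)[OF f g(2)] F(3)[OF g(1)] fourier_gaussian) simp
  moreover have "fourier (\<lambda>z. fourier f z + ?c * gaussian z) y = fourier (fourier f) y + ?c * gaussian y"
    by (simp only: F(2)[OF schwartz_fourier[OF f] g(2)] F(3)[OF g(1)] fourier_gaussian)
  ultimately show ?thesis
    using gy by simp
qed

lemma fourier_eq_0_imp_eq_0:
  assumes "schwartz f" "\<And>\<xi>. fourier f \<xi> = 0"
  shows "f x = 0"
proof -
  have "fourier f = (\<lambda>_. 0)"
    using assms(2) by auto
  then show ?thesis
    using fourier_inversion[OF assms(1), of "- x"] by (simp add: fourier_def)
qed

definition double_fourier ::
  "('a::euclidean_space \<times> 'b::euclidean_space \<Rightarrow> complex) \<Rightarrow> 'a \<times> 'b \<Rightarrow> complex" where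
  "double_fourier F = (\<lambda>(\<xi>, \<omega>). fourier (\<lambda>x. partial_fourier F (x, \<omega>)) \<xi>)"

lemma double_fourier_tensor:
  "double_fourier (\<lambda>z. f (fst z) * g (snd z)) w = fourier f (fst w) * fourier g (snd w)"
proof -
  have 1: "partial_fourier (\<lambda>z. f (fst z) * g (snd z)) (x, \<omega>) = f x * fourier g \<omega>" for x \<omega>
    by (simp add: partial_fourier_def fourier_def mult.assoc)
  have 2: "fourier (\<lambda>x. f x * c) \<xi> = fourier f \<xi> * c" for c \<xi>
    unfolding fourier_def
    by (subst integral_mult_left_zero[symmetric], rule Bochner_Integration.integral_cong)
      (simp_all add: mult_ac)
  show ?thesis
    unfolding double_fourier_def 1 2 by (simp add: split_beta)
qed

lemma linear_swap: "linear prod.swap" "inj prod.swap"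
  by (auto simp: linear_iff inj_def prod_eq_iff)

lemma schwartz_swap: "schwartz F \<Longrightarrow> schwartz (\<lambda>z. F (prod.swap z))"
  by (rule schwartz_linear_compose[OF _ linear_swap])

lemma dir_deriv_swap:
  "schwartz F \<Longrightarrow> dir_deriv v (\<lambda>z. F (prod.swap z)) z = dir_deriv (prod.swap v) F (prod.swap z)"
  by (rule dir_deriv_linear_compose[OF schwartz_differentiable linear_swap(1)])

text \<open>The transform in the first variable is the one in the second variable conjugated by the swap. Each of
  the two exchanges derivatives and coordinates in its own variable and commutes with those in the other.\<close>

lemma fourier_like_double_fourier:
  "fourier_like (double_fourier :: ('a::euclidean_space \<times> 'b::euclidean_space \<Rightarrow> complex) \<Rightarrow> _)"
proof -
  define P :: "('a \<times> 'b \<Rightarrow> complex) \<Rightarrow> 'a \<times> 'b \<Rightarrow> complex"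
    where "P F = (\<lambda>z. partial_fourier (\<lambda>z. F (prod.swap z)) (prod.swap z))" for F
  have dP: "double_fourier F = P (partial_fourier F)" for F :: "'a \<times> 'b \<Rightarrow> complex"
    by (auto simp: double_fourier_def P_def partial_fourier_def)
  have P_s: "schwartz (P F)" if "schwartz F" for F
    unfolding P_def by (intro schwartz_swap schwartz_partial_fourier that)
  have P_add: "P (\<lambda>z. F z + G z) w = P F w + P G w" if "schwartz F" "schwartz G" for F G w
    unfolding P_def by (intro partial_fourier_add schwartz_swap that)
  have P_cmult: "P (\<lambda>z. c * F z) w = c * P F w" for c F w
    unfolding P_def by (rule partial_fourier_cmult)
  have P_inner: "P (\<lambda>z. of_real ((a, b) \<bullet> z) * F z) w
      = of_real (b \<bullet> snd w) * P F w + \<i> / (2 * pi) * dir_deriv (a, 0) (P F) w" if "schwartz F" for F a b w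
  proof -
    have "(\<lambda>z. of_real ((a, b) \<bullet> prod.swap z) * F (prod.swap z))
        = (\<lambda>z. of_real ((b, a) \<bullet> z) * F (prod.swap z))"
      by (simp add: fun_eq_iff inner_prod_def add.commute)
    then show ?thesis
      unfolding P_def dir_deriv_swap[OF schwartz_partial_fourier[OF schwartz_swap[OF that]]]
      using partial_fourier_inner_mult[OF schwartz_swap[OF that], of b a "prod.swap w"] by simp
  qed
  have P_deriv: "P (dir_deriv (a, b) F) w
      = dir_deriv (0, b) (P F) w + 2 * pi * \<i> * of_real (a \<bullet> fst w) * P F w" if "schwartz F" for F a b w
  proof -
    have "(\<lambda>z. dir_deriv (a, b) F (prod.swap z)) = dir_deriv (b, a) (\<lambda>z. F (prod.swap z))"
      by (simp add: fun_eq_iff dir_deriv_swap[OF that])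
    then show ?thesis
      unfolding P_def dir_deriv_swap[OF schwartz_partial_fourier[OF schwartz_swap[OF that]]]
      using partial_fourier_dir_deriv[OF schwartz_swap[OF that], of b a "prod.swap w"] by simp
  qed
  show ?thesis
    unfolding fourier_like_def dP
  proof (intro conjI allI impI)
    fix F G :: "'a \<times> 'b \<Rightarrow> complex" and c and v w :: "'a \<times> 'b"
    assume F: "schwartz F"
    note pF = schwartz_partial_fourier[OF F]
    obtain a b where v: "v = (a, b)" by force
    have d0: "dir_deriv 0 H z = 0" if "schwartz H" for H :: "'a \<times> 'b \<Rightarrow> complex" and z
      using linear_0[OF linear_dir_deriv[OF that]] .
    have split: "dir_deriv v H z = dir_deriv (a, 0) H z + dir_deriv (0, b) H z"
      if "schwartz H" for H :: "'a \<times> 'b \<Rightarrow> complex" and z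
      using dir_deriv_add_direction[OF schwartz_differentiable[OF that], of "(a, 0)" "(0, b)"] by (simp add: v)
    show "schwartz (P (partial_fourier F))"
      by (intro P_s pF)
    show "P (partial_fourier (\<lambda>x. F x + G x)) w = P (partial_fourier F) w + P (partial_fourier G) w"
      if "schwartz G"
      using P_add[OF pF schwartz_partial_fourier[OF that]] partial_fourier_add[OF F that] by presburger
    show "P (partial_fourier (\<lambda>x. c * F x)) w = c * P (partial_fourier F) w"
      using P_cmult[of c "partial_fourier F" w] by (simp add: partial_fourier_cmult[abs_def])
    show "P (partial_fourier (\<lambda>x. of_real (v \<bullet> x) * F x)) w
        = \<i> / (2 * pi) * dir_deriv v (P (partial_fourier F)) w"
    proof -
      have "partial_fourier (\<lambda>x. of_real (v \<bullet> x) * F x) = (\<lambda>w. of_real ((a, 0) \<bullet> w) * partial_fourier F w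
          + (\<i> / (2 * pi)) * dir_deriv (0, b) (partial_fourier F) w)"
        unfolding v by (rule ext) (simp only: partial_fourier_inner_mult[OF F], simp add: inner_prod_def)
      then have "P (partial_fourier (\<lambda>x. of_real (v \<bullet> x) * F x)) w
          = P (\<lambda>w. of_real ((a, 0) \<bullet> w) * partial_fourier F w) w
            + (\<i> / (2 * pi)) * P (dir_deriv (0, b) (partial_fourier F)) w"
        using P_add[OF schwartz_inner_mult[OF pF, of "(a, 0)"]
            schwartz_cmult[OF schwartz_dir_deriv[OF pF]]] by (simp only: P_cmult)
      then show ?thesis
        unfolding P_inner[OF pF] P_deriv[OF pF] split[OF P_s[OF pF]] by (simp add: distrib_left)
    qed
    show "P (partial_fourier (dir_deriv v F)) w = 2 * pi * \<i> * of_real (v \<bullet> w) * P (partial_fourier F) w"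
    proof -
      have "partial_fourier (dir_deriv v F) = (\<lambda>w. dir_deriv (a, 0) (partial_fourier F) w
          + (2 * pi * \<i>) * (of_real ((0, b) \<bullet> w) * partial_fourier F w))"
        unfolding v by (rule ext) (simp only: partial_fourier_dir_deriv[OF F], simp add: inner_prod_def)
      then have "P (partial_fourier (dir_deriv v F)) w = P (dir_deriv (a, 0) (partial_fourier F)) w
          + (2 * pi * \<i>) * P (\<lambda>w. of_real ((0, b) \<bullet> w) * partial_fourier F w) w"
        using P_add[OF schwartz_dir_deriv[OF pF]
            schwartz_cmult[OF schwartz_inner_mult[OF pF, of "(0, b)"]]] by (simp only: P_cmult)
      then show ?thesis
        unfolding P_inner[OF pF] P_deriv[OF pF] v zero_prod_def[symmetric] d0[OF P_s[OF pF]]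
        by (simp add: inner_prod_def algebra_simps)
    qed
  qed
qed


section \<open>Functionals whose tensor square vanishes over a discrete set\<close>

text \<open>The algebraic part of the definition of tempered distributions.\<close>

definition conj_linear :: "'a::euclidean_space functional \<Rightarrow> bool" where
  "conj_linear \<mu> \<longleftrightarrow>
     (\<forall>\<phi> \<psi>. schwartz \<phi> \<longrightarrow> schwartz \<psi> \<longrightarrow> \<mu> (\<lambda>x. \<phi> x + \<psi> x) = \<mu> \<phi> + \<mu> \<psi>) \<and>
     (\<forall>a \<phi>. schwartz \<phi> \<longrightarrow> \<mu> (\<lambda>x. a * \<phi> x) = cnj a * \<mu> \<phi>)"

lemma conj_linear_add:
  "conj_linear \<mu> \<Longrightarrow> schwartz \<phi> \<Longrightarrow> schwartz \<psi> \<Longrightarrow> \<mu> (\<lambda>x. \<phi> x + \<psi> x) = \<mu> \<phi> + \<mu> \<psi>"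
  unfolding conj_linear_def by blast

lemma conj_linear_cmult:
  "conj_linear \<mu> \<Longrightarrow> schwartz \<phi> \<Longrightarrow> \<mu> (\<lambda>x. a * \<phi> x) = cnj a * \<mu> \<phi>"
  unfolding conj_linear_def by blast

lemma conj_linear_zero: "conj_linear \<mu> \<Longrightarrow> \<mu> (\<lambda>x. 0) = 0"
  using conj_linear_cmult[OF _ schwartz_zero, of \<mu> 0] by simp

lemma conj_linear_sum:
  assumes "conj_linear \<mu>" "finite I" "\<And>i. i \<in> I \<Longrightarrow> schwartz (f i)"
  shows "\<mu> (\<lambda>x. \<Sum>i\<in>I. f i x) = (\<Sum>i\<in>I. \<mu> (f i))"
  using assms(2,3)
  by (induction I) (simp_all add: conj_linear_zero[OF assms(1)] conj_linear_add[OF assms(1)] schwartz_sum)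

definition supported_in :: "('a::euclidean_space \<Rightarrow> complex) \<Rightarrow> 'a set \<Rightarrow> bool" where
  "supported_in \<phi> U \<longleftrightarrow> test_function \<phi> \<and> closure {x. \<phi> x \<noteq> 0} \<subseteq> U"

lemma supported_in_0: "supported_in \<phi> U \<Longrightarrow> x \<notin> U \<Longrightarrow> \<phi> x = 0"
  unfolding supported_in_def using eq_0_off_support by blast

lemma supported_in_mono: "supported_in \<phi> U \<Longrightarrow> U \<subseteq> V \<Longrightarrow> supported_in \<phi> V"
  unfolding supported_in_def by blast

lemma supported_in_schwartz: "supported_in \<phi> U \<Longrightarrow> schwartz \<phi>"
  unfolding supported_in_def using test_function_schwartz by blast

lemma supported_in_divide:
  assumes \<phi>: "supported_in \<phi> U" and g: "smooth g" "\<And>x. x \<in> U \<Longrightarrow> g x \<noteq> 0"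
  shows "supported_in (\<lambda>x. \<phi> x / g x) U"
proof -
  let ?K = "closure {x. \<phi> x \<noteq> 0}"
  have K: "smooth \<phi>" "compact ?K" "?K \<subseteq> U"
    using \<phi> unfolding supported_in_def test_function_def by auto
  note \<phi>0 = eq_0_off_support[of _ \<phi>]
  have "g x \<noteq> 0" if "x \<in> ?K" for x
    using that K(3) g(2) by blast
  then have "smooth (\<lambda>x. \<phi> x / g x)"
    using smooth_divide[OF K(1) \<phi>0 closed_closure g(1)] by blast
  then have "test_function (\<lambda>x. \<phi> x / g x)"
    by (rule test_functionI[OF _ K(2)]) (subst \<phi>0, simp_all)
  moreover have "closure {x. \<phi> x / g x \<noteq> 0} \<subseteq> ?K"
    by (rule closure_mono) auto
  ultimately show ?thesis
    using K(3) unfolding supported_in_def by blast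
qed

lemma uniform_discrete_linear_vimage:
  fixes L :: "'a::euclidean_space \<Rightarrow> 'b::euclidean_space"
  assumes L: "linear L" "inj L" and R: "uniform_discrete R"
  shows "uniform_discrete {q. L q \<in> R}"
proof -
  obtain e where e: "e > 0" "\<And>x y. x \<in> R \<Longrightarrow> y \<in> R \<Longrightarrow> dist x y < e \<Longrightarrow> x = y"
    using R unfolding uniform_discrete_def by blast
  obtain K where K: "K > 0" "\<And>x. norm (L x) \<le> norm x * K"
    using bounded_linear.pos_bounded[of L] L(1) linear_conv_bounded_linear by blast
  have "x = y" if "L x \<in> R" "L y \<in> R" "dist x y < e / K" for x y
  proof -
    have "dist (L x) (L y) \<le> dist x y * K"
      using K(2)[of "x - y"] by (simp add: dist_norm linear_diff[OF L(1)])
    also have "\<dots> < e"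
      using that(3) K(1) by (simp add: pos_less_divide_eq)
    finally show ?thesis
      using e(2) that L(2) by (meson injD)
  qed
  then show ?thesis
    unfolding uniform_discrete_def using e(1) K(1) by (intro exI[of _ "e / K"]) auto
qed

lemma uniform_discrete_finite_Int_compact:
  fixes \<Lambda> :: "'a::euclidean_space set"
  assumes "uniform_discrete \<Lambda>" "compact K"
  shows "finite (\<Lambda> \<inter> K)"
proof -
  have "uniform_discrete (\<Lambda> \<inter> K)" "bounded (\<Lambda> \<inter> K)"
    using assms uniform_discrete_subset[of \<Lambda> "\<Lambda> \<inter> K"] bounded_subset[OF compact_imp_bounded, of K "\<Lambda> \<inter> K"]
    by auto
  then show ?thesis
    using uniform_discrete_finite_iff by blast
qed

lemma finite_discrete_support:
  fixes \<Lambda> :: "'a::euclidean_space set"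
  assumes "uniform_discrete \<Lambda>" "test_function \<phi>"
  shows "finite {q. q \<in> \<Lambda> \<and> \<phi> q \<noteq> 0}"
proof (rule finite_subset)
  show "{q. q \<in> \<Lambda> \<and> \<phi> q \<noteq> 0} \<subseteq> \<Lambda> \<inter> closure {x. \<phi> x \<noteq> 0}"
    using closure_subset[of "{x. \<phi> x \<noteq> 0}"] by blast
  show "finite (\<Lambda> \<inter> closure {x. \<phi> x \<noteq> 0})"
    using assms unfolding test_function_def by (blast intro: uniform_discrete_finite_Int_compact)
qed

text \<open>The Dirac masses with weights the positive and negative parts of the real and imaginary parts of \<open>a\<close> form
  four Radon measures, because a compact set contains only finitely many points of \<open>\<Lambda>\<close>.\<close>

lemma given_by_measure_discrete:
  fixes \<nu> :: "'a::euclidean_space functional"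
  assumes \<Lambda>: "uniform_discrete \<Lambda>"
    and \<nu>: "\<And>\<phi>. test_function \<phi> \<Longrightarrow> \<nu> \<phi> = (\<Sum>q | q \<in> \<Lambda> \<and> \<phi> q \<noteq> 0. a q * cnj (\<phi> q))"
  shows "given_by_measure \<nu>"
proof -
  define M :: "('a \<Rightarrow> real) \<Rightarrow> 'a measure"
    where "M w = distr (density (count_space \<Lambda>) (\<lambda>q. ennreal (w q))) borel (\<lambda>q. q)" for w
  have meas: "(\<lambda>q. q) \<in> density (count_space \<Lambda>) (\<lambda>q. ennreal (w q)) \<rightarrow>\<^sub>M borel" for w
    by simp
  have radon: "radon_measure (M w)" for w
    unfolding radon_measure_def
  proof (intro conjI allI impI)
    fix K :: "'a set" assume K: "compact K"
    then have Kb: "K \<in> sets borel"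
      by (simp add: compact_imp_closed borel_closed)
    have "emeasure (M w) K = emeasure (density (count_space \<Lambda>) (\<lambda>q. ennreal (w q))) (\<Lambda> \<inter> K)"
      unfolding M_def using Kb by (subst emeasure_distr[OF meas]) (auto simp: Int_commute vimage_def Int_def)
    also have "\<dots> = (\<integral>\<^sup>+ q. ennreal (w q) * indicator (\<Lambda> \<inter> K) q \<partial>count_space \<Lambda>)"
      by (rule emeasure_density) auto
    also have "\<dots> = (\<Sum>q\<in>\<Lambda> \<inter> K. ennreal (w q) * indicator (\<Lambda> \<inter> K) q)"
      by (rule nn_integral_count_space'[OF uniform_discrete_finite_Int_compact[OF \<Lambda> K]]) auto
    also have "\<dots> < \<infinity>"
      using uniform_discrete_finite_Int_compact[OF \<Lambda> K] by (auto simp: ennreal_mult_less_top less_top[symmetric])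
    finally show "emeasure (M w) K < \<infinity>" .
  qed (simp add: M_def)
  have integral: "(\<integral>x. cnj (\<phi> x) \<partial>M w) = (\<Sum>q | q \<in> \<Lambda> \<and> \<phi> q \<noteq> 0. of_real (w q) * cnj (\<phi> q))"
    if w: "\<And>q. w q \<ge> 0" and \<phi>: "test_function \<phi>" for w \<phi>
  proof -
    note fin = finite_discrete_support[OF \<Lambda> \<phi>]
    have "(\<integral>x. cnj (\<phi> x) \<partial>M w) = (\<integral>q. cnj (\<phi> q) \<partial>density (count_space \<Lambda>) (\<lambda>q. ennreal (w q)))"
      unfolding M_def
    proof (rule integral_distr[OF meas])
      have "continuous_on UNIV (\<lambda>x. cnj (\<phi> x))"
        by (intro schwartz_continuous_on schwartz_cnj test_function_schwartz \<phi>)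
      then show "(\<lambda>x. cnj (\<phi> x)) \<in> borel_measurable borel"
        by (rule borel_measurable_continuous_onI)
    qed
    also have "\<dots> = (\<integral>q. w q *\<^sub>R cnj (\<phi> q) \<partial>count_space \<Lambda>)"
      using w by (intro integral_density) auto
    also have "\<dots> = (\<Sum>q | q \<in> \<Lambda> \<and> w q *\<^sub>R cnj (\<phi> q) \<noteq> 0. w q *\<^sub>R cnj (\<phi> q))"
      by (rule lebesgue_integral_count_space_finite_support, rule finite_subset[OF _ fin]) auto
    also have "\<dots> = (\<Sum>q | q \<in> \<Lambda> \<and> \<phi> q \<noteq> 0. of_real (w q) * cnj (\<phi> q))"
      unfolding scaleR_conv_of_real by (rule sum.mono_neutral_left[OF fin]) auto
    finally show "(\<integral>x. cnj (\<phi> x) \<partial>M w) = (\<Sum>q | q \<in> \<Lambda> \<and> \<phi> q \<noteq> 0. of_real (w q) * cnj (\<phi> q))" .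
  qed
  define w :: "nat \<Rightarrow> 'a \<Rightarrow> real" where
    "w k q = max 0 ([Re (a q), Im (a q), - Re (a q), - Im (a q)] ! k)" for k q
  have a: "a q = (\<Sum>k<4. \<i> ^ k * of_real (w k q))" for q
    by (simp add: w_def eval_nat_numeral complex_eq_iff max_def)
  have "\<nu> \<phi> = (\<Sum>k<4. \<i> ^ k * (\<integral>x. cnj (\<phi> x) \<partial>M (w k)))" if "test_function \<phi>" for \<phi>
  proof -
    have "(\<Sum>k<4. \<i> ^ k * (\<integral>x. cnj (\<phi> x) \<partial>M (w k)))
        = (\<Sum>k<4. \<i> ^ k * (\<Sum>q | q \<in> \<Lambda> \<and> \<phi> q \<noteq> 0. of_real (w k q) * cnj (\<phi> q)))"
      by (intro sum.cong refl, subst integral[OF _ that]) (auto simp: w_def)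
    also have "\<dots> = (\<Sum>q | q \<in> \<Lambda> \<and> \<phi> q \<noteq> 0. (\<Sum>k<4. \<i> ^ k * of_real (w k q)) * cnj (\<phi> q))"
      unfolding sum_distrib_left sum_distrib_right mult.assoc by (rule sum.swap)
    finally show ?thesis
      unfolding \<nu>[OF that] a[symmetric] by simp
  qed
  then show ?thesis
    unfolding given_by_measure_def using radon by (intro exI[of _ "\<lambda>k. M (w k)"]) blast
qed

lemma moderate_linear_coordinate:
  fixes P :: "'a::euclidean_space \<Rightarrow> 'b::euclidean_space"
  assumes "linear P"
  shows "moderate (\<lambda>u. of_real (b \<bullet> P (u - p)))"
proof -
  have "b \<bullet> P (u - p) = adjoint P b \<bullet> u + - (adjoint P b \<bullet> p)" for u
    using adjoint_works[OF assms, of "u - p" b] by (simp add: inner_commute inner_diff_left)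
  then show ?thesis
    using moderate_affine[of "adjoint P b" "of_real (- (adjoint P b \<bullet> p))"] by simp
qed

lemma cnj_bump: "cnj (bump p \<epsilon> x) = bump p \<epsilon> x"
  by (simp add: bump_def)

text \<open>If some \<open>d e\<close> is not real, then \<open>x\<^sub>e - p\<^sub>e - cnj (d e)\<close> has no zeros, so every test function is divisible by
  it, and \<open>l\<close> vanishes on test functions. If all \<open>d e\<close> are real, they are the coordinates of \<open>q - p\<close> for
  some point \<open>q\<close>, and \<open>l\<close> is a multiple of \<open>\<delta>\<^sub>q\<close> by Hadamard's lemma. Near \<open>p\<close> only the case \<open>q = p\<close> contributes.\<close>

lemma scalar_coordinates_imp_dirac:
  fixes l :: "'a::euclidean_space functional"
  assumes l: "conj_linear l"
    and d: "\<And>e f. e \<in> Basis \<Longrightarrow> schwartz f \<Longrightarrow> l (\<lambda>x. of_real (e \<bullet> (x - p)) * f x) = d e * l f"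
  shows "\<exists>a r. r > 0 \<and> (\<forall>h. supported_in h (ball p r) \<longrightarrow> l h = a * cnj (h p))"
proof (cases "\<exists>e\<in>Basis. Im (d e) \<noteq> 0")
  case True
  then obtain e where e: "e \<in> Basis" "Im (d e) \<noteq> 0" by blast
  let ?g = "\<lambda>x. of_real (e \<bullet> x) + - (of_real (e \<bullet> p) + cnj (d e))"
  have g: "?g x \<noteq> 0" for x
  proof
    assume "?g x = 0"
    then have "Im (?g x) = 0" by (simp only: complex.sel zero_complex.simps)
    then show False using e(2) by simp
  qed
  have "l h = 0" if "supported_in h (ball p 1)" for h
  proof -
    have "supported_in (\<lambda>x. h x / ?g x) (ball p 1)"
      by (rule supported_in_divide[OF that moderate_imp_smooth[OF moderate_affine] g])
    then have k: "schwartz (\<lambda>x. h x / ?g x)"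
      by (rule supported_in_schwartz)
    have "h x = of_real (e \<bullet> (x - p)) * (h x / ?g x) + (- cnj (d e)) * (h x / ?g x)" for x
    proof -
      have "?g x * t = of_real (e \<bullet> (x - p)) * t + (- cnj (d e)) * t" for t
        by (simp add: inner_diff_right algebra_simps)
      from this[of "h x / ?g x"] show ?thesis
        using g[of x] by simp
    qed
    then have "l h = l (\<lambda>x. of_real (e \<bullet> (x - p)) * (h x / ?g x) + (- cnj (d e)) * (h x / ?g x))"
      by presburger
    also have "\<dots> = l (\<lambda>x. of_real (e \<bullet> (x - p)) * (h x / ?g x)) + l (\<lambda>x. (- cnj (d e)) * (h x / ?g x))"
      by (intro conj_linear_add[OF l] schwartz_cmult k
          schwartz_moderate_mult[OF moderate_linear_coordinate[OF linear_id[unfolded id_def]]])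
    also have "\<dots> = 0"
      by (simp only: d[OF e(1) k] conj_linear_cmult[OF l k]) simp
    finally show ?thesis .
  qed
  then show ?thesis
    by (intro exI[of _ 0] exI[of _ 1]) simp
next
  case False
  define q where "q = p + (\<Sum>e\<in>Basis. Re (d e) *\<^sub>R e)"
  have dq: "d e = of_real (e \<bullet> (q - p))" if "e \<in> Basis" for e
    using False that by (simp add: q_def inner_sum_right inner_Basis if_distrib complex_eq_iff cong: if_cong)
  have vanish: "l f = 0" if "schwartz f" "f q = 0" for f
  proof (rule functional_killing_coordinates_vanishes[where p = q, OF _ _ that])
    show "l (\<lambda>x. f x + g x) = l f + l g" if "schwartz f" "schwartz g" for f g
      by (rule conj_linear_add[OF l that])
    fix e :: 'a and f :: "'a \<Rightarrow> complex" assume e: "e \<in> Basis" and f: "schwartz f"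
    have "(\<lambda>x. of_real (e \<bullet> (x - q)) * f x)
        = (\<lambda>x. of_real (e \<bullet> (x - p)) * f x + (- d e) * f x)"
      by (simp add: dq[OF e] fun_eq_iff inner_diff_right algebra_simps)
    then have "l (\<lambda>x. of_real (e \<bullet> (x - q)) * f x)
        = l (\<lambda>x. of_real (e \<bullet> (x - p)) * f x) + l (\<lambda>x. (- d e) * f x)"
      using conj_linear_add[OF l schwartz_moderate_mult[OF moderate_linear_coordinate[OF linear_id[unfolded id_def]] f]
          schwartz_cmult[OF f]] by presburger
    also have "\<dots> = 0"
      by (simp only: d[OF e f] conj_linear_cmult[OF l f]) (simp add: dq[OF e])
    finally show "l (\<lambda>x. of_real (e \<bullet> (x - q)) * f x) = 0" .
  qed
  show ?thesis
  proof (cases "q = p")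
    case True
    let ?g = "\<lambda>x. gaussian (x - p)"
    have g: "schwartz ?g" "?g p = 1"
      by (rule schwartz_translate[OF schwartz_gaussian]) (simp add: gaussian_def)
    have "l h = l ?g * cnj (h p)" if h: "schwartz h" for h
    proof -
      have "l (\<lambda>x. h x + (- h p) * ?g x) = 0"
        by (rule vanish[OF schwartz_add[OF h schwartz_cmult[OF g(1)]]]) (use g(2) True in simp)
      moreover have "l (\<lambda>x. h x + (- h p) * ?g x) = l h + cnj (- h p) * l ?g"
        by (simp only: conj_linear_add[OF l h schwartz_cmult[OF g(1)]] conj_linear_cmult[OF l g(1)])
      ultimately show ?thesis
        by (simp add: mult.commute)
    qed
    then show ?thesis
      using supported_in_schwartz by (intro exI[of _ "l ?g"] exI[of _ 1]) (auto)
  next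
    case False
    have "l h = 0" if "supported_in h (ball p (dist p q))" for h
      by (rule vanish[OF supported_in_schwartz[OF that] supported_in_0[OF that]]) simp
    then show ?thesis
      using False by (intro exI[of _ 0] exI[of _ "dist p q"]) simp
  qed
qed

text \<open>Sums of two tensors suffice: a single one localizes the support, and two arise from a component of \<open>P (u - p) + Q (v - p)\<close> times a tensor.\<close>

locale tensor_square_vanishing =
  fixes \<nu> :: "'a::euclidean_space functional" and P Q :: "'a \<Rightarrow> 'a" and R :: "'a set"
  assumes conj_linear: "conj_linear \<nu>"
    and linear: "linear P" "linear Q" and inj_sum: "inj (\<lambda>x. P x + Q x)"
    and discrete: "uniform_discrete R"
    and vanishing: "\<And>\<phi>\<^sub>1 \<psi>\<^sub>1 \<phi>\<^sub>2 \<psi>\<^sub>2. schwartz \<phi>\<^sub>1 \<Longrightarrow> schwartz \<psi>\<^sub>1 \<Longrightarrow> schwartz \<phi>\<^sub>2 \<Longrightarrow> schwartz \<psi>\<^sub>2 \<Longrightarrow>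
      (\<And>u v. P u + Q v \<in> R \<Longrightarrow> \<phi>\<^sub>1 u * cnj (\<psi>\<^sub>1 v) + \<phi>\<^sub>2 u * cnj (\<psi>\<^sub>2 v) = 0) \<Longrightarrow>
      \<nu> \<phi>\<^sub>1 * cnj (\<nu> \<psi>\<^sub>1) + \<nu> \<phi>\<^sub>2 * cnj (\<nu> \<psi>\<^sub>2) = 0"
begin

definition \<Lambda> where "\<Lambda> = {q. P q + Q q \<in> R}"

lemma linear_sum: "linear (\<lambda>x. P x + Q x)"
  using linear by (rule linear_compose_add)

lemma near:
  assumes "e > 0"
  obtains \<epsilon> where "\<epsilon> > 0" "\<And>u v. u \<in> ball q \<epsilon> \<Longrightarrow> v \<in> ball q \<epsilon> \<Longrightarrow> dist (P u + Q v) (P q + Q q) < e"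
proof -
  obtain K where K: "K > 0" "\<And>x. norm (P x) \<le> norm x * K"
    using bounded_linear.pos_bounded[of P] linear(1) linear_conv_bounded_linear by blast
  obtain L where L: "L > 0" "\<And>x. norm (Q x) \<le> norm x * L"
    using bounded_linear.pos_bounded[of Q] linear(2) linear_conv_bounded_linear by blast
  show thesis
  proof
    show "e / (K + L) > 0"
      using assms K L by simp
    fix u v assume "u \<in> ball q (e / (K + L))" "v \<in> ball q (e / (K + L))"
    then have uv: "norm (u - q) < e / (K + L)" "norm (v - q) < e / (K + L)"
      by (auto simp: dist_norm norm_minus_commute)
    have "dist (P u + Q v) (P q + Q q) = norm (P (u - q) + Q (v - q))"
      by (simp add: dist_norm linear_diff[OF linear(1)] linear_diff[OF linear(2)] algebra_simps)
    also have "\<dots> \<le> norm (u - q) * K + norm (v - q) * L"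
      by (rule order_trans[OF norm_triangle_ineq add_mono[OF K(2) L(2)]])
    also have "\<dots> < e / (K + L) * K + e / (K + L) * L"
      using uv K(1) L(1) by (intro add_strict_mono mult_strict_right_mono)
    also have "\<dots> = e"
      using K(1) L(1) unfolding distrib_left[symmetric] by simp
    finally show "dist (P u + Q v) (P q + Q q) < e" .
  qed
qed

lemma locally_zero:
  assumes "q \<notin> \<Lambda>"
  shows "\<exists>\<epsilon>>0. \<forall>\<phi>. supported_in \<phi> (ball q \<epsilon>) \<longrightarrow> \<nu> \<phi> = 0"
proof -
  have "open (- R)"
    using uniform_discrete_imp_closed[OF discrete] by (simp add: open_Compl)
  moreover have "P q + Q q \<in> - R"
    using assms by (simp add: \<Lambda>_def)
  ultimately obtain e where e: "e > 0" "ball (P q + Q q) e \<subseteq> - R"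
    using open_contains_ball by blast
  obtain \<epsilon> where \<epsilon>: "\<epsilon> > 0" "\<And>u v. u \<in> ball q \<epsilon> \<Longrightarrow> v \<in> ball q \<epsilon> \<Longrightarrow> dist (P u + Q v) (P q + Q q) < e"
    using near[OF e(1)] by blast
  have "\<nu> \<phi> = 0" if \<phi>: "supported_in \<phi> (ball q \<epsilon>)" for \<phi>
  proof -
    have "\<phi> u * cnj (\<phi> v) + 0 * cnj 0 = 0" if "P u + Q v \<in> R" for u v
    proof -
      have "\<not> (u \<in> ball q \<epsilon> \<and> v \<in> ball q \<epsilon>)"
        using \<epsilon>(2)[of u v] e(2) that by (metis ComplD dist_commute mem_ball subsetD)
      then show ?thesis
        using supported_in_0[OF \<phi>] by auto
    qed
    then have "\<nu> \<phi> * cnj (\<nu> \<phi>) + \<nu> (\<lambda>x. 0) * cnj (\<nu> (\<lambda>x. 0)) = 0"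
      using supported_in_schwartz[OF \<phi>] schwartz_zero by (intro vanishing) auto
    then show ?thesis
      by (simp add: conj_linear_zero[OF conj_linear])
  qed
  then show ?thesis
    using \<epsilon>(1) by blast
qed

text \<open>The key step. Fix a Schwartz function \<open>\<phi>\<^sub>0\<close> with \<open>l \<phi>\<^sub>0 \<noteq> 0\<close> for the localized functional \<open>l\<close>. Setting \<open>\<psi> = \<phi>\<^sub>0\<close>
  in the identity \<open>key\<close> shows that multiplication by \<open>b \<bullet> P (x - p)\<close> acts on \<open>l\<close> as a scalar, and setting
  \<open>\<phi> = \<phi>\<^sub>0\<close> shows the same for \<open>b \<bullet> Q (x - p)\<close>. As \<open>P + Q\<close> is injective, each coordinate of \<open>x - p\<close> is of the
  form \<open>b \<bullet> (P (x - p) + Q (x - p))\<close>.\<close>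

lemma locally_dirac:
  assumes "p \<in> \<Lambda>"
  shows "\<exists>a \<epsilon>. \<epsilon> > 0 \<and> (\<forall>\<phi>. supported_in \<phi> (ball p \<epsilon>) \<longrightarrow> \<nu> \<phi> = a * cnj (\<phi> p))"
proof -
  obtain e where e: "e > 0" "\<And>x y. x \<in> R \<Longrightarrow> y \<in> R \<Longrightarrow> dist x y < e \<Longrightarrow> x = y"
    using discrete unfolding uniform_discrete_def by blast
  obtain \<epsilon> where \<epsilon>: "\<epsilon> > 0" "\<And>u v. u \<in> ball p \<epsilon> \<Longrightarrow> v \<in> ball p \<epsilon> \<Longrightarrow> dist (P u + Q v) (P p + Q p) < e"
    using near[OF e(1)] by blast
  have only: "P (u - p) + Q (v - p) = 0" if "u \<in> ball p \<epsilon>" "v \<in> ball p \<epsilon>" "P u + Q v \<in> R" for u v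
  proof -
    have "P u + Q v = P p + Q p"
      using assms by (intro e(2) \<epsilon>(2) that) (simp add: \<Lambda>_def)
    then show ?thesis
      by (simp add: linear_diff[OF linear(1)] linear_diff[OF linear(2)] algebra_simps)
  qed
  define \<eta> where "\<eta> = bump p \<epsilon>"
  have \<eta>: "schwartz \<eta>" "smooth \<eta>" "\<And>x. cnj (\<eta> x) = \<eta> x" "\<And>x. \<eta> x \<noteq> 0 \<longleftrightarrow> x \<in> ball p \<epsilon>"
    using test_function_schwartz[OF test_function_bump] smooth_bump cnj_bump bump_nonzero_iff \<epsilon>(1)
    unfolding \<eta>_def by blast+
  define l where "l \<phi> = \<nu> (\<lambda>x. \<eta> x * \<phi> x)" for \<phi>
  have l: "conj_linear l"
    unfolding conj_linear_def
  proof (intro conjI allI impI)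
    show "l (\<lambda>x. \<phi> x + \<psi> x) = l \<phi> + l \<psi>" if "schwartz \<phi>" "schwartz \<psi>" for \<phi> \<psi>
      using conj_linear_add[OF conj_linear schwartz_mult[OF \<eta>(1) that(1)] schwartz_mult[OF \<eta>(1) that(2)]]
      by (simp add: l_def distrib_left)
    show "l (\<lambda>x. a * \<phi> x) = cnj a * l \<phi>" if "schwartz \<phi>" for a \<phi>
      using conj_linear_cmult[OF conj_linear schwartz_mult[OF \<eta>(1) that], of a]
      by (simp add: l_def mult.left_commute)
  qed
  let ?cP = "\<lambda>b f x. of_real (b \<bullet> P (x - p)) * f x" and ?cQ = "\<lambda>b f x. of_real (b \<bullet> Q (x - p)) * f x"
  have sP: "schwartz (?cP b f)" if "schwartz f" for b f
    by (rule schwartz_moderate_mult[OF moderate_linear_coordinate[OF linear(1)] that])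
  have sQ: "schwartz (?cQ b f)" if "schwartz f" for b f
    by (rule schwartz_moderate_mult[OF moderate_linear_coordinate[OF linear(2)] that])
  have key: "l (?cP b \<phi>) * cnj (l \<psi>) + l \<phi> * cnj (l (?cQ b \<psi>)) = 0"
    if "schwartz \<phi>" "schwartz \<psi>" for b \<phi> \<psi>
    unfolding l_def
  proof (rule vanishing)
    fix u v assume R: "P u + Q v \<in> R"
    show "\<eta> u * ?cP b \<phi> u * cnj (\<eta> v * \<psi> v) + \<eta> u * \<phi> u * cnj (\<eta> v * ?cQ b \<psi> v) = 0"
    proof (cases "u \<in> ball p \<epsilon> \<and> v \<in> ball p \<epsilon>")
      case True
      have "\<eta> u * ?cP b \<phi> u * cnj (\<eta> v * \<psi> v) + \<eta> u * \<phi> u * cnj (\<eta> v * ?cQ b \<psi> v)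
          = of_real (b \<bullet> (P (u - p) + Q (v - p))) * (\<eta> u * \<phi> u * cnj (\<eta> v * \<psi> v))"
        by (simp add: inner_add_right algebra_simps)
      then show ?thesis
        using only[of u v] True R by simp
    next
      case False
      then have "\<eta> u = 0 \<or> \<eta> v = 0"
        using \<eta>(4) by blast
      then show ?thesis
        by auto
    qed
  qed (intro schwartz_mult[OF \<eta>(1)] sP sQ that)+
  have *: "\<exists>a r. r > 0 \<and> (\<forall>h. supported_in h (ball p r) \<longrightarrow> l h = a * cnj (h p))"
  proof (cases "\<exists>\<phi>. schwartz \<phi> \<and> l \<phi> \<noteq> 0")
    case False
    then show ?thesis
      using supported_in_schwartz by (intro exI[of _ 0] exI[of _ 1]) auto
  next
    case True
    then obtain \<phi>\<^sub>0 where \<phi>\<^sub>0: "schwartz \<phi>\<^sub>0" "l \<phi>\<^sub>0 \<noteq> 0" by blast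
    define c where "c b = - cnj (l (?cQ b \<phi>\<^sub>0)) / cnj (l \<phi>\<^sub>0) + - cnj (l (?cP b \<phi>\<^sub>0)) / cnj (l \<phi>\<^sub>0)" for b
    have sum: "l (\<lambda>x. of_real (b \<bullet> (P (x - p) + Q (x - p))) * f x) = c b * l f" if f: "schwartz f" for b f
    proof -
      have 1: "l (?cP b f) = - cnj (l (?cQ b \<phi>\<^sub>0)) / cnj (l \<phi>\<^sub>0) * l f"
        using key[OF f \<phi>\<^sub>0(1), of b] \<phi>\<^sub>0(2) by (simp add: field_simps eq_neg_iff_add_eq_0)
      have "cnj (l (?cP b \<phi>\<^sub>0) * cnj (l f) + l \<phi>\<^sub>0 * cnj (l (?cQ b f))) = cnj 0"
        using key[OF \<phi>\<^sub>0(1) f, of b] by (simp only:)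
      then have 2: "l (?cQ b f) = - cnj (l (?cP b \<phi>\<^sub>0)) / cnj (l \<phi>\<^sub>0) * l f"
        using \<phi>\<^sub>0(2) by (simp add: field_simps eq_neg_iff_add_eq_0)
      have "l (\<lambda>x. of_real (b \<bullet> (P (x - p) + Q (x - p))) * f x) = l (\<lambda>x. ?cP b f x + ?cQ b f x)"
        by (simp add: inner_add_right distrib_right)
      also have "\<dots> = l (?cP b f) + l (?cQ b f)"
        by (rule conj_linear_add[OF l sP[OF f] sQ[OF f]])
      finally show ?thesis
        unfolding 1 2 c_def distrib_right .
    qed
    obtain M where M: "linear M" "\<And>x. M (P x + Q x) = x"
      using linear_injective_left_inverse[OF linear_sum inj_sum] by (metis comp_apply id_apply)
    have "e \<bullet> x = adjoint M e \<bullet> (P x + Q x)" for e x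
      using adjoint_works[OF M(1), of "P x + Q x" e] by (simp add: M(2) inner_commute)
    then show ?thesis
      using sum[of _ "adjoint M _"] by (intro scalar_coordinates_imp_dirac[OF l, of p "\<lambda>e. c (adjoint M e)"]) simp
  qed
  then obtain a r where r: "r > 0" "\<And>h. supported_in h (ball p r) \<Longrightarrow> l h = a * cnj (h p)"
    by blast
  have "\<nu> \<phi> = (a / \<eta> p) * cnj (\<phi> p)" if \<phi>: "supported_in \<phi> (ball p (min r \<epsilon>))" for \<phi>
  proof -
    let ?h = "\<lambda>x. \<phi> x / \<eta> x"
    have "supported_in ?h (ball p (min r \<epsilon>))"
      by (rule supported_in_divide[OF \<phi> \<eta>(2)]) (simp add: \<eta>(4))
    then have "l ?h = a * cnj (?h p)"
      by (intro r(2)) (erule supported_in_mono, auto)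
    moreover have "(\<lambda>x. \<eta> x * ?h x) = \<phi>"
    proof
      fix x show "\<eta> x * ?h x = \<phi> x"
        using \<eta>(4)[of x] supported_in_0[OF \<phi>, of x] by (cases "\<eta> x = 0") auto
    qed
    ultimately show ?thesis
      by (simp add: l_def \<eta>(3))
  qed
  then show ?thesis
    using r(1) \<epsilon>(1) by (intro exI[of _ "a / \<eta> p"] exI[of _ "min r \<epsilon>"]) simp
qed

lemma uniform_discrete_\<Lambda>: "uniform_discrete \<Lambda>"
  unfolding \<Lambda>_def by (rule uniform_discrete_linear_vimage[OF linear_sum inj_sum discrete])

lemma support_subset: "dist_support \<nu> \<subseteq> \<Lambda>"
proof
  fix q assume q: "q \<in> dist_support \<nu>"
  show "q \<in> \<Lambda>"
  proof (rule ccontr)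
    assume "q \<notin> \<Lambda>"
    then obtain \<epsilon> where "\<epsilon> > 0" "\<And>\<phi>. supported_in \<phi> (ball q \<epsilon>) \<Longrightarrow> \<nu> \<phi> = 0"
      using locally_zero by blast
    then show False
      using q unfolding dist_support_def supported_in_def
      by (auto dest!: spec[of _ "ball q \<epsilon>"])
  qed
qed

text \<open>Every test function is a finite sum of test functions supported in sets \<open>V\<close> on which \<open>\<nu>\<close> is known to be a
  combination of Dirac masses. The summation ranges over an arbitrary finite \<open>F\<close> containing all relevant
  points, so that the local formulas can be added with one common \<open>F\<close>.\<close>

lemma given_by_measure: "given_by_measure \<nu>"
proof -
  have "\<forall>p. \<exists>a. p \<in> \<Lambda> \<longrightarrow> (\<exists>\<epsilon>>0. \<forall>\<phi>. supported_in \<phi> (ball p \<epsilon>) \<longrightarrow> \<nu> \<phi> = a * cnj (\<phi> p))"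
    using locally_dirac by blast
  then obtain a where a: "\<And>p. p \<in> \<Lambda> \<Longrightarrow> \<exists>\<epsilon>>0. \<forall>\<phi>. supported_in \<phi> (ball p \<epsilon>) \<longrightarrow> \<nu> \<phi> = a p * cnj (\<phi> p)"
    by metis
  obtain \<delta> where \<delta>: "\<delta> > 0" "\<And>x y. x \<in> \<Lambda> \<Longrightarrow> y \<in> \<Lambda> \<Longrightarrow> dist x y < \<delta> \<Longrightarrow> x = y"
    using uniform_discrete_\<Lambda> unfolding uniform_discrete_def by blast
  define good where "good V \<longleftrightarrow> (\<forall>\<phi> F. supported_in \<phi> V \<longrightarrow> finite F \<longrightarrow> F \<subseteq> \<Lambda> \<longrightarrow>
      {q. q \<in> \<Lambda> \<and> \<phi> q \<noteq> 0} \<subseteq> F \<longrightarrow> \<nu> \<phi> = (\<Sum>q\<in>F. a q * cnj (\<phi> q)))" for V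
  have "\<exists>V. open V \<and> p \<in> V \<and> good V" for p
  proof (cases "p \<in> \<Lambda>")
    case True
    then obtain \<epsilon> where \<epsilon>: "\<epsilon> > 0" "\<And>\<phi>. supported_in \<phi> (ball p \<epsilon>) \<Longrightarrow> \<nu> \<phi> = a p * cnj (\<phi> p)"
      using a by blast
    have "\<nu> \<phi> = (\<Sum>q\<in>F. a q * cnj (\<phi> q))"
      if \<phi>: "supported_in \<phi> (ball p (min \<epsilon> \<delta>))" and F: "finite F" "F \<subseteq> \<Lambda>" "{q. q \<in> \<Lambda> \<and> \<phi> q \<noteq> 0} \<subseteq> F" for \<phi> F
    proof -
      have \<phi>0: "\<phi> q = 0" if "q \<in> \<Lambda>" "q \<noteq> p" for q
        using \<delta>(2)[OF True that(1)] that(2) supported_in_0[OF \<phi>, of q] by auto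
      have "\<nu> \<phi> = a p * cnj (\<phi> p)"
        by (rule \<epsilon>(2)[OF supported_in_mono[OF \<phi>]]) auto
      also have "\<dots> = (\<Sum>q\<in>{p}. a q * cnj (\<phi> q))"
        by simp
      also have "\<dots> = (\<Sum>q\<in>insert p F. a q * cnj (\<phi> q))"
        using F \<phi>0 by (intro sum.mono_neutral_left) auto
      also have "\<dots> = (\<Sum>q\<in>F. a q * cnj (\<phi> q))"
        using F True by (intro sum.mono_neutral_right) auto
      finally show ?thesis .
    qed
    then have "good (ball p (min \<epsilon> \<delta>))"
      unfolding good_def by blast
    then show ?thesis
      using \<epsilon>(1) \<delta>(1) by (intro exI[of _ "ball p (min \<epsilon> \<delta>)"]) auto
  next
    case False
    then obtain \<epsilon> where \<epsilon>: "\<epsilon> > 0" "\<And>\<phi>. supported_in \<phi> (ball p \<epsilon>) \<Longrightarrow> \<nu> \<phi> = 0"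
      using locally_zero by blast
    have closed: "closed \<Lambda>"
      by (rule uniform_discrete_imp_closed[OF uniform_discrete_\<Lambda>])
    have "\<nu> \<phi> = (\<Sum>q\<in>F. a q * cnj (\<phi> q))"
      if \<phi>: "supported_in \<phi> (ball p \<epsilon> - \<Lambda>)" and F: "F \<subseteq> \<Lambda>" for \<phi> F
    proof -
      have "\<nu> \<phi> = 0"
        by (rule \<epsilon>(2)[OF supported_in_mono[OF \<phi>]]) auto
      moreover have "\<phi> q = 0" if "q \<in> F" for q
        using that F supported_in_0[OF \<phi>, of q] by auto
      ultimately show ?thesis
        by simp
    qed
    then have "good (ball p \<epsilon> - \<Lambda>)"
      unfolding good_def by blast
    then show ?thesis
      using \<epsilon>(1) False closed by (intro exI[of _ "ball p \<epsilon> - \<Lambda>"]) auto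
  qed
  then have "\<forall>p. \<exists>V. open V \<and> p \<in> V \<and> good V"
    by blast
  from choice[OF this] obtain V
    where V: "\<And>p. open (V p)" "\<And>p. p \<in> V p" and good: "\<And>p. good (V p)"
    by blast
  show ?thesis
  proof (rule given_by_measure_discrete[OF uniform_discrete_\<Lambda>])
    fix \<phi> :: "'a \<Rightarrow> complex" assume \<phi>: "test_function \<phi>"
    let ?F = "{q. q \<in> \<Lambda> \<and> \<phi> q \<noteq> 0}"
    note F = finite_discrete_support[OF uniform_discrete_\<Lambda> \<phi>]
    obtain I \<psi> where I: "finite I" and \<psi>: "\<And>i. i \<in> I \<Longrightarrow> test_function (\<psi> i)"
      "\<And>i. i \<in> I \<Longrightarrow> closure {x. \<psi> i x \<noteq> 0} \<subseteq> V i" "\<And>i x. \<phi> x = 0 \<Longrightarrow> \<psi> i x = 0"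
      and sum: "\<And>x. \<phi> x = (\<Sum>i\<in>I. \<psi> i x)"
      by (rule test_function_decomposition[OF \<phi> V(1,2)]) (rule that)
    have "\<nu> \<phi> = \<nu> (\<lambda>x. \<Sum>i\<in>I. \<psi> i x)"
      using sum by presburger
    also have "\<dots> = (\<Sum>i\<in>I. \<nu> (\<psi> i))"
      by (intro conj_linear_sum[OF conj_linear I] test_function_schwartz \<psi>)
    also have "\<dots> = (\<Sum>i\<in>I. \<Sum>q\<in>?F. a q * cnj (\<psi> i q))"
    proof (intro sum.cong refl)
      fix i assume "i \<in> I"
      then have "supported_in (\<psi> i) (V i)" "{q. q \<in> \<Lambda> \<and> \<psi> i q \<noteq> 0} \<subseteq> ?F"
        using \<psi> unfolding supported_in_def by auto
      then show "\<nu> (\<psi> i) = (\<Sum>q\<in>?F. a q * cnj (\<psi> i q))"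
        using good[of i] F unfolding good_def by blast
    qed
    also have "\<dots> = (\<Sum>q\<in>?F. a q * cnj (\<phi> q))"
      by (subst sum.swap) (simp add: sum_distrib_left[symmetric] sum[symmetric] cnj_sum[symmetric] del: cnj_sum)
    finally show "\<nu> \<phi> = (\<Sum>q\<in>?F. a q * cnj (\<phi> q))" .
  qed
qed

end


section \<open>Matrix-Wigner transforms\<close>

text \<open>Identifies the product space, on which block matrices act, with the vectors that matrix inversion
  refers to.\<close>

definition vec_join :: "(real^'d) \<times> (real^'d) \<Rightarrow> real^('d::finite + 'd)" where
  "vec_join z = (\<chi> i. case i of Inl i \<Rightarrow> fst z $ i | Inr i \<Rightarrow> snd z $ i)"

lemma vec_join_inject: "vec_join z = vec_join w \<Longrightarrow> z = w"
  by (auto simp: vec_join_def vec_eq_iff prod_eq_iff split: sum.splits)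

lemma vec_join_block_apply:
  fixes T :: "real^('d::finite + 'd)^('d + 'd)"
  shows "vec_join (block_apply T z) = T *v vec_join z"
proof -
  have "(\<Sum>j\<in>UNIV. M j * (case j of Inl j \<Rightarrow> f j | Inr j \<Rightarrow> g j))
      = (\<Sum>j\<in>UNIV. M (Inl j) * f j) + (\<Sum>j\<in>UNIV. M (Inr j) * g j)"
    for M :: "'d + 'd \<Rightarrow> real" and f g
    unfolding UNIV_Plus_UNIV[symmetric] by (subst sum.Plus) (auto simp: comp_def)
  then show ?thesis
    by (auto simp: vec_join_def vec_eq_iff block_apply_def split_beta matrix_vector_mult_def
        block11_def block12_def block21_def block22_def split: sum.split)
qed

lemma matrix_inv_cancel:
  assumes "invertible (A :: real^'n^'n)"
  shows "A ** matrix_inv A = mat 1" "matrix_inv A ** A = mat 1"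
  using someI_ex[OF assms[unfolded invertible_def]] unfolding matrix_inv_def by auto

lemma block_apply_matrix_inv:
  assumes "invertible T"
  shows "block_apply T (block_apply (matrix_inv T) z) = z" "block_apply (matrix_inv T) (block_apply T z) = z"
  using assms
  by (auto intro!: vec_join_inject simp: vec_join_block_apply matrix_vector_mul_assoc
      matrix_inv_cancel)

lemma linear_block_apply: "linear (block_apply T)"
  by (rule linearI)
    (auto simp: block_apply_def split_beta matrix_vector_right_distrib matrix_vector_mult_scaleR scaleR_add_right)

lemma inj_block_apply: "invertible T \<Longrightarrow> inj (block_apply T)"
  by (metis block_apply_matrix_inv(2) injI)

text \<open>The second partial Fourier transform in the extension of \<open>W\<^sub>T\<close> to distributions cancels the one in the test
  function, by Fourier inversion, and the change of variables by \<open>T\<^sup>-\<^sup>1\<close> cancels the one by \<open>T\<close>.\<close>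

lemma dist_matrix_wigner_two_tensors:
  fixes T :: "real^('d::finite + 'd)^('d + 'd)"
  assumes T: "invertible T" and \<mu>: "conj_linear \<mu>"
    and s: "schwartz \<phi>\<^sub>1" "schwartz \<psi>\<^sub>1" "schwartz \<phi>\<^sub>2" "schwartz \<psi>\<^sub>2"
    and G: "\<And>u v. G (u, v) = \<phi>\<^sub>1 u * cnj (\<psi>\<^sub>1 v) + \<phi>\<^sub>2 u * cnj (\<psi>\<^sub>2 v)"
  shows "schwartz (\<lambda>z. G (block_apply T z))"
    and "dist_matrix_wigner T \<mu> (partial_fourier (\<lambda>z. G (block_apply T z)))
      = of_real (1 / \<bar>det T\<bar>) * (\<mu> \<phi>\<^sub>1 * cnj (\<mu> \<psi>\<^sub>1) + \<mu> \<phi>\<^sub>2 * cnj (\<mu> \<psi>\<^sub>2))"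
proof -
  have "G = (\<lambda>z. \<phi>\<^sub>1 (fst z) * cnj (\<psi>\<^sub>1 (snd z)) + \<phi>\<^sub>2 (fst z) * cnj (\<psi>\<^sub>2 (snd z)))"
    using G by (auto simp: fun_eq_iff)
  then have "schwartz G"
    by (simp only:) (intro schwartz_add schwartz_tensor schwartz_cnj s)
  then show GT: "schwartz (\<lambda>z. G (block_apply T z))"
    by (rule schwartz_linear_compose[OF _ linear_block_apply inj_block_apply[OF T]])
  let ?\<Phi> = "partial_fourier (\<lambda>z. G (block_apply T z))"
  have inv: "(\<lambda>(x, t). partial_fourier ?\<Phi> (x, - t)) = (\<lambda>z. G (block_apply T z))"
    using fourier_inversion[OF schwartz_slice[OF GT]] by (auto simp: partial_fourier_def)
  have inner: "\<mu> (\<lambda>y. cnj (G (x, y))) = cnj (\<mu> (\<lambda>y. 0)) + (\<mu> \<psi>\<^sub>1 * \<phi>\<^sub>1 x + \<mu> \<psi>\<^sub>2 * \<phi>\<^sub>2 x)" for x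
    using conj_linear_add[OF \<mu> schwartz_cmult[OF s(2), of "cnj (\<phi>\<^sub>1 x)"] schwartz_cmult[OF s(4), of "cnj (\<phi>\<^sub>2 x)"]]
    by (simp add: G conj_linear_cmult[OF \<mu> s(2)] conj_linear_cmult[OF \<mu> s(4)] conj_linear_zero[OF \<mu>])
  have "dist_tensor \<mu> (dist_cnj \<mu>) G = \<mu> (\<lambda>x. \<mu> \<psi>\<^sub>1 * \<phi>\<^sub>1 x + \<mu> \<psi>\<^sub>2 * \<phi>\<^sub>2 x)"
    by (simp add: dist_tensor_def dist_cnj_def inner conj_linear_zero[OF \<mu>])
  also have "\<dots> = \<mu> \<phi>\<^sub>1 * cnj (\<mu> \<psi>\<^sub>1) + \<mu> \<phi>\<^sub>2 * cnj (\<mu> \<psi>\<^sub>2)"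
    by (simp add: conj_linear_add[OF \<mu>] conj_linear_cmult[OF \<mu>] schwartz_cmult s mult.commute)
  finally show "dist_matrix_wigner T \<mu> ?\<Phi>
      = of_real (1 / \<bar>det T\<bar>) * (\<mu> \<phi>\<^sub>1 * cnj (\<mu> \<psi>\<^sub>1) + \<mu> \<phi>\<^sub>2 * cnj (\<mu> \<psi>\<^sub>2))"
    unfolding dist_matrix_wigner_def dist_partial_fourier_def dist_pullback_def inv
    by (simp add: block_apply_matrix_inv(1)[OF T])
qed

locale discrete_matrix_wigner =
  fixes T :: "real^('d::finite + 'd)^('d + 'd)"
    and \<mu> :: "(real^'d) functional" and R S :: "(real^'d) set" and c :: "real^'d \<Rightarrow> real^'d \<Rightarrow> complex"
  assumes T: "invertible T" and \<mu>: "conj_linear \<mu>"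
    and sum: "\<And>\<Phi>. schwartz \<Phi> \<Longrightarrow>
      ((\<lambda>(r, s). c r s * dirac (r, s) \<Phi>) has_sum dist_matrix_wigner T \<mu> \<Phi>) (R \<times> S)"
begin

lemma two_tensors_eq_0:
  assumes s: "schwartz \<phi>\<^sub>1" "schwartz \<psi>\<^sub>1" "schwartz \<phi>\<^sub>2" "schwartz \<psi>\<^sub>2"
    and G: "\<And>u v. G (u, v) = \<phi>\<^sub>1 u * cnj (\<psi>\<^sub>1 v) + \<phi>\<^sub>2 u * cnj (\<psi>\<^sub>2 v)"
    and 0: "\<And>r s. r \<in> R \<Longrightarrow> s \<in> S \<Longrightarrow> partial_fourier (\<lambda>z. G (block_apply T z)) (r, s) = 0"
  shows "\<mu> \<phi>\<^sub>1 * cnj (\<mu> \<psi>\<^sub>1) + \<mu> \<phi>\<^sub>2 * cnj (\<mu> \<psi>\<^sub>2) = 0"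
proof -
  let ?\<Phi> = "partial_fourier (\<lambda>z. G (block_apply T z))"
  note tensor = dist_matrix_wigner_two_tensors[OF T \<mu> s G]
  have "((\<lambda>(r, s). c r s * dirac (r, s) ?\<Phi>) has_sum 0) (R \<times> S)"
    by (rule has_sum_0) (auto simp: dirac_def 0)
  then have "dist_matrix_wigner T \<mu> ?\<Phi> = 0"
    using has_sum_unique sum[OF schwartz_partial_fourier[OF tensor(1)]] by blast
  moreover have "det T \<noteq> 0"
    using T by (simp add: invertible_det_nz)
  ultimately show ?thesis
    unfolding tensor(2) by simp
qed

text \<open>If \<open>T (r, t) = (u, v)\<close>, then \<open>A u + B v = r\<close>. So \<open>G \<circ> T\<close> vanishes on the slice over every \<open>r \<in> R\<close>.\<close>

lemma vanishing_space_side: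
  assumes s: "schwartz \<phi>\<^sub>1" "schwartz \<psi>\<^sub>1" "schwartz \<phi>\<^sub>2" "schwartz \<psi>\<^sub>2"
    and 0: "\<And>u v. block11 (matrix_inv T) *v u + block12 (matrix_inv T) *v v \<in> R \<Longrightarrow>
      \<phi>\<^sub>1 u * cnj (\<psi>\<^sub>1 v) + \<phi>\<^sub>2 u * cnj (\<psi>\<^sub>2 v) = 0"
  shows "\<mu> \<phi>\<^sub>1 * cnj (\<mu> \<psi>\<^sub>1) + \<mu> \<phi>\<^sub>2 * cnj (\<mu> \<psi>\<^sub>2) = 0"
proof (rule two_tensors_eq_0[OF s])
  let ?G = "\<lambda>(u, v). \<phi>\<^sub>1 u * cnj (\<psi>\<^sub>1 v) + \<phi>\<^sub>2 u * cnj (\<psi>\<^sub>2 v)"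
  show "?G (u, v) = \<phi>\<^sub>1 u * cnj (\<psi>\<^sub>1 v) + \<phi>\<^sub>2 u * cnj (\<psi>\<^sub>2 v)" for u v
    by simp
  fix r s assume "r \<in> R"
  have "?G (block_apply T (r, t)) = 0" for t
  proof -
    obtain u v where uv: "block_apply T (r, t) = (u, v)" by force
    then have "block_apply (matrix_inv T) (u, v) = (r, t)"
      using block_apply_matrix_inv(2)[OF T, of "(r, t)"] by simp
    then have "block11 (matrix_inv T) *v u + block12 (matrix_inv T) *v v = r"
      by (simp add: block_apply_def)
    then show ?thesis
      using 0[of u v] \<open>r \<in> R\<close> uv by simp
  qed
  then show "partial_fourier (\<lambda>z. ?G (block_apply T z)) (r, s) = 0"
    by (simp add: partial_fourier_def fourier_def)
qed

text \<open>With \<open>F = \<phi>\<^sub>1 \<otimes> cnj \<psi>\<^sub>1 + \<phi>\<^sub>2 \<otimes> cnj \<psi>\<^sub>2\<close>, the test function to be shown to vanish for \<open>s \<in> S\<close> is the partial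
  transform of \<open>H \<circ> N\<close>, where \<open>H\<close> is the double transform of \<open>F\<close> and \<open>N\<close> is \<open>T\<close> followed by a reflection of the
  first factor. Applying the Fourier transform in the first variable as well gives the double transform
  of \<open>H \<circ> N\<close>, which at \<open>(\<xi>, s)\<close> only depends on the value of \<open>F\<close> at one point \<open>(u, v)\<close>; this point satisfies
  \<open>B\<^sub>0\<^sup>T u - D\<^sub>0\<^sup>T v = s\<close>.\<close>

lemma vanishing_frequency_side:
  assumes s: "schwartz \<phi>\<^sub>1" "schwartz \<psi>\<^sub>1" "schwartz \<phi>\<^sub>2" "schwartz \<psi>\<^sub>2"
    and 0: "\<And>u v. transpose (block12 T) *v u + - (transpose (block22 T) *v v) \<in> S \<Longrightarrow>
      \<phi>\<^sub>1 u * cnj (\<psi>\<^sub>1 v) + \<phi>\<^sub>2 u * cnj (\<psi>\<^sub>2 v) = 0"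
  shows "dist_fourier \<mu> \<phi>\<^sub>1 * cnj (dist_fourier \<mu> \<psi>\<^sub>1) + dist_fourier \<mu> \<phi>\<^sub>2 * cnj (dist_fourier \<mu> \<psi>\<^sub>2) = 0"
  unfolding dist_fourier_def
proof (rule two_tensors_eq_0)
  define F where "F = (\<lambda>z. \<phi>\<^sub>1 (fst z) * cnj (\<psi>\<^sub>1 (snd z)) + \<phi>\<^sub>2 (fst z) * cnj (\<psi>\<^sub>2 (snd z)))"
  have F: "schwartz F"
    unfolding F_def by (intro schwartz_add schwartz_tensor schwartz_cnj s)
  let ?J = "\<lambda>(u :: real^'d, v :: real^'d). (- u, v)"
  let ?G = "\<lambda>z. double_fourier F (?J z)"
  have cnj_fourier: "cnj (fourier \<psi> (- v)) = fourier (\<lambda>x. cnj (\<psi> x)) v" for \<psi> :: "real^'d \<Rightarrow> complex" and v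
  proof -
    have "cnj (fourier \<psi> (- v)) = (\<integral>t. cnj (\<psi> t * cis (- 2 * pi * (- v \<bullet> t))) \<partial>lborel)"
      unfolding fourier_def by (rule Bochner_Integration.integral_cnj[symmetric])
    also have "\<dots> = fourier (\<lambda>x. cnj (\<psi> x)) v"
      unfolding fourier_def by (intro Bochner_Integration.integral_cong refl) (simp add: cis_cnj)
    finally show ?thesis .
  qed
  show "?G (u, v) = fourier \<phi>\<^sub>1 (- u) * cnj (fourier \<psi>\<^sub>1 (- v)) + fourier \<phi>\<^sub>2 (- u) * cnj (fourier \<psi>\<^sub>2 (- v))" for u v
    unfolding F_def cnj_fourier prod.case
    by (subst fourier_likeD(2)[OF fourier_like_double_fourier]; (intro schwartz_tensor schwartz_cnj s)?)
      (simp add: double_fourier_tensor[where g = "\<lambda>x. cnj (_ x)"])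
  let ?N = "\<lambda>z. ?J (block_apply T z)"
  have J: "linear ?J" "inj ?J"
    by (auto simp: linear_iff inj_def)
  have N: "linear ?N" "inj ?N"
    using linear_compose[OF linear_block_apply J(1)] inj_compose[OF J(2) inj_block_apply[OF T]]
    by (simp_all add: comp_def)
  have GN: "schwartz (\<lambda>z. ?G (block_apply T z))"
    using schwartz_linear_compose[OF fourier_likeD(1)[OF fourier_like_double_fourier F] N] .
  obtain M where M: "linear M" "\<And>x. M (?N x) = x"
    using linear_injective_left_inverse[OF N] by (metis comp_apply id_apply)
  fix r s assume "s \<in> S"
  have "fourier (\<lambda>x. partial_fourier (\<lambda>z. ?G (block_apply T z)) (x, s)) \<xi> = 0" for \<xi>
  proof -
    define p where "p = - adjoint M (\<xi>, s)"
    have p: "p \<bullet> ?N z = - ((\<xi>, s) \<bullet> z)" for z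
      using adjoint_works[OF M(1), of "?N z" "(\<xi>, s)"] by (simp add: p_def M(2) inner_commute)
    obtain u v where uv: "p = (u, v)" by force
    have "(transpose (block12 T) *v u + - (transpose (block22 T) *v v)) \<bullet> t = s \<bullet> t" for t
    proof -
      have "(transpose X *v w) \<bullet> t = w \<bullet> (X *v t)" for X :: "real^'d^'d" and w
        by (metis dot_lmul_matrix transpose_matrix_vector)
      then show ?thesis
        using p[of "(0, t)"] by (simp add: uv block_apply_def inner_prod_def inner_diff_left)
    qed
    then have "transpose (block12 T) *v u + - (transpose (block22 T) *v v) = s"
      using vector_eq_rdot by blast
    then have "F p = 0"
      using 0[of u v] \<open>s \<in> S\<close> by (simp add: F_def uv)
    from fourier_like_inversion[OF fourier_like_double_fourier N p F this]
    have "double_fourier (\<lambda>z. ?G (block_apply T z)) (\<xi>, s) = 0" .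
    then show ?thesis
      by (simp add: double_fourier_def)
  qed
  moreover have "schwartz (\<lambda>x. partial_fourier (\<lambda>z. ?G (block_apply T z)) (x, s))"
    using schwartz_slice[OF schwartz_swap[OF schwartz_partial_fourier[OF GN]], of s] by simp
  ultimately show "partial_fourier (\<lambda>z. ?G (block_apply T z)) (r, s) = 0"
    using fourier_eq_0_imp_eq_0 by blast
qed (intro schwartz_reflect schwartz_fourier s)+

end

lemma conj_linear_dist_fourier:
  fixes \<mu> :: "'a::euclidean_space functional"
  assumes \<mu>: "conj_linear \<mu>"
  shows "conj_linear (dist_fourier \<mu>)"
  unfolding conj_linear_def dist_fourier_def
proof (intro conjI allI impI)
  note F = fourier_likeD[OF fourier_like_fourier]
  show "\<mu> (\<lambda>t. fourier (\<lambda>x. \<phi> x + \<psi> x) (- t)) = \<mu> (\<lambda>t. fourier \<phi> (- t)) + \<mu> (\<lambda>t. fourier \<psi> (- t))"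
    if "schwartz \<phi>" "schwartz \<psi>" for \<phi> \<psi>
    unfolding F(2)[OF that]
    by (intro conj_linear_add[OF \<mu>] schwartz_reflect schwartz_fourier that)
  show "\<mu> (\<lambda>t. fourier (\<lambda>x. a * \<phi> x) (- t)) = cnj a * \<mu> (\<lambda>t. fourier \<phi> (- t))" if "schwartz \<phi>" for a \<phi>
    unfolding F(3)[OF that]
    by (intro conj_linear_cmult[OF \<mu>] schwartz_reflect schwartz_fourier that)
qed

lemma inj_matrix_vector_mult: "det (M :: real^'d^'d) \<noteq> 0 \<Longrightarrow> inj ((*v) M)"
  by (simp add: invertible_det_nz[symmetric] invertible_left_inverse matrix_left_invertible_injective)


section \<open>The Cohen class\<close>

lemma integral_eq_0_imp_eq_0:
  fixes f :: "'a::euclidean_space \<Rightarrow> real"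
  assumes f: "integrable lborel f" "continuous_on UNIV f" "\<And>x. f x \<ge> 0"
    and "(\<integral>x. f x \<partial>lborel) = 0"
  shows "f x = 0"
proof (rule ccontr)
  assume "f x \<noteq> 0"
  have "open {x. f x \<noteq> 0}"
    using f(2) by (intro open_Collect_neq continuous_on_const)
  then have "\<not> negligible {x. f x \<noteq> 0}"
    using open_not_negligible \<open>f x \<noteq> 0\<close> by blast
  moreover have "AE x in lborel. f x = 0"
    using integral_nonneg_eq_0_iff_AE[OF f(1)] assms(3,4) by simp
  then have "{x. f x \<noteq> 0} \<in> null_sets lborel"
    using AE_iff_null_sets[of "{x. f x \<noteq> 0}" lborel] \<open>open {x. f x \<noteq> 0}\<close> by simp
  then have "negligible {x. f x \<noteq> 0}"
    by (simp add: negligible_iff_null_sets null_sets_completionI)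
  ultimately show False by blast
qed

lemma gaussian_prod: "gaussian (a, b) = gaussian a * gaussian b"
  by (simp add: gaussian_def norm_Pair of_real_mult[symmetric] exp_add[symmetric] algebra_simps del: of_real_mult)

lemma cnj_gaussian: "cnj (gaussian x) = gaussian x"
  by (simp add: gaussian_def)

text \<open>Decompose \<open>p = L s + q\<close> with \<open>q\<close> orthogonal to the range of \<open>L\<close>. By Pythagoras and translation invariance
  the integral over the affine subspace \<open>p + range L\<close> is \<open>gaussian q\<close> times the integral over \<open>range L\<close>.\<close>

lemma integral_gaussian_affine:
  fixes L :: "'a::euclidean_space \<Rightarrow> 'b::euclidean_space"
  assumes "linear L" "inj L"
    and "(\<integral>t. gaussian (p + L t) \<partial>lborel) = (\<integral>t. gaussian (L t) \<partial>lborel)"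
  shows "p \<in> range L"
proof -
  let ?I = "\<integral>t. gaussian (L t) \<partial>lborel"
  have "subspace (range L)"
    using assms(1) by (simp add: linear_subspace_image)
  then have "span (range L) = range L"
    by (simp add: span_eq_iff)
  then obtain s q where s: "p = L s + q" and q: "\<And>t. orthogonal q (L t)"
    using orthogonal_subspace_decomp_exists[of "range L" p] by (metis rangeE rangeI)
  have "gaussian (p + L t) = gaussian q * gaussian (L (t + s))" for t
  proof -
    have "p + L t = q + L (t + s)"
      by (simp add: s linear_add[OF assms(1)])
    then have "(norm (p + L t))\<^sup>2 = (norm q)\<^sup>2 + (norm (L (t + s)))\<^sup>2"
      using norm_add_Pythagorean[OF q] by simp
    then show ?thesis
      by (simp add: gaussian_def of_real_mult[symmetric] exp_add[symmetric] algebra_simps del: of_real_mult)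
  qed
  then have "(\<integral>t. gaussian (p + L t) \<partial>lborel) = gaussian q * (\<integral>t. gaussian (L (t + s)) \<partial>lborel)"
    by simp
  also have "(\<integral>t. gaussian (L (t + s)) \<partial>lborel) = ?I"
    by (rule integral_translate[OF borel_measurable_continuous_onI[OF
        schwartz_continuous_on[OF schwartz_linear_compose[OF schwartz_gaussian assms(1,2)]]]])
  finally have eq: "gaussian q * ?I = ?I"
    using assms(3) by simp
  have "?I \<noteq> 0"
  proof
    assume "?I = 0"
    have "?I = of_real (\<integral>t. exp (- pi * (norm (L t))\<^sup>2) \<partial>lborel)"
      unfolding gaussian_def by (rule integral_complex_of_real)
    then have 0: "(\<integral>t. exp (- pi * (norm (L t))\<^sup>2) \<partial>lborel) = 0"
      using \<open>?I = 0\<close> by simp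
    have "integrable lborel (\<lambda>t. Re (gaussian (L t)))"
      by (rule integrable_Re[OF schwartz_integrable[OF schwartz_linear_compose[OF schwartz_gaussian assms(1,2)]]])
    then have "integrable lborel (\<lambda>t. exp (- pi * (norm (L t))\<^sup>2))"
      by (simp add: gaussian_def)
    moreover have "continuous_on UNIV (\<lambda>t. exp (- pi * (norm (L t))\<^sup>2))"
      by (intro continuous_intros linear_continuous_on[OF assms(1)[unfolded linear_conv_bounded_linear]])
    ultimately have "exp (- pi * (norm (L 0))\<^sup>2) = 0"
      using 0 integral_eq_0_imp_eq_0[of "\<lambda>t. exp (- pi * (norm (L t))\<^sup>2)" 0] by simp
    then show False by simp
  qed
  then have "gaussian q = 1"
    using eq by simp
  then have "q = 0"
    by (simp add: gaussian_def)
  then show ?thesis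
    using s by simp
qed

definition time_frequency_shift ::
  "'a::euclidean_space \<Rightarrow> 'a \<Rightarrow> ('a \<Rightarrow> complex) \<Rightarrow> 'a \<Rightarrow> complex" where
  "time_frequency_shift y \<eta> f t = cis (2 * pi * (\<eta> \<bullet> t)) * f (t - y)"

lemma schwartz_time_frequency_shift:
  assumes "schwartz f"
  shows "schwartz (time_frequency_shift y \<eta> f)"
  using schwartz_moderate_mult[OF moderate_cis[of "(2 * pi) *\<^sub>R \<eta>"] schwartz_translate[OF assms]]
  by (simp add: time_frequency_shift_def[abs_def])

lemma wigner_covariant:
  "wigner (time_frequency_shift y \<eta> f) (x, \<omega>) = wigner f (x - y, \<omega> - \<eta>)"
proof -
  have half: "((1 / 2) *\<^sub>R mat 1 :: real^'d^'d) *v t = (1 / 2) *\<^sub>R t"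
    "(- (1 / 2) *\<^sub>R mat 1 :: real^'d^'d) *v t = - ((1 / 2) *\<^sub>R t)" for t
    by (subst scaleR_matrix_vector_assoc[symmetric], simp)+
  have phases: "cis (- 2 * pi * (t \<bullet> \<omega>)) * (cis (2 * pi * (\<eta> \<bullet> (x + (1/2) *\<^sub>R t))) * f1)
      * cnj (cis (2 * pi * (\<eta> \<bullet> (x + - ((1/2) *\<^sub>R t)))) * f2)
      = cis (- 2 * pi * (t \<bullet> (\<omega> - \<eta>))) * f1 * cnj f2" for t f1 f2
  proof -
    have "cis (- 2 * pi * (t \<bullet> (\<omega> - \<eta>))) = cis (- 2 * pi * (t \<bullet> \<omega>))
        * cis (2 * pi * (\<eta> \<bullet> (x + (1/2) *\<^sub>R t))) * cis (- (2 * pi * (\<eta> \<bullet> (x + - ((1/2) *\<^sub>R t)))))"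
      unfolding cis_mult by (rule arg_cong[where f = cis])
        (simp add: inner_add_right inner_diff_right inner_commute algebra_simps)
    then show ?thesis
      by (simp add: cis_cnj mult_ac)
  qed
  then show ?thesis
    unfolding wigner_def matrix_wigner_def time_frequency_shift_def block_matrix_blocks prod.case
      matrix_vector_mul_lid half phases
    by (simp add: algebra_simps)
qed

lemma cohen_class_covariant:
  assumes "in_cohen_class Q" "schwartz f"
  shows "Q (time_frequency_shift y \<eta> f) (x, \<omega>) = Q f (x - y, \<omega> - \<eta>)"
proof -
  obtain \<sigma> where \<sigma>: "\<And>f. schwartz f \<Longrightarrow> Q f = dist_convolution \<sigma> (wigner f)"
    using assms(1) unfolding in_cohen_class_def by blast
  have "wigner (time_frequency_shift y \<eta> f) ((x, \<omega>) - w) = wigner f ((x - y, \<omega> - \<eta>) - w)" for w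
    by (cases w) (simp add: wigner_covariant algebra_simps)
  then show ?thesis
    by (simp only: \<sigma> assms(2) schwartz_time_frequency_shift dist_convolution_def)
qed

lemma cos_multiples_eq_1_imp_0:
  assumes "\<And>\<eta>. cos (2 * pi * (\<eta> \<bullet> w)) = 1"
  shows "w = (0 :: 'a::real_inner)"
proof (rule ccontr)
  assume "w \<noteq> 0"
  then have "((1 / (2 * (w \<bullet> w))) *\<^sub>R w) \<bullet> w = 1 / 2"
    by simp
  then show False
    using assms[of "(1 / (2 * (w \<bullet> w))) *\<^sub>R w"] \<open>w \<noteq> 0\<close> by simp
qed

text \<open>For the Gaussian, \<open>W\<^sub>T\<close> is the Fourier transform of a positive function \<open>t \<mapsto> gaussian (T (x, t))\<close>. Covariance
  under modulation by \<open>\<eta>\<close> at \<open>\<omega> = \<eta>\<close> says that multiplying this function by a phase does not change its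
  integral. So the phase is constantly \<open>1\<close>, which gives \<open>A\<^sub>0 = C\<^sub>0\<close> and \<open>B\<^sub>0 - D\<^sub>0 = Id\<close>. Covariance under translation
  by \<open>y\<close> at \<open>x = y\<close> compares Gaussian integrals over two parallel affine subspaces, so that
  \<open>(p, p)\<close> lies in the range of \<open>t \<mapsto> (B\<^sub>0 t, D\<^sub>0 t)\<close> for \<open>p = A\<^sub>0 y - y\<close>. As \<open>B\<^sub>0 - D\<^sub>0 = Id\<close>, this forces \<open>p = 0\<close>.\<close>

lemma cohen_class_blocks:
  fixes T :: "real^('d::finite + 'd)^('d + 'd)"
  assumes T: "invertible T" and cohen: "in_cohen_class (matrix_wigner T)"
  shows "block12 T - block22 T = mat 1"
    and "block11 (matrix_inv T) + block12 (matrix_inv T) = mat 1"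
proof -
  define g where "g = (gaussian :: real^'d \<Rightarrow> complex)"
  have g: "schwartz g" "\<And>x. cnj (g x) = g x"
    by (simp_all add: g_def schwartz_gaussian cnj_gaussian)
  let ?u = "\<lambda>x t. block11 T *v x + block12 T *v t" and ?v = "\<lambda>x t. block21 T *v x + block22 T *v t"
  let ?G = "\<lambda>x t. gaussian (block_apply T (x, t))"
  have G: "g (?u x t) * g (?v x t) = ?G x t" for x t
    by (simp add: g_def block_apply_def gaussian_prod)
  have sG: "schwartz (?G x)" for x
    using schwartz_slice[OF schwartz_linear_compose[OF schwartz_gaussian linear_block_apply inj_block_apply[OF T]]] .
  have cos1: "cos (2 * pi * (\<eta> \<bullet> (?u x t - ?v x t - t))) = 1" for x t \<eta>
  proof -
    let ?\<theta> = "\<lambda>t. 2 * pi * (\<eta> \<bullet> (?u x t - ?v x t - t))"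
    have "matrix_wigner T (time_frequency_shift 0 \<eta> g) (x, \<eta>) = (\<integral>t. cis (?\<theta> t) * ?G x t \<partial>lborel)"
    proof -
      have "cis (- 2 * pi * (t \<bullet> \<eta>)) * time_frequency_shift 0 \<eta> g (?u x t)
          * cnj (time_frequency_shift 0 \<eta> g (?v x t)) = cis (?\<theta> t) * ?G x t" for t
      proof -
        have "cis (?\<theta> t) = cis (- 2 * pi * (t \<bullet> \<eta>)) * cis (2 * pi * (\<eta> \<bullet> ?u x t)) * cis (- (2 * pi * (\<eta> \<bullet> ?v x t)))"
          unfolding cis_mult by (rule arg_cong[where f = cis])
            (simp add: inner_diff_right inner_commute right_diff_distrib)
        then show ?thesis
          unfolding G[symmetric] by (simp add: time_frequency_shift_def g(2) cis_cnj mult_ac)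
      qed
      then show ?thesis
        unfolding matrix_wigner_def by simp
    qed
    moreover have "matrix_wigner T (time_frequency_shift 0 \<eta> g) (x, \<eta>) = (\<integral>t. ?G x t \<partial>lborel)"
      using cohen_class_covariant[OF cohen g(1), of 0 \<eta> x \<eta>]
      by (simp add: matrix_wigner_def g(2) G)
    ultimately have eq: "(\<integral>t. cis (?\<theta> t) * ?G x t \<partial>lborel) = (\<integral>t. ?G x t \<partial>lborel)"
      by simp
    let ?r = "\<lambda>t. exp (- pi * (norm (block_apply T (x, t)))\<^sup>2)"
    have c: "continuous_on UNIV ?\<theta>" "continuous_on UNIV (\<lambda>t. block_apply T (x, t))"
      unfolding block_apply_def prod.case
      by (intro continuous_intros matrix_vector_mult_linear_continuous_on)+
    have "complex_integrable lborel (\<lambda>t. cis (?\<theta> t) * ?G x t)"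
    proof (rule Bochner_Integration.integrable_bound[OF schwartz_integrable[OF sG[of x]]])
      show "(\<lambda>t. cis (?\<theta> t) * ?G x t) \<in> borel_measurable lborel"
        using borel_measurable_continuous_onI[OF continuous_on_mult[OF continuous_on_cis[OF c(1)]
              schwartz_continuous_on[OF sG]]] by simp
    qed (simp add: norm_mult)
    note ci = this schwartz_integrable[OF sG[of x]]
    have ReG: "Re (cis (?\<theta> t) * ?G x t) = cos (?\<theta> t) * ?r t" "Re (?G x t) = ?r t" for t
      by (simp_all add: gaussian_def)
    have i: "integrable lborel (\<lambda>t. cos (?\<theta> t) * ?r t)" "(\<integral>t. cos (?\<theta> t) * ?r t \<partial>lborel) = (\<integral>t. ?r t \<partial>lborel)"
      "integrable lborel ?r"
      using integrable_Re[OF ci(1)] integrable_Re[OF ci(2)] arg_cong[OF eq, of Re]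
      unfolding integral_Re[OF ci(1), symmetric] integral_Re[OF ci(2), symmetric] ReG by - assumption+
    have "(1 - cos (?\<theta> t)) * ?r t = 0"
    proof (rule integral_eq_0_imp_eq_0[where f = "\<lambda>t. (1 - cos (?\<theta> t)) * ?r t"])
      show "integrable lborel (\<lambda>t. (1 - cos (?\<theta> t)) * ?r t)" "(\<integral>t. (1 - cos (?\<theta> t)) * ?r t \<partial>lborel) = 0"
        using i by (simp_all add: left_diff_distrib)
      show "continuous_on UNIV (\<lambda>t. (1 - cos (?\<theta> t)) * ?r t)"
        by (intro continuous_intros c)
    qed simp
    then show ?thesis by simp
  qed
  have diff: "?u x t - ?v x t = t" for x t
    using cos_multiples_eq_1_imp_0[OF cos1] by (metis eq_iff_diff_eq_0)
  then have "(block12 T - block22 T) *v t = mat 1 *v t" for t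
    using diff[of 0 t] by (simp add: matrix_vector_mult_diff_rdistrib)
  then show "block12 T - block22 T = mat 1"
    by (simp add: matrix_eq)
  have A\<^sub>0: "block11 T *v y = y" for y
  proof -
    define p where "p = block11 T *v y - y"
    have C\<^sub>0: "block21 T *v y = block11 T *v y"
      using diff[of y 0] by simp
    let ?L = "\<lambda>t. block_apply T (0, t)"
    have "linear (\<lambda>t::real^'d. (0::real^'d, t))" "inj (\<lambda>t::real^'d. (0::real^'d, t))"
      by (auto simp: linear_iff inj_def)
    then have L: "linear ?L" "inj ?L"
      using linear_compose[OF _ linear_block_apply[of T]] inj_compose[OF inj_block_apply[OF T]]
      by (auto simp: comp_def)
    have "time_frequency_shift y 0 g (?u y t) * cnj (time_frequency_shift y 0 g (?v y t))
        = gaussian ((p, p) + ?L t)" for t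
      unfolding time_frequency_shift_def
      by (simp add: g(2)) (simp add: g_def gaussian_prod[symmetric] block_apply_def p_def C\<^sub>0 algebra_simps)
    then have "matrix_wigner T (time_frequency_shift y 0 g) (y, 0) = (\<integral>t. gaussian ((p, p) + ?L t) \<partial>lborel)"
      unfolding matrix_wigner_def by simp
    moreover have "matrix_wigner T (time_frequency_shift y 0 g) (y, 0) = (\<integral>t. gaussian (?L t) \<partial>lborel)"
      using cohen_class_covariant[OF cohen g(1), of y 0 y 0] G[of 0]
      by (simp add: matrix_wigner_def g(2))
    ultimately have "(p, p) \<in> range ?L"
      using integral_gaussian_affine[OF L] by simp
    then obtain t where "(p, p) = ?L t"
      by blast
    then have uv: "?u 0 t = p" "?v 0 t = p"
      unfolding block_apply_def by auto
    then have "t = 0"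
      using diff[of 0 t] by simp
    with uv show ?thesis
      by (simp add: p_def)
  qed
  have "(block11 (matrix_inv T) + block12 (matrix_inv T)) *v x = mat 1 *v x" for x
  proof -
    have "block_apply T (x, 0) = (x, x)"
      using A\<^sub>0[of x] diff[of x 0] by (simp add: block_apply_def)
    then have "block_apply (matrix_inv T) (x, x) = (x, 0)"
      using block_apply_matrix_inv(2)[OF T, of "(x, 0)"] by simp
    then show ?thesis
      by (simp add: block_apply_def matrix_vector_mult_add_rdistrib)
  qed
  then show "block11 (matrix_inv T) + block12 (matrix_inv T) = mat 1"
    by (simp add: matrix_eq)
qed

theorem theorem1:
  fixes T :: "real^('d::finite + 'd)^('d + 'd)"
    and A\<^sub>0 B\<^sub>0 C\<^sub>0 D\<^sub>0 A B C D :: "real^'d^'d"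
    and \<mu> :: "(real^'d) functional"
    and R S :: "(real^'d) set"
    and c :: "real^'d \<Rightarrow> real^'d \<Rightarrow> complex"
  assumes "invertible T"
    and "T = block_matrix A\<^sub>0 B\<^sub>0 C\<^sub>0 D\<^sub>0"
    and "matrix_inv T = block_matrix A B C D"
    and "tempered_distribution \<mu>"
    and "uniform_discrete R" and "uniform_discrete S"
    and "\<And>\<Phi>. schwartz \<Phi> \<Longrightarrow>
           ((\<lambda>(r, s). c r s * dirac (r, s) \<Phi>) has_sum dist_matrix_wigner T \<mu> \<Phi>) (R \<times> S)"
    and "\<forall>r\<in>R. bdd_above ((\<lambda>s. cmod (c r s)) ` S)"
    and "\<forall>s\<in>S. bdd_above ((\<lambda>r. cmod (c r s)) ` R)"
    and "det (B\<^sub>0 - D\<^sub>0) \<noteq> 0"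
    and "det (A + B) \<noteq> 0"
  shows "given_by_measure \<mu> \<and> given_by_measure (dist_fourier \<mu>) \<and>
         uniform_discrete (dist_support \<mu>) \<and>
         uniform_discrete (dist_support (dist_fourier \<mu>)) \<and>
         (in_cohen_class (matrix_wigner T) \<longrightarrow>
            dist_support \<mu> \<subseteq> R \<and> dist_support (dist_fourier \<mu>) \<subseteq> S)"
proof -
  have \<mu>: "conj_linear \<mu>"
    using assms(4) unfolding tempered_distribution_def conj_linear_def by blast
  interpret W: discrete_matrix_wigner T \<mu> R S c
    by unfold_locales (fact assms(1) \<mu> assms(7))+
  have blocks: "block12 T = B\<^sub>0" "block22 T = D\<^sub>0"
    "block11 (matrix_inv T) = A" "block12 (matrix_inv T) = B"
    unfolding assms(3) unfolding assms(2) by simp_all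
  have AB: "A *v q + B *v q = (A + B) *v q" for q
    by (simp add: matrix_vector_mult_add_rdistrib)
  have BD: "transpose B\<^sub>0 *v q + - (transpose D\<^sub>0 *v q) = transpose (B\<^sub>0 - D\<^sub>0) *v q" for q
  proof -
    have "transpose (B\<^sub>0 - D\<^sub>0) = transpose B\<^sub>0 - transpose D\<^sub>0"
      by (simp add: transpose_def vec_eq_iff)
    then show ?thesis
      by (simp add: matrix_vector_mult_diff_rdistrib)
  qed
  interpret space: tensor_square_vanishing \<mu> "(*v) A" "(*v) B" R
  proof (rule tensor_square_vanishing.intro)
    show "inj (\<lambda>q. A *v q + B *v q)"
      unfolding AB by (rule inj_matrix_vector_mult[OF assms(11)])
    show "linear ((*v) A)" "linear ((*v) B)"
      by (rule matrix_vector_mul_linear)+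
  qed (use \<mu> assms(5) W.vanishing_space_side blocks in auto)
  interpret frequency: tensor_square_vanishing "dist_fourier \<mu>"
    "\<lambda>u. transpose B\<^sub>0 *v u" "\<lambda>v. - (transpose D\<^sub>0 *v v)" S
  proof (rule tensor_square_vanishing.intro)
    show "inj (\<lambda>q. transpose B\<^sub>0 *v q + - (transpose D\<^sub>0 *v q))"
      unfolding BD using assms(10) by (intro inj_matrix_vector_mult) (simp add: det_transpose)
    show "linear ((*v) (transpose B\<^sub>0))" "linear (\<lambda>v. - (transpose D\<^sub>0 *v v))"
      by (intro linear_compose_neg matrix_vector_mul_linear)+
  qed (use conj_linear_dist_fourier[OF \<mu>] assms(6) W.vanishing_frequency_side blocks in auto)
  have "dist_support \<mu> \<subseteq> R \<and> dist_support (dist_fourier \<mu>) \<subseteq> S"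
    if "in_cohen_class (matrix_wigner T)"
  proof -
    have "A + B = mat 1" "transpose (B\<^sub>0 - D\<^sub>0) = mat 1"
      using cohen_class_blocks[OF assms(1) that] unfolding blocks by (simp_all add: transpose_mat)
    then show ?thesis
      using space.support_subset frequency.support_subset
      unfolding space.\<Lambda>_def frequency.\<Lambda>_def AB BD by simp
  qed
  then show ?thesis
    using space.given_by_measure frequency.given_by_measure
      uniform_discrete_subset[OF space.uniform_discrete_\<Lambda> space.support_subset]
      uniform_discrete_subset[OF frequency.uniform_discrete_\<Lambda> frequency.support_subset]
    by blast
qed

end
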